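(* Fix $1<q\le\infty$, $a\ge 1$, $\theta>0$, $1\le s<\infty$ with $1/s+1/s'=1$, and a weight $\omega\in RH_{s'}^{loc}$. Then there exist $C=C(q,n,a,\omega,s,\theta)$ and $K_0=K_0(n,a)\ge 1$ with the following property. Let $F,G,H_1$ be non-negative measurable functions on $\mathbb{R}^n$, $F\in L^1_{loc}$, such that for every cube $Q=Q(x_0,r)$ with $r<\rho(x_0)$ there exist non-negative functions $G_{8Q},H_{8Q}$ with $F\le G_{8Q}+H_{8Q}$ a.e. on $8Q$ and $$\Big(\frac{1}{|8Q|}\int_{8Q}H_{8Q}(y)^q\,dy\Big)^{1/q}\le a\big(M_{\rho,\theta}F(x)+H_1(\bar x)\big)\quad\text{for all }x,\bar x\in 8Q$$ (with the usual essential-supremum interpretation if $q=\infty$), and such that for every $x\in\mathbb{R}^n$ $$\sup_{Q=Q(x_0,r)\ni x,\ r<\rho(x_0)}\frac{1}{|8Q|}\int_{8Q}G_{8Q}(y)\,dy+\sup_{Q=Q(x_0,r)\ni x,\ r\ge\rho(x_0)}\frac{1}{\Psi_\theta(Q)|Q|}\int_{Q}F(y)\,dy\le G(x).$$ Then for all $\lambda>0$, $K\ge K_0$ and $0<\gamma<1$, $$\omega\{x: M_{\rho,\theta}F(x)>K\lambda,\ G(x)+H_1(x)\le\gamma\lambda\}\le C\Big(\frac{a^q}{K^q}+\frac{\gamma}{K}\Big)^{1/s}\omega\{x:M_{\rho,\theta}F(x)>\lambda\}$$ (where $a^q/K^q:=0$ if $q=\infty$). Consequently, for every $0<p<q/s$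 (every $0<p<\infty$ if $q=\infty$), $$\|M_{\rho,\theta}F\|_{L^p(\omega)}\le C\big(\|G\|_{L^p(\omega)}+\|H_1\|_{L^p(\omega)}\big)\quad\text{provided }\|M_{\rho,\theta}F\|_{L^p(\omega)}<\infty,$$ $$\|M_{\rho,\theta}F\|_{L^{p,\infty}(\omega)}\le C\big(\|G\|_{L^{p,\infty}(\omega)}+\|H_1\|_{L^{p,\infty}(\omega)}\big)\quad\text{provided }\|M_{\rho,\theta}F\|_{L^{p,\infty}(\omega)}<\infty.$$ Moreover, if $p\ge 1$, these two estimates hold whenever $F\in L^1(\mathbb{R}^n)$ (without assuming finiteness of the left-hand sides).
   Context: $\rho:\mathbb{R}^n\to(0,\infty)$ is a function for which there are constants $l_0>0$, $C_0>1$ with $C_0^{-1}(1+|x-y|/\rho(x))^{-l_0}\le \rho(y)/\rho(x)\le C_0(1+|x-y|/\rho(x))^{l_0/(l_0+1)}$ for all $x,y\in\mathbb{R}^n$. $Q(x_0,r)$ denotes the cube (sides parallel to the axes) centered at $x_0$ with side length $r$, $\lambda Q(x_0,r)=Q(x_0,\lambda r)$; $B(x_0,r)$ is the ball. For a ball or cube $B$ with center $x_0$ and radius/side length $r$, $\Psi_\theta(B)=(1+r/\rho(x_0))^\theta$. $M_{\rho,\theta}f(x)=\sup_{B\ni x}\frac{1}{\Psi_\theta(B)|B|}\int_B|f(y)|dy$. A weight is a non-negative locally integrable function, $\omega(E)=\int_E\omega$. $\omega\in RH_q^{loc}$ ($1<q<\infty$) means there is $C$ with $(\frac1{|B|}\int_B\omega^q)^{1/q}\le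 \frac{C}{|B|}\int_B\omega$ for every ball $B=B(x_0,r)$ with $r<\rho(x_0)$; $\omega\in RH_\infty^{loc}$ means $\omega(x)\le \frac{C}{|B|}\int_B\omega$ for a.e. $x\in B$ for all such balls. $\|f\|_{L^{p,\infty}(\omega)}=\sup_{\lambda>0}\lambda\,\omega\{|f|>\lambda\}^{1/p}$. *)

theory Defs
  imports "HOL-Analysis.Analysis"
begin

text \<open>Real power of an extended non-negative real (for positive exponents):
  infinity stays infinity.\<close>
definition enn_powr :: "ennreal \<Rightarrow> real \<Rightarrow> ennreal" where
  "enn_powr x p = (if x = \<infinity> then \<infinity> else ennreal (enn2real x powr p))"

definition critical_radius :: "(real^'n \<Rightarrow> real) \<Rightarrow> bool" where
  "critical_radius \<rho> \<longleftrightarrow> (\<forall>x. 0 < \<rho> x) \<and>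
     (\<exists>l0 C0::real. 0 < l0 \<and> 1 < C0 \<and> (\<forall>x y.
        inverse C0 * (1 + norm (x - y) / \<rho> x) powr (- l0) \<le> \<rho> y / \<rho> x \<and>
        \<rho> y / \<rho> x \<le> C0 * (1 + norm (x - y) / \<rho> x) powr (l0 / (l0 + 1))))"

definition cube :: "real^'n \<Rightarrow> real \<Rightarrow> (real^'n) set" where
  "cube x0 r = {y. \<forall>i. \<bar>y $ i - x0 $ i\<bar> < r / 2}"

text \<open>Psi_theta for a ball/cube with centre x0 and radius/side length r.\<close>
definition Psi :: "(real^'n \<Rightarrow> real) \<Rightarrow> real \<Rightarrow> real^'n \<Rightarrow> real \<Rightarrow> real" where
  "Psi \<rho> \<theta> x0 r = (1 + r / \<rho> x0) powr \<theta>"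

definition M_rho :: "(real^'n \<Rightarrow> real) \<Rightarrow> real \<Rightarrow> (real^'n \<Rightarrow> real) \<Rightarrow> real^'n \<Rightarrow> ennreal" where
  "M_rho \<rho> \<theta> f x = (SUP (x0, r) \<in> {(x0, r). 0 < r \<and> x \<in> ball x0 r}.
      ennreal (1 / (Psi \<rho> \<theta> x0 r * measure lebesgue (ball x0 r))) *
      (\<integral>\<^sup>+ y \<in> ball x0 r. ennreal \<bar>f y\<bar> \<partial>lebesgue))"

definition nn_avg :: "(real^'n) set \<Rightarrow> (real^'n \<Rightarrow> ennreal) \<Rightarrow> ennreal" where
  "nn_avg S f = (\<integral>\<^sup>+ y \<in> S. f y \<partial>lebesgue) / emeasure lebesgue S"

definition avg :: "(real^'n) set \<Rightarrow> (real^'n \<Rightarrow> real) \<Rightarrow> real" where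
  "avg S f = (LINT y:S|lebesgue. f y) / measure lebesgue S"

definition locally_integrable :: "(real^'n \<Rightarrow> real) \<Rightarrow> bool" where
  "locally_integrable f \<longleftrightarrow> f \<in> borel_measurable lebesgue \<and>
     (\<forall>K. compact K \<longrightarrow> set_integrable lebesgue K f)"

definition weight :: "(real^'n \<Rightarrow> real) \<Rightarrow> bool" where
  "weight w \<longleftrightarrow> (\<forall>x. 0 \<le> w x) \<and> locally_integrable w"

definition RH_loc :: "(real^'n \<Rightarrow> real) \<Rightarrow> real \<Rightarrow> (real^'n \<Rightarrow> real) \<Rightarrow> bool" where
  "RH_loc \<rho> q w \<longleftrightarrow> (\<exists>C. \<forall>x0 r. 0 < r \<and> r < \<rho> x0 \<longrightarrow>
      enn_powr (nn_avg (ball x0 r) (\<lambda>y. ennreal (w y powr q))) (1 / q)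
        \<le> ennreal (C * avg (ball x0 r) w))"

definition RH_inf_loc :: "(real^'n \<Rightarrow> real) \<Rightarrow> (real^'n \<Rightarrow> real) \<Rightarrow> bool" where
  "RH_inf_loc \<rho> w \<longleftrightarrow> (\<exists>C. \<forall>x0 r. 0 < r \<and> r < \<rho> x0 \<longrightarrow>
      (AE x in lebesgue. x \<in> ball x0 r \<longrightarrow> w x \<le> C * avg (ball x0 r) w))"

definition wmeas :: "(real^'n \<Rightarrow> real) \<Rightarrow> (real^'n) set \<Rightarrow> ennreal" where
  "wmeas w E = (\<integral>\<^sup>+ x \<in> E. ennreal (w x) \<partial>lebesgue)"

definition wLp :: "(real^'n \<Rightarrow> real) \<Rightarrow> real \<Rightarrow> (real^'n \<Rightarrow> ennreal) \<Rightarrow> ennreal" where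
  "wLp w p f = enn_powr (\<integral>\<^sup>+ x. ennreal (w x) * enn_powr (f x) p \<partial>lebesgue) (1 / p)"

definition wLp_weak :: "(real^'n \<Rightarrow> real) \<Rightarrow> real \<Rightarrow> (real^'n \<Rightarrow> ennreal) \<Rightarrow> ennreal" where
  "wLp_weak w p f = (SUP t \<in> {0<..}. ennreal t * enn_powr (wmeas w {x. ennreal t < f x}) (1 / p))"

text \<open>The hypothesis on (F, G, H1) with exponent q (q = infinity allowed), constant a,
  realised by a choice of G_{8Q}, H_{8Q} for each cube Q = Q(x0,r) with r < rho(x0).\<close>
definition good_decomp ::
  "(real^'n \<Rightarrow> real) \<Rightarrow> real \<Rightarrow> ereal \<Rightarrow> real \<Rightarrow>
   (real^'n \<Rightarrow> real) \<Rightarrow> (real^'n \<Rightarrow> real) \<Rightarrow> (real^'n \<Rightarrow> real) \<Rightarrow> bool" where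
  "good_decomp \<rho> \<theta> q a F G H1 \<longleftrightarrow>
    (\<exists>G8 H8 :: real^'n \<Rightarrow> real \<Rightarrow> real^'n \<Rightarrow> real.
      (\<forall>x0 r. 0 < r \<and> r < \<rho> x0 \<longrightarrow>
         (\<forall>y. 0 \<le> G8 x0 r y \<and> 0 \<le> H8 x0 r y) \<and>
         G8 x0 r \<in> borel_measurable lebesgue \<and> H8 x0 r \<in> borel_measurable lebesgue \<and>
         (AE y in lebesgue. y \<in> cube x0 (8 * r) \<longrightarrow> F y \<le> G8 x0 r y + H8 x0 r y) \<and>
         (\<forall>x \<in> cube x0 (8 * r). \<forall>xb \<in> cube x0 (8 * r).
            (if q = \<infinity> then
               (AE y in lebesgue. y \<in> cube x0 (8 * r) \<longrightarrow>
                  ennreal (H8 x0 r y) \<le> ennreal a * (M_rho \<rho> \<theta> F x + ennreal (H1 xb)))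
             else
               enn_powr (nn_avg (cube x0 (8 * r))
                   (\<lambda>y. ennreal (H8 x0 r y powr real_of_ereal q))) (1 / real_of_ereal q)
                 \<le> ennreal a * (M_rho \<rho> \<theta> F x + ennreal (H1 xb))))) \<and>
      (\<forall>x.
         (SUP (x0, r) \<in> {(x0, r). 0 < r \<and> r < \<rho> x0 \<and> x \<in> cube x0 r}.
             nn_avg (cube x0 (8 * r)) (\<lambda>y. ennreal (G8 x0 r y)))
         + (SUP (x0, r) \<in> {(x0, r). 0 < r \<and> \<rho> x0 \<le> r \<and> x \<in> cube x0 r}.
             ennreal (1 / (Psi \<rho> \<theta> x0 r * measure lebesgue (cube x0 r))) *
             (\<integral>\<^sup>+ y \<in> cube x0 r. ennreal (F y) \<partial>lebesgue))
         \<le> ennreal (G x)))"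

end

theory Submission
  imports Defs
begin

text \<open>
  The reverse Hoelder condition enters only through the fractional absolute continuity
  \<open>\<omega>(E) \<le> C (|E| / |B|)^(1/s) \<omega>(B)\<close> for \<open>E \<subseteq> B\<close>, where the radius of \<open>B\<close> is below the critical one.
  This implies local doubling, and it passes to the truncations \<open>min(\<omega>, N)\<close> with a constant
  independent of \<open>N\<close>.

  For the good-lambda inequality let \<open>S\<close> be its left-hand set and \<open>E = {M F > \<lambda>}\<close>. If \<open>\<gamma> / K\<close> is
  bounded below, the inequality is trivial for large \<open>C\<close>. Otherwise the bound on averages of \<open>F\<close> over
  supercritical cubes forces every ball witnessing \<open>M F > K \<lambda>\<close> at a point of \<open>S\<close> to be tiny compared
  with the critical radius; this makes the factors \<open>\<Psi>\<close> harmless, so \<open>K0\<close> does not depend on \<open>\<theta>\<close>.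
  Around \<open>x \<in> S\<close> take a ball of radius comparable to \<open>min(dist(x, -E), \<rho>(x))\<close>. If the distance is the
  minimum, a dilated cube meets \<open>-E\<close>, where \<open>M F \<le> \<lambda>\<close>, and the decomposition \<open>F \<le> G + H\<close> applies;
  otherwise the average of \<open>F\<close> at scale \<open>\<rho>(x)\<close> is at most a multiple of \<open>\<gamma> \<lambda>\<close>. In both cases a
  weak (1,1) bound controls the proportion of \<open>S\<close> in the ball, and a Vitali covering sums up.

  With \<open>a_k = K^(k p) \<omega>{M F > K^k}\<close> good-lambda becomes \<open>a_(k+1) \<le> a_k / 2 + b_k\<close>, which can be solved
  as soon as \<open>a_k\<close> is bounded for \<open>k \<rightarrow> -\<infinity>\<close>. For \<open>F \<in> L^1\<close> and \<open>p \<ge> 1\<close> the weak (1,1) bound provides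
  this for the weights \<open>min(\<omega>, N)\<close>, and one lets \<open>N \<rightarrow> \<infinity>\<close>.
\<close>

subsection \<open>Covering and weak-type estimates\<close>

text \<open>The elementary inequality x \<le> t + t^(1-\<sigma>) x^\<sigma> takes the place of both
  Hoelder's inequality (for the weight) and an L^q bound for the maximal operator (for the part H):
  cutting at a height t turns every L^q hypothesis into an L^1 bound. A single covering argument
  comparing two measures then yields the weak (1,1) bounds as well as the summation over balls for
  the weighted measure.

  The obstacle in the norm estimates is that half of the sum of the a_k can be absorbed only if it
  is finite. The local reverse Hoelder condition says nothing about \<omega> at large scales, so
  even for integrable F the a_k could be unbounded as k tends to minus infinity. For the bounded
  weights min(\<omega>, N) the Lebesgue weak (1,1) bound decides this. The price is that no constant
  may depend on the weight other than through the constant of its fractional absolute continuity,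
  which is why that constant is fixed first and the weight is quantified afterwards.\<close>

lemma Vitali_compare:
  fixes S E :: "'a::euclidean_space set"
  assumes mu: "sets \<mu> = sets lebesgue" and nu: "sets \<nu> = sets lebesgue"
    and S: "S \<in> sets lebesgue" and E: "E \<in> sets lebesgue"
    and cov: "\<And>x. x \<in> S \<Longrightarrow> \<exists>c r. 0 < r \<and> r \<le> R \<and> x \<in> ball c r \<and> ball c r \<subseteq> E \<and>
                emeasure \<mu> (S \<inter> ball c (5 * r)) \<le> k * emeasure \<nu> (ball c r)"
  shows "emeasure \<mu> S \<le> k * emeasure \<nu> E"
proof -
  \<comment> \<open>All admissible balls, with the common bound \<open>R\<close> on the radii that
    the Vitali selection requires. The selected balls are disjoint and lie in \<open>E\<close>, so
    their \<nu>-measures add up to at most that of \<open>E\<close>, while their fivefold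
    enlargements still cover \<open>S\<close>.\<close>
  define J where "J = {(c, r). 0 < r \<and> r \<le> R \<and> ball c r \<subseteq> E \<and>
                emeasure \<mu> (S \<inter> ball c (5 * r)) \<le> k * emeasure \<nu> (ball c r)}"
  have J: "\<And>i. i \<in> J \<Longrightarrow> 0 < snd i \<and> snd i \<le> R" by (auto simp: J_def)
  obtain C where C: "countable C" "C \<subseteq> J"
     "pairwise (\<lambda>i j. disjnt (cball (fst i) (snd i)) (cball (fst j) (snd j))) C"
     "\<And>i. i \<in> J \<Longrightarrow> \<exists>j. j \<in> C \<and>
                        \<not> disjnt (cball (fst i) (snd i)) (cball (fst j) (snd j)) \<and>
                        cball (fst i) (snd i) \<subseteq> ball (fst j) (5 * snd j)"
    by (rule Vitali_covering_lemma_cballs_balls[of J snd R fst, OF J]) (assumption, rule that)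
  let ?V = "\<lambda>i::'a \<times> real. ball (fst i) (snd i)"
  let ?U = "\<lambda>i::'a \<times> real. S \<inter> ball (fst i) (5 * snd i)"
  have ball[simp]: "ball c r \<in> sets lebesgue" for c :: 'a and r by simp
  have Um: "?U i \<in> sets \<mu>" for i
    unfolding mu by (intro sets.Int S ball)
  have Sm: "S \<in> sets \<mu>" unfolding mu by (rule S)
  have disj: "disjoint_family_on ?V C"
    unfolding disjoint_family_on_def
  proof (intro ballI impI)
    fix i j assume "i \<in> C" "j \<in> C" "i \<noteq> j"
    then have "disjnt (cball (fst i) (snd i)) (cball (fst j) (snd j))"
      using C(3) by (auto simp: pairwise_def)
    then show "?V i \<inter> ?V j = {}"
      by (meson ball_subset_cball disjnt_def disjnt_subset1 disjnt_subset2)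
  qed
  \<comment> \<open>The sum over the selected balls is written as an integral against counting
    measure on \<open>C\<close>, so that it can be exchanged with the integral in \<mu> and no
    enumeration of \<open>C\<close> is needed.\<close>
  have pt: "indicator S x \<le> (\<integral>\<^sup>+ i. indicator (?U i) x \<partial>count_space C)" for x :: 'a
  proof (cases "x \<in> S")
    case True
    from cov[OF this] obtain c r where cr: "(c, r) \<in> J" "x \<in> ball c r"
      unfolding J_def by blast
    from C(4)[OF cr(1)] obtain j where "j \<in> C" "cball c r \<subseteq> ball (fst j) (5 * snd j)"
      by auto
    moreover have "x \<in> cball c r" using cr(2) by simp
    ultimately have "j \<in> C" "x \<in> ?U j"
      using True by blast+
    then show ?thesis
      using nn_integral_ge_point[of j C "\<lambda>i. indicator (?U i) x"] by (simp add: True)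
  qed simp
  have "emeasure \<mu> S = (\<integral>\<^sup>+ x. indicator S x \<partial>\<mu>)"
    by (rule nn_integral_indicator[OF Sm, symmetric])
  also have "\<dots> \<le> (\<integral>\<^sup>+ x. \<integral>\<^sup>+ i. indicator (?U i) x \<partial>count_space C \<partial>\<mu>)"
    by (intro nn_integral_mono pt)
  also have "\<dots> = (\<integral>\<^sup>+ i. \<integral>\<^sup>+ x. indicator (?U i) x \<partial>\<mu> \<partial>count_space C)"
    by (intro nn_integral_count_space_nn_integral C(1) borel_measurable_indicator Um)
  also have "\<dots> \<le> (\<integral>\<^sup>+ i. k * emeasure \<nu> (?V i) \<partial>count_space C)"
  proof (intro nn_integral_mono)
    fix i assume "i \<in> space (count_space C)"
    then have "i \<in> J" using C(2) by auto
    then show "(\<integral>\<^sup>+ x. indicator (?U i) x \<partial>\<mu>) \<le> k * emeasure \<nu> (?V i)"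
      unfolding nn_integral_indicator[OF Um] by (auto simp: J_def)
  qed
  also have "\<dots> = k * (\<integral>\<^sup>+ i. emeasure \<nu> (?V i) \<partial>count_space C)"
    by (rule nn_integral_cmult) simp
  also have "\<dots> = k * emeasure \<nu> (\<Union>(?V ` C))"
    by (subst emeasure_UN_countable[OF _ C(1) disj]) (simp_all only: nu ball)
  also have "\<dots> \<le> k * emeasure \<nu> E"
  proof (intro mult_left_mono emeasure_mono)
    show "\<Union>(?V ` C) \<subseteq> E" using C(2) by (force simp: J_def)
    show "E \<in> sets \<nu>" unfolding nu by (rule E)
  qed simp
  finally show ?thesis .
qed

lemma emeasure_lebesgue_ball:
  fixes c :: "'a::euclidean_space"
  assumes "0 \<le> r"
  shows "emeasure lebesgue (ball c r) = ennreal (unit_ball_vol (real DIM('a)) * r ^ DIM('a))"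
  using assms by (simp add: emeasure_ball)

lemma measure_lebesgue_ball:
  fixes c :: "'a::euclidean_space"
  assumes "0 \<le> r"
  shows "measure lebesgue (ball c r) = unit_ball_vol (real DIM('a)) * r ^ DIM('a)"
  using assms by (simp add: content_ball)

text \<open>The comparison of t times Lebesgue measure with the measure of density f; the factor 5^n
  is the volume ratio of the Vitali enlargement. Keeping \<open>W\<close> as a parameter gives a
  localised weak (1,1) bound (with a cube) and the global one (with the whole space).\<close>

lemma weak_type_balls:
  fixes f :: "'a::euclidean_space \<Rightarrow> ennreal"
  assumes f: "f \<in> borel_measurable lebesgue" and S: "S \<in> sets lebesgue" and W: "W \<in> sets lebesgue"
    and cov: "\<And>y. y \<in> S \<Longrightarrow> \<exists>c r. 0 < r \<and> r \<le> R \<and> y \<in> ball c r \<and> ball c r \<subseteq> W \<and>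
       ennreal t * emeasure lebesgue (ball c r) \<le> (\<integral>\<^sup>+ z \<in> ball c r. f z \<partial>lebesgue)"
  shows "ennreal t * emeasure lebesgue S \<le> 5 ^ DIM('a) * (\<integral>\<^sup>+ z \<in> W. f z \<partial>lebesgue)"
proof -
  let ?m = "density lebesgue (\<lambda>_::'a. ennreal t)" and ?n = "density lebesgue f"
  have "emeasure ?m S \<le> 5 ^ DIM('a) * emeasure ?n W"
  proof (rule Vitali_compare[OF _ _ S W])
    fix y assume "y \<in> S"
    from cov[OF this] obtain c r where cr: "0 < r" "r \<le> R" "y \<in> ball c r" "ball c r \<subseteq> W"
       "ennreal t * emeasure lebesgue (ball c r) \<le> (\<integral>\<^sup>+ z \<in> ball c r. f z \<partial>lebesgue)" by blast
    have "emeasure ?m (S \<inter> ball c (5 * r)) \<le> emeasure ?m (ball c (5 * r))"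
      by (rule emeasure_mono) auto
    also have "\<dots> = ennreal t * emeasure lebesgue (ball c (5 * r))"
      by (rule emeasure_density_const) auto
    also have "emeasure lebesgue (ball c (5 * r)) = 5 ^ DIM('a) * emeasure lebesgue (ball c r)"
    proof -
      have "emeasure lebesgue (ball c (5 * r)) = ennreal (5 ^ DIM('a) * (unit_ball_vol (real DIM('a)) * r ^ DIM('a)))"
        using cr(1) by (subst emeasure_lebesgue_ball) (auto simp: power_mult_distrib mult_ac)
      also have "\<dots> = ennreal (5 ^ DIM('a)) * emeasure lebesgue (ball c r)"
        using cr(1) by (subst emeasure_lebesgue_ball) (auto intro!: ennreal_mult)
      also have "ennreal (5 ^ DIM('a)) = 5 ^ DIM('a)"
        by (metis ennreal_numeral ennreal_power zero_le_numeral)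
      finally show ?thesis .
    qed
    also have "ennreal t * (5 ^ DIM('a) * emeasure lebesgue (ball c r)) = 5 ^ DIM('a) * (ennreal t * emeasure lebesgue (ball c r))"
      by (simp add: mult_ac)
    also have "\<dots> \<le> 5 ^ DIM('a) * emeasure ?n (ball c r)"
      using cr(5) f by (intro mult_left_mono) (auto simp: emeasure_density)
    finally show "\<exists>c r. 0 < r \<and> r \<le> R \<and> y \<in> ball c r \<and> ball c r \<subseteq> W \<and>
        emeasure ?m (S \<inter> ball c (5 * r)) \<le> 5 ^ DIM('a) * emeasure ?n (ball c r)"
      using cr by blast
  qed auto
  then show ?thesis
    using emeasure_density_const[OF S, of "ennreal t"] W f by (simp add: emeasure_density)
qed

subsection \<open>Local reverse Hoelder weights\<close>

text \<open>A quantitative A-infinity condition restricted to subcritical balls. The constant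
  \<open>C\<close> is an explicit argument so that later estimates can be uniform over all weights,
  in particular all truncations, sharing it.\<close>

definition frac_abs_cont :: "(real^'n \<Rightarrow> real) \<Rightarrow> real \<Rightarrow> real \<Rightarrow> (real^'n \<Rightarrow> real) \<Rightarrow> bool" where
  "frac_abs_cont \<rho> s C w \<longleftrightarrow>
    (\<forall>x r E. 0 < r \<and> r < \<rho> x \<and> E \<in> sets lebesgue \<and> E \<subseteq> ball x r \<longrightarrow>
       wmeas w E \<le> ennreal (C * (measure lebesgue E / measure lebesgue (ball x r)) powr (1 / s))
                    * wmeas w (ball x r))"

lemma weightD:
  assumes "weight w"
  shows "0 \<le> w x" "w \<in> borel_measurable lebesgue" "(\<lambda>x. ennreal (w x)) \<in> borel_measurable lebesgue"
  using assms by (auto simp: weight_def locally_integrable_def)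

lemma wmeas_eq_emeasure:
  assumes "weight w" "E \<in> sets lebesgue"
  shows "wmeas w E = emeasure (density lebesgue (\<lambda>x. ennreal (w x))) E"
  unfolding wmeas_def by (rule emeasure_density[symmetric]) (use weightD[OF assms(1)] assms(2) in auto)

lemma wmeas_mono: "A \<subseteq> B \<Longrightarrow> wmeas w A \<le> wmeas w B"
  unfolding wmeas_def by (intro nn_integral_mono mult_left_mono) (auto simp: indicator_def)

lemma wmeas_le: "(\<And>x. x \<in> A \<Longrightarrow> v x \<le> w x) \<Longrightarrow> wmeas v A \<le> wmeas w A"
  unfolding wmeas_def by (intro nn_integral_mono) (auto simp: indicator_def ennreal_leI)

lemma lmeasurable_subset_ball:
  assumes "E \<in> sets lebesgue" "E \<subseteq> ball (x::'a::euclidean_space) r"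
  shows "E \<in> lmeasurable" "measure lebesgue E \<le> measure lebesgue (ball x r)"
proof -
  show "E \<in> lmeasurable"
    using assms lmeasurable_ball[of x r] by (metis fmeasurableI2)
  then show "measure lebesgue E \<le> measure lebesgue (ball x r)"
    using assms by (intro measure_mono_fmeasurable) auto
qed

lemma wmeas_ball:
  assumes w: "weight w"
  shows "wmeas w (ball x r) = ennreal (LINT y:ball x r|lebesgue. w y)" "0 \<le> (LINT y:ball x r|lebesgue. w y)"
proof -
  have "set_integrable lebesgue (cball x r) w"
    using w by (auto simp: weight_def locally_integrable_def)
  then have i: "set_integrable lebesgue (ball x r) w"
    by (rule set_integrable_subset) auto
  then have i: "integrable lebesgue (\<lambda>y. indicator (ball x r) y * w y)"
    by (simp add: set_integrable_def)
  have "wmeas w (ball x r) = (\<integral>\<^sup>+ y. ennreal (indicator (ball x r) y * w y) \<partial>lebesgue)"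
    unfolding wmeas_def by (intro nn_integral_cong) (auto simp: indicator_def)
  also have "\<dots> = ennreal (LINT y:ball x r|lebesgue. w y)"
    unfolding set_lebesgue_integral_def real_scaleR_def
    by (rule nn_integral_eq_integral[OF i]) (auto simp: weightD[OF w] intro!: AE_I2)
  finally show "wmeas w (ball x r) = ennreal (LINT y:ball x r|lebesgue. w y)" .
  show "0 \<le> (LINT y:ball x r|lebesgue. w y)"
    unfolding set_lebesgue_integral_def real_scaleR_def
    by (intro integral_nonneg_AE AE_I2) (auto simp: weightD[OF w])
qed

lemma emeasure_ball_eq_measure:
  "emeasure lebesgue (ball (x::'a::euclidean_space) r) = ennreal (measure lebesgue (ball x r))"
  using emeasure_eq_measure2[OF lmeasurable_ball[of x r]] .

lemma ennreal_divide_mult_cancel: "0 < v \<Longrightarrow> x / ennreal v * ennreal v = x"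
  by (simp add: ennreal_divide_times divide_ennreal)

text \<open>Above the height t one has t^(\<sigma>-1) \<le> x^(\<sigma>-1), so the second term alone
  suffices there. The height is free and is adapted to each use.\<close>

lemma le_add_powr:
  fixes x t \<sigma> :: real
  assumes "0 \<le> x" "0 < t" "1 \<le> \<sigma>"
  shows "x \<le> t + t powr (1 - \<sigma>) * x powr \<sigma>"
proof (cases "x \<le> t")
  case False
  then have "0 < x" using assms by auto
  have "x = t powr (1 - \<sigma>) * (t powr (\<sigma> - 1) * x)"
    using assms by (simp add: powr_add[symmetric] mult.assoc[symmetric])
  also have "\<dots> \<le> t powr (1 - \<sigma>) * (x powr (\<sigma> - 1) * x)"
    using False assms by (intro mult_left_mono mult_right_mono powr_mono2) auto
  also have "x powr (\<sigma> - 1) * x = x powr \<sigma>"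
    using \<open>0 < x\<close> powr_add[of x "\<sigma> - 1" 1] by simp
  finally show ?thesis using assms by simp
qed (use assms in \<open>simp add: add_increasing2\<close>)

lemma wmeas_null:
  assumes "E \<in> null_sets lebesgue"
  shows "wmeas w E = 0"
  unfolding wmeas_def by (rule nn_integral_null_set[OF assms])

text \<open>Integrating w \<le> t + t^(1-\<sigma>) w^\<sigma>, with \<sigma> the conjugate exponent
  of s, bounds w(E) by t |E| plus t^(1-\<sigma>) times the integral of w^\<sigma> over the ball, and
  the latter is controlled by the reverse Hoelder inequality. The two equal terms at the optimal
  height account for the constant \<open>2 * C\<close>.\<close>

lemma RH_loc_imp_frac_abs_cont:
  fixes w :: "real^'n \<Rightarrow> real"
  assumes w: "weight w" and s: "1 < s" and RH: "RH_loc \<rho> (s / (s - 1)) w"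
  shows "\<exists>C\<ge>1. frac_abs_cont \<rho> s C w"
proof -
  define \<sigma> where "\<sigma> = s / (s - 1)"
  have \<sigma>: "1 < \<sigma>" "1 - 1 / \<sigma> = 1 / s" "0 < \<sigma>"
    using s by (auto simp: \<sigma>_def field_simps)
  obtain C0 where C0: "\<And>x0 r. 0 < r \<Longrightarrow> r < \<rho> x0 \<Longrightarrow>
      enn_powr (nn_avg (ball x0 r) (\<lambda>y. ennreal (w y powr \<sigma>))) (1 / \<sigma>) \<le> ennreal (C0 * avg (ball x0 r) w)"
    using RH unfolding RH_loc_def \<sigma>_def by blast
  define C where "C = max 1 C0"
  have C: "1 \<le> C" "C0 \<le> C" by (auto simp: C_def)
  have "frac_abs_cont \<rho> s (2 * C) w"
    unfolding frac_abs_cont_def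
  proof (intro allI impI, elim conjE)
    fix x r E assume r: "0 < r" "r < \<rho> x" and E: "E \<in> sets lebesgue" "E \<subseteq> ball x r"
    define V where "V = measure lebesgue (ball x r)"
    define e where "e = measure lebesgue E"
    define I where "I = (LINT y:ball x r|lebesgue. w y)"
    define m where "m = I / V"
    have V: "0 < V" unfolding V_def using r(1) by (simp add: content_ball_gt_0_iff)
    have e: "e \<le> V" "emeasure lebesgue E = ennreal e" "0 \<le> e"
      using lmeasurable_subset_ball[OF E] by (auto simp: V_def e_def emeasure_eq_measure2)
    have I: "wmeas w (ball x r) = ennreal I" "0 \<le> I"
      using wmeas_ball[OF w, of x r] by (auto simp: I_def)
    have "wmeas w E \<le> ennreal (2 * C * (e / V) powr (1 / s)) * ennreal I"
    proof -
      consider "I = 0" | "e = 0" | "0 < I" "0 < e" using I(2) e(3) by fastforce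
      then show ?thesis
      proof cases
        case 1
        then show ?thesis using I(1) wmeas_mono[OF E(2), of w] by simp
      next
        case 2
        then have "E \<in> null_sets lebesgue" using E e by auto
        then show ?thesis by (simp add: wmeas_null)
      next
        case 3
        have m: "0 < m" "I = m * V" "avg (ball x r) w = m"
          using 3 V by (auto simp: m_def avg_def I_def V_def)
        define X where "X = nn_avg (ball x r) (\<lambda>y. ennreal (w y powr \<sigma>))"
        have X: "enn_powr X (1 / \<sigma>) \<le> ennreal (C * m)"
        proof -
          have "C0 * m \<le> C * m" using C m by simp
          then show ?thesis
            using C0[OF r] unfolding X_def m(3)[symmetric]
            by (meson ennreal_leI order_trans)
        qed
        then have "X \<noteq> \<infinity>" by (auto simp: enn_powr_def top_unique)
        then obtain z where z: "X = ennreal z" "0 \<le> z" by (cases X) auto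
        have "z powr (1 / \<sigma>) \<le> C * m"
          using X z C(1) m(1) by (simp add: enn_powr_def)
        then have "(z powr (1 / \<sigma>)) powr \<sigma> \<le> (C * m) powr \<sigma>"
          using \<sigma> by (intro powr_mono2) auto
        then have zle: "z \<le> (C * m) powr \<sigma>"
          using \<sigma> z by (simp add: powr_powr)
        have "(\<integral>\<^sup>+ y \<in> ball x r. ennreal (w y powr \<sigma>) \<partial>lebesgue) / ennreal V = ennreal z"
          using z unfolding X_def nn_avg_def V_def emeasure_ball_eq_measure by simp
        then have "(\<integral>\<^sup>+ y \<in> ball x r. ennreal (w y powr \<sigma>) \<partial>lebesgue) = ennreal z * ennreal V"
          using V ennreal_divide_mult_cancel by metis
        also have "\<dots> \<le> ennreal ((C * m) powr \<sigma> * V)"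
          using zle z V by (simp add: ennreal_mult[symmetric])
        finally have J: "(\<integral>\<^sup>+ y \<in> ball x r. ennreal (w y powr \<sigma>) \<partial>lebesgue) \<le> ennreal ((C * m) powr \<sigma> * V)" .
        define u where "u = e / V"
        have u: "0 < u" using 3 V by (simp add: u_def)
        have Cm: "0 < C * m" using C m by simp
        \<comment> \<open>The height that balances the two terms: with u = |E| / |B| and m the mean
          of w, each of them becomes exactly C u^(1/s) w(B).\<close>
        define t where "t = C * m * u powr (- 1 / \<sigma>)"
        have t: "0 < t" using Cm u by (simp add: t_def)
        have "wmeas w E \<le> (\<integral>\<^sup>+ y. ennreal t * indicator E y + ennreal (t powr (1 - \<sigma>)) * (ennreal (w y powr \<sigma>) * indicator (ball x r) y) \<partial>lebesgue)"
          unfolding wmeas_def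
        proof (intro nn_integral_mono)
          fix y
          have "ennreal (w y) \<le> ennreal t + ennreal (t powr (1 - \<sigma>)) * ennreal (w y powr \<sigma>)"
            using le_add_powr[OF weightD(1)[OF w] t, of \<sigma>] \<sigma> t
            by (simp add: ennreal_mult[symmetric] ennreal_plus[symmetric] del: ennreal_plus)
          then show "ennreal (w y) * indicator E y \<le> ennreal t * indicator E y + ennreal (t powr (1 - \<sigma>)) * (ennreal (w y powr \<sigma>) * indicator (ball x r) y)"
            using E(2) by (auto simp: indicator_def simp del: mem_ball)
        qed
        also have "\<dots> = ennreal t * ennreal e + ennreal (t powr (1 - \<sigma>)) * (\<integral>\<^sup>+ y \<in> ball x r. ennreal (w y powr \<sigma>) \<partial>lebesgue)"
        proof -
          have [measurable]: "w \<in> borel_measurable lebesgue" "E \<in> sets lebesgue" "ball x r \<in> sets lebesgue"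
            using weightD[OF w] E by auto
          show ?thesis
            by (subst nn_integral_add) (auto simp: nn_integral_cmult nn_integral_cmult_indicator e(2))
        qed
        also have "\<dots> \<le> ennreal t * ennreal e + ennreal (t powr (1 - \<sigma>)) * ennreal ((C * m) powr \<sigma> * V)"
          by (intro add_left_mono mult_left_mono J) auto
        also have "\<dots> = ennreal (t * e + t powr (1 - \<sigma>) * ((C * m) powr \<sigma> * V))"
          using t e V by (simp add: ennreal_mult[symmetric] ennreal_plus[symmetric] del: ennreal_plus)
        also have "t * e = C * u powr (1 / s) * I"
        proof -
          have "t * e = C * m * V * (u powr (- 1 / \<sigma>) * u)"
            using V by (simp add: t_def u_def)
          also have "u powr (- 1 / \<sigma>) * u = u powr (1 / s)"
            using u powr_add[of u "- 1 / \<sigma>" 1] \<sigma>(2) by (simp add: algebra_simps)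
          finally show ?thesis by (simp add: m(2))
        qed
        also have "t powr (1 - \<sigma>) * ((C * m) powr \<sigma> * V) = C * u powr (1 / s) * I"
        proof -
          have "t powr (1 - \<sigma>) = (C * m) powr (1 - \<sigma>) * u powr (- 1 / \<sigma> * (1 - \<sigma>))"
            using Cm u by (simp add: t_def powr_mult powr_powr)
          also have "- 1 / \<sigma> * (1 - \<sigma>) = 1 / s"
            using \<sigma> by (simp add: field_simps)
          finally have "t powr (1 - \<sigma>) * ((C * m) powr \<sigma> * V) = ((C * m) powr (1 - \<sigma>) * (C * m) powr \<sigma>) * u powr (1 / s) * V"
            by simp
          also have "(C * m) powr (1 - \<sigma>) * (C * m) powr \<sigma> = C * m"
            using Cm powr_add[of "C * m" "1 - \<sigma>" \<sigma>] by simp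
          finally show ?thesis by (simp add: m(2) mult_ac)
        qed
        finally show ?thesis
          using C I unfolding u_def by (simp add: ennreal_mult[symmetric] mult_ac)
      qed
    qed
    then show "wmeas w E \<le> ennreal (2 * C * (measure lebesgue E / measure lebesgue (ball x r)) powr (1 / s)) * wmeas w (ball x r)"
      unfolding I(1) by (simp add: e_def V_def)
  qed
  then show ?thesis using C(1) by (intro exI[of _ "2 * C"]) auto
qed

lemma RH_inf_loc_imp_frac_abs_cont:
  fixes w :: "real^'n \<Rightarrow> real"
  assumes w: "weight w" and RH: "RH_inf_loc \<rho> w"
  shows "\<exists>C\<ge>1. frac_abs_cont \<rho> 1 C w"
proof -
  obtain C0 where C0: "\<And>x0 r. 0 < r \<Longrightarrow> r < \<rho> x0 \<Longrightarrow>
      (AE x in lebesgue. x \<in> ball x0 r \<longrightarrow> w x \<le> C0 * avg (ball x0 r) w)"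
    using RH unfolding RH_inf_loc_def by blast
  define C where "C = max 1 C0"
  have C: "1 \<le> C" "C0 \<le> C" by (auto simp: C_def)
  have "frac_abs_cont \<rho> 1 C w"
    unfolding frac_abs_cont_def
  proof (intro allI impI, elim conjE)
    fix x r E assume r: "0 < r" "r < \<rho> x" and E: "E \<in> sets lebesgue" "E \<subseteq> ball x r"
    define V where "V = measure lebesgue (ball x r)"
    define e where "e = measure lebesgue E"
    define I where "I = (LINT y:ball x r|lebesgue. w y)"
    have V: "0 < V" unfolding V_def using r(1) by (simp add: content_ball_gt_0_iff)
    have e: "e \<le> V" "emeasure lebesgue E = ennreal e" "0 \<le> e"
      using lmeasurable_subset_ball[OF E] by (auto simp: V_def e_def emeasure_eq_measure2)
    have I: "wmeas w (ball x r) = ennreal I" "0 \<le> I"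
      using wmeas_ball[OF w, of x r] by (auto simp: I_def)
    have "AE y in lebesgue. ennreal (w y) * indicator E y \<le> ennreal (C * (I / V)) * indicator E y"
      using C0[OF r]
    proof (rule AE_mp, intro AE_I2 impI)
      fix y assume y: "y \<in> ball x r \<longrightarrow> w y \<le> C0 * avg (ball x r) w"
      have "C0 * (I / V) \<le> C * (I / V)" using C V I by (intro mult_right_mono) auto
      then have "y \<in> E \<Longrightarrow> w y \<le> C * (I / V)"
        using y E by (auto simp: avg_def I_def V_def)
      then show "ennreal (w y) * indicator E y \<le> ennreal (C * (I / V)) * indicator E y"
        by (auto simp: indicator_def ennreal_leI)
    qed
    then have "wmeas w E \<le> (\<integral>\<^sup>+ y. ennreal (C * (I / V)) * indicator E y \<partial>lebesgue)"
      unfolding wmeas_def by (rule nn_integral_mono_AE)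
    also have "\<dots> = ennreal (C * (I / V)) * ennreal e"
      using E by (simp add: nn_integral_cmult_indicator e)
    also have "\<dots> = ennreal (C * (e / V) powr (1 / 1)) * ennreal I"
      using C I V e by (simp add: ennreal_mult[symmetric])
    finally show "wmeas w E \<le> ennreal (C * (measure lebesgue E / measure lebesgue (ball x r)) powr (1 / 1)) * wmeas w (ball x r)"
      unfolding I(1) by (simp add: e_def V_def)
  qed
  then show ?thesis using C(1) by auto
qed


section \<open>Truncated weights and local doubling\<close>

lemma weight_trunc:
  assumes "weight w" "0 \<le> N"
  shows "weight (\<lambda>x. min (w x) N)"
  unfolding weight_def locally_integrable_def
proof (intro conjI allI impI)
  have [measurable]: "w \<in> borel_measurable lebesgue" using weightD[OF assms(1)] by auto
  show m: "(\<lambda>x. min (w x) N) \<in> borel_measurable lebesgue" by simp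
  fix x show "0 \<le> min (w x) N" using assms weightD(1)[OF assms(1), of x] by auto
next
  fix K :: "(real^'a) set" assume "compact K"
  then have w: "set_integrable lebesgue K w" and K: "K \<in> sets lebesgue"
    using assms by (auto simp: weight_def locally_integrable_def compact_imp_closed intro!: lmeasurable_compact)
  have "w \<in> borel_measurable lebesgue" using weightD[OF assms(1)] by auto
  then have "set_borel_measurable lebesgue K (\<lambda>x. min (w x) N)"
    using K unfolding set_borel_measurable_def by measurable
  then show "set_integrable lebesgue K (\<lambda>x. min (w x) N)"
    by (rule set_integrable_bound[OF w])
       (use assms weightD[OF assms(1)] in \<open>auto simp: abs_le_iff min_def intro!: AE_I2\<close>)
qed

lemma wmeas_Un:
  assumes "weight w" "A \<in> sets lebesgue" "B \<in> sets lebesgue"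
  shows "wmeas w (A \<union> B) \<le> wmeas w A + wmeas w B"
  using assms emeasure_subadditive[of A "density lebesgue (\<lambda>x. ennreal (w x))" B]
  by (simp add: wmeas_eq_emeasure sets.Un)

text \<open>If N is at least L times the mean of w, Chebyshev bounds the part of the ball where w >
  N by 1/L of its volume. The value L = (2C)^s is the one for which fractional absolute continuity
  then gives this part at most half of the w-mass; on the rest, truncation changes nothing.\<close>

lemma wmeas_trunc_ge_half:
  fixes w :: "real^'n \<Rightarrow> real"
  assumes w: "weight w" and C: "1 \<le> C" and s: "1 \<le> s" and fac: "frac_abs_cont \<rho> s C w"
    and r: "0 < r" "r < \<rho> x"
    and I: "wmeas w (ball x r) = ennreal I" "0 < I"
    and N: "(2 * C) powr s * (I / measure lebesgue (ball x r)) \<le> N"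
    and I': "wmeas (\<lambda>x. min (w x) N) (ball x r) = ennreal I'" "0 \<le> I'"
  shows "I \<le> 2 * I'"
proof -
  define V where "V = measure lebesgue (ball x r)"
  define L where "L = (2 * C) powr s"
  have V: "0 < V" unfolding V_def using r(1) by (simp add: content_ball_gt_0_iff)
  have L: "0 < L" "C * (1 / L) powr (1 / s) = 1 / 2"
    using C s by (auto simp: L_def powr_divide powr_powr)
  have N0: "0 < L * (I / V)" "L * (I / V) \<le> N" using L V I N by (auto simp: L_def V_def)
  define A where "A = {y \<in> ball x r. N < w y}"
  have [measurable]: "w \<in> borel_measurable lebesgue" "ball x r \<in> sets lebesgue" using weightD[OF w] by auto
  have "{y. N < w y} \<in> sets lebesgue" 
    using borel_measurable_less[of "\<lambda>_. N" lebesgue w] by simp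
  then have A: "A \<in> sets lebesgue" "A \<subseteq> ball x r"
    unfolding A_def by (auto simp: Collect_conj_eq simp del: mem_ball)
  have cA: "emeasure lebesgue A = ennreal (measure lebesgue A)"
    using lmeasurable_subset_ball[OF A] by (auto simp: emeasure_eq_measure2)
  have "ennreal (L * (I / V)) * ennreal (measure lebesgue A) = (\<integral>\<^sup>+ y. ennreal (L * (I / V)) * indicator A y \<partial>lebesgue)"
    using A cA by (simp add: nn_integral_cmult_indicator)
  also have "\<dots> \<le> wmeas w A"
    unfolding wmeas_def using N0 by (intro nn_integral_mono) (auto simp: indicator_def A_def intro!: ennreal_leI)
  also have "\<dots> \<le> ennreal I" using wmeas_mono[OF A(2), of w] I by simp
  finally have "L * (I / V) * measure lebesgue A \<le> I"
    using I N0 by (simp add: ennreal_mult[symmetric])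
  then have mA: "measure lebesgue A / V \<le> 1 / L"
    using I L V by (simp add: field_simps)
  have "wmeas w A \<le> ennreal (C * (measure lebesgue A / V) powr (1 / s)) * ennreal I"
    using fac r A I unfolding frac_abs_cont_def V_def by metis
  also have "\<dots> \<le> ennreal (C * (1 / L) powr (1 / s)) * ennreal I"
    using mA C s V by (intro mult_right_mono ennreal_leI mult_left_mono powr_mono2) auto
  also have "\<dots> = ennreal (I / 2)" using I L by (simp add: ennreal_mult[symmetric])
  finally have 1: "wmeas w A \<le> ennreal (I / 2)" .
  have "wmeas w (ball x r - A) \<le> wmeas (\<lambda>x. min (w x) N) (ball x r - A)"
    by (rule wmeas_le) (auto simp: A_def)
  also have "\<dots> \<le> ennreal I'" using wmeas_mono[of "ball x r - A" "ball x r" "\<lambda>x. min (w x) N"] I' by auto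
  finally have 2: "wmeas w (ball x r - A) \<le> ennreal I'" .
  have "ennreal I \<le> wmeas w A + wmeas w (ball x r - A)"
    using wmeas_Un[OF w A(1), of "ball x r - A"] A I by (simp add: Un_absorb1)
  also have "\<dots> \<le> ennreal (I / 2 + I')" using 1 2 I I' by (simp add: add_mono ennreal_plus)
  finally show ?thesis using I I' by (simp flip: ennreal_plus)
qed

text \<open>On a given ball there are two regimes. A truncation height that is large against the
  mean of w keeps half of the mass, so the bound for w is inherited. A small height makes the
  truncated weight comparable to the constant N on the ball, where the bound is that of Lebesgue
  measure. Neither regime produces a dependence on N.\<close>

lemma frac_abs_cont_trunc:
  fixes w :: "real^'n \<Rightarrow> real"
  assumes w: "weight w" and C: "1 \<le> C" and s: "1 \<le> s" and fac: "frac_abs_cont \<rho> s C w"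
  shows "\<exists>C'\<ge>1. \<forall>N>0. frac_abs_cont \<rho> s C' (\<lambda>x. min (w x) N)"
proof -
  define L where "L = (2 * C) powr s"
  have L: "1 \<le> L" using C s by (auto simp: L_def ge_one_powr_ge_zero)
  have "frac_abs_cont \<rho> s (2 * C + 2 * L) (\<lambda>x. min (w x) N)" if N: "0 < N" for N
    unfolding frac_abs_cont_def
  proof (intro allI impI, elim conjE)
    fix x r E assume r: "0 < r" "r < \<rho> x" and E: "E \<in> sets lebesgue" "E \<subseteq> ball x r"
    define V where "V = measure lebesgue (ball x r)"
    define e where "e = measure lebesgue E"
    have V: "0 < V" unfolding V_def using r(1) by (simp add: content_ball_gt_0_iff)
    have e: "e \<le> V" "emeasure lebesgue E = ennreal e" "0 \<le> e"
      using lmeasurable_subset_ball[OF E] by (auto simp: V_def e_def emeasure_eq_measure2)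
    define I where "I = (LINT y:ball x r|lebesgue. w y)"
    have I: "wmeas w (ball x r) = ennreal I" "0 \<le> I"
      using wmeas_ball[OF w, of x r] by (auto simp: I_def)
    have trunc: "\<exists>I'\<ge>0. wmeas (\<lambda>x. min (w x) n) (ball x r) = ennreal I'" if "0 \<le> n" for n
      using wmeas_ball[OF weight_trunc[OF w that], of x r] by blast
    obtain I' where I': "wmeas (\<lambda>x. min (w x) N) (ball x r) = ennreal I'" "0 \<le> I'"
      using trunc[of N] N by auto
    have "wmeas (\<lambda>x. min (w x) N) E \<le> ennreal ((2 * C + 2 * L) * (e / V) powr (1 / s)) * ennreal I'"
    proof (cases "I = 0")
      case True
      have "wmeas (\<lambda>x. min (w x) N) E \<le> wmeas w E" by (rule wmeas_le) auto
      then show ?thesis using True I(1) wmeas_mono[OF E(2), of w] by simp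
    next
      case False
      then have I0: "0 < I" using I by simp
      show ?thesis
      proof (cases "L * (I / V) \<le> N")
        case True
        then have le: "I \<le> 2 * I'"
          by (intro wmeas_trunc_ge_half[OF w C s fac r I(1) I0 _ I']) (auto simp: L_def V_def)
        have "wmeas (\<lambda>x. min (w x) N) E \<le> wmeas w E" by (rule wmeas_le) auto
        also have "\<dots> \<le> ennreal (C * (e / V) powr (1 / s)) * ennreal I"
          using fac r E I unfolding frac_abs_cont_def V_def e_def by metis
        also have "\<dots> = ennreal (C * (e / V) powr (1 / s) * I)"
          using C I by (simp add: ennreal_mult)
        also have "\<dots> \<le> ennreal ((2 * C + 2 * L) * (e / V) powr (1 / s) * I')"
        proof (rule ennreal_leI)
          have "C * (e / V) powr (1 / s) * I \<le> C * (e / V) powr (1 / s) * (2 * I')"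
            using C le by (intro mult_left_mono) auto
          also have "\<dots> \<le> (2 * C + 2 * L) * (e / V) powr (1 / s) * I'"
            using L I' by (simp add: algebra_simps)
          finally show "C * (e / V) powr (1 / s) * I \<le> (2 * C + 2 * L) * (e / V) powr (1 / s) * I'" .
        qed
        finally show ?thesis using C L I' by (simp add: ennreal_mult)
      next
        case False
        \<comment> \<open>The smallest height at which half of the mass is known to survive. As N <
          n, scaling gives (N/n) min(w, n) \<le> min(w, N), hence the mass of min(w, N) on the ball
          is at least N V / (2 L).\<close>
        define n where "n = L * (I / V)"
        have n: "0 < n" "N < n" using False L V I0 by (auto simp: n_def)
        obtain J where J: "wmeas (\<lambda>x. min (w x) n) (ball x r) = ennreal J" "0 \<le> J"
          using trunc[of n] n by auto
        have le: "I \<le> 2 * J"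
          by (intro wmeas_trunc_ge_half[OF w C s fac r I(1) I0 _ J]) (auto simp: L_def V_def n_def)
        have "ennreal (N / n * J) = ennreal (N / n) * wmeas (\<lambda>x. min (w x) n) (ball x r)"
          unfolding J using N n J by (intro ennreal_mult) auto
        also have "\<dots> = (\<integral>\<^sup>+ y. ennreal (N / n) * (ennreal (min (w y) n) * indicator (ball x r) y) \<partial>lebesgue)"
        proof -
          have [measurable]: "w \<in> borel_measurable lebesgue" "ball x r \<in> sets lebesgue" using weightD[OF w] by auto
          show ?thesis unfolding wmeas_def by (subst nn_integral_cmult) auto
        qed
        also have "\<dots> \<le> wmeas (\<lambda>x. min (w x) N) (ball x r)"
          unfolding wmeas_def
        proof (intro nn_integral_mono)
          fix y
          have "N / n * min (w y) n \<le> min (w y) N"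
          proof -
            have "N / n * min (w y) n \<le> N / n * n" using N n by (intro mult_left_mono) auto
            moreover have "N / n * min (w y) n \<le> 1 * min (w y) n" 
              using N n weightD(1)[OF w, of y] by (intro mult_right_mono) auto
            ultimately show ?thesis using n by auto
          qed
          then have "ennreal (N / n) * ennreal (min (w y) n) \<le> ennreal (min (w y) N)"
            using N n weightD(1)[OF w, of y] by (simp add: ennreal_mult[symmetric])
          then show "ennreal (N / n) * (ennreal (min (w y) n) * indicator (ball x r) y) \<le> ennreal (min (w y) N) * indicator (ball x r) y"
            by (auto simp: indicator_def)
        qed
        finally have NJ: "N / n * J \<le> I'" unfolding I' using I' by simp
        have "N / n * (I / 2) \<le> N / n * J" using le N n by (intro mult_left_mono) auto
        then have NV: "N * V \<le> 2 * L * I'"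
        proof -
          have "N / n * (I / 2) = N * V / (2 * L)" using V L I0 by (simp add: n_def)
          then have "N * V / (2 * L) \<le> I'" using NJ \<open>N / n * (I / 2) \<le> N / n * J\<close> by linarith
          then show ?thesis using L by (simp add: field_simps)
        qed
        \<comment> \<open>The linear bound is weakened to the power 1/s, which is legitimate because
          e / V \<le> 1 and 1/s \<le> 1.\<close>
        have u: "e / V \<le> (e / V) powr (1 / s)"
        proof (cases "e = 0")
          case False
          then show ?thesis
            using e V s powr_mono'[of "1 / s" 1 "e / V"] by simp
        qed simp
        have "wmeas (\<lambda>x. min (w x) N) E \<le> (\<integral>\<^sup>+ y. ennreal N * indicator E y \<partial>lebesgue)"
          unfolding wmeas_def by (intro nn_integral_mono) (auto simp: indicator_def intro!: ennreal_leI)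
        also have "\<dots> = ennreal (N * e)"
          using E N e by (simp add: nn_integral_cmult_indicator ennreal_mult)
        also have "\<dots> \<le> ennreal ((2 * C + 2 * L) * (e / V) powr (1 / s) * I')"
        proof (rule ennreal_leI)
          have "N * e = N * V * (e / V)" using V by simp
          also have "\<dots> \<le> (2 * L * I') * (e / V) powr (1 / s)"
            using mult_mono[OF NV u] e V L I' by simp
          also have "\<dots> \<le> (2 * C + 2 * L) * (e / V) powr (1 / s) * I'"
            using C I' by (simp add: algebra_simps)
          finally show "N * e \<le> (2 * C + 2 * L) * (e / V) powr (1 / s) * I'" .
        qed
        finally show ?thesis using C L I' by (simp add: ennreal_mult)
      qed
    qed
    then show "wmeas (\<lambda>x. min (w x) N) E \<le> ennreal ((2 * C + 2 * L) * (measure lebesgue E / measure lebesgue (ball x r)) powr (1 / s))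
        * wmeas (\<lambda>x. min (w x) N) (ball x r)"
      unfolding I'(1) by (simp add: e_def V_def)
  qed
  then show ?thesis using C L by (intro exI[of _ "2 * C + 2 * L"]) auto
qed

text \<open>A thin enough outer shell carries at most half of the mass, so shrinking the radius by
  the factor \<tau> costs a factor 2; this is iterated until the radius has dropped by 5, the ratio
  of the Vitali covering. Since the balls only shrink around a fixed centre, all of them stay
  subcritical. The number m is chosen before the weight.\<close>

lemma frac_abs_cont_doubling:
  fixes \<rho> :: "real^'n \<Rightarrow> real"
  assumes C: "1 \<le> C" and s: "1 \<le> s"
  shows "\<exists>m::nat. \<forall>w x r. weight w \<and> frac_abs_cont \<rho> s C w \<and> 0 < r \<and> r < \<rho> x \<longrightarrow>
           wmeas w (ball x r) \<le> 2 ^ m * wmeas w (ball x (r / 5))"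
proof -
  define h where "h = (1 / (2 * C)) powr s"
  have h: "0 < h" "h \<le> 1" "C * h powr (1 / s) = 1 / 2"
    using C s by (auto simp: h_def powr_powr powr_le1)
  define n where "n = CARD('n)"
  have n: "1 \<le> n" by (simp add: n_def Suc_leI)
  \<comment> \<open>Bernoulli's inequality turns this into 1 - \<tau>^n \<le> h for the relative
    volume of the shell, and h satisfies C h^(1/s) = 1/2. The extra 2 in the denominator keeps
    \<tau> positive.\<close>
  define \<tau> where "\<tau> = 1 - h / (2 * real n)"
  have \<tau>: "0 < \<tau>" "\<tau> < 1" using h n by (auto simp: \<tau>_def field_simps)
  have "1 + real n * (- (h / (2 * real n))) \<le> (1 + (- (h / (2 * real n)))) ^ n"
    using h n by (intro Bernoulli_inequality) (auto simp: field_simps)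
  then have \<tau>n: "1 - \<tau> ^ n \<le> h" using h n by (simp add: \<tau>_def)
  have step: "wmeas w (ball x r) \<le> 2 * wmeas w (ball x (\<tau> * r))" if w: "weight w" and fac: "frac_abs_cont \<rho> s C w" and r: "0 < r" "r < \<rho> x" for w x r
  proof -
    define E where "E = ball x r - ball x (\<tau> * r)"
    have \<tau>r: "0 < \<tau> * r" "\<tau> * r \<le> r" using \<tau> r by (auto simp: mult_le_cancel_right1)
    have sub: "ball x (\<tau> * r) \<subseteq> ball x r" using \<tau>r by (intro subset_ball)
    have E: "E \<in> sets lebesgue" "E \<subseteq> ball x r" by (auto simp: E_def)
    have U: "E \<union> ball x (\<tau> * r) = ball x r" using sub by (auto simp: E_def)
    have "measure lebesgue E = measure lebesgue (ball x r) - measure lebesgue (ball x (\<tau> * r))"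
      unfolding E_def by (rule measurable_measure_Diff) (use sub in auto)
    also have "\<dots> = (1 - \<tau> ^ n) * measure lebesgue (ball x r)"
      using r \<tau>r by (simp add: measure_lebesgue_ball content_ball n_def power_mult_distrib algebra_simps)
    finally have mE: "measure lebesgue E / measure lebesgue (ball x r) = 1 - \<tau> ^ n"
      using r by (simp add: content_ball_gt_0_iff)
    obtain I where I: "wmeas w (ball x r) = ennreal I" "0 \<le> I" using wmeas_ball[OF w, of x r] by blast
    obtain J where J: "wmeas w (ball x (\<tau> * r)) = ennreal J" "0 \<le> J" using wmeas_ball[OF w, of x "\<tau> * r"] by blast
    have "wmeas w E \<le> ennreal (C * (1 - \<tau> ^ n) powr (1 / s)) * ennreal I"
      using fac r E I mE unfolding frac_abs_cont_def by metis
    also have "\<dots> \<le> ennreal (C * h powr (1 / s)) * ennreal I"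
      using \<tau>n C s \<tau> by (intro mult_right_mono ennreal_leI mult_left_mono powr_mono2) (auto simp: power_le_one)
    also have "\<dots> = ennreal (I / 2)" using h I by (simp add: ennreal_mult[symmetric])
    finally have "wmeas w E \<le> ennreal (I / 2)" .
    moreover have "ennreal I \<le> wmeas w E + wmeas w (ball x (\<tau> * r))"
      using wmeas_Un[OF w E(1), of "ball x (\<tau> * r)"] I U by simp
    ultimately have "ennreal I \<le> ennreal (I / 2) + ennreal J"
      using J by (metis add_right_mono order_trans)
    then have "I \<le> 2 * J" using I J by (simp flip: ennreal_plus)
    then show ?thesis using I J by (simp add: ennreal_mult[symmetric] flip: ennreal_numeral)
  qed
  have iter: "wmeas w (ball x r) \<le> 2 ^ k * wmeas w (ball x (\<tau> ^ k * r))" if w: "weight w" and fac: "frac_abs_cont \<rho> s C w" and r: "0 < r" "r < \<rho> x" for w x r k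
  proof (induction k)
    case (Suc k)
    have "\<tau> ^ k * r \<le> 1 * r" using \<tau> r by (intro mult_right_mono) (auto simp: power_le_one)
    then have "\<tau> ^ k * r < \<rho> x" using r by linarith
    then have "wmeas w (ball x (\<tau> ^ k * r)) \<le> 2 * wmeas w (ball x (\<tau> * (\<tau> ^ k * r)))"
      using \<tau> r by (intro step w fac) auto
    then have "2 ^ k * wmeas w (ball x (\<tau> ^ k * r)) \<le> 2 ^ k * (2 * wmeas w (ball x (\<tau> * (\<tau> ^ k * r))))"
      by (rule mult_left_mono) simp
    with Suc show ?case by (simp add: mult_ac)
  qed simp
  obtain m where m: "\<tau> ^ m < 1 / 5" using real_arch_pow_inv[of "1/5" \<tau>] \<tau> by auto
  have "wmeas w (ball x r) \<le> 2 ^ m * wmeas w (ball x (r / 5))" if w: "weight w" and fac: "frac_abs_cont \<rho> s C w" and r: "0 < r" "r < \<rho> x" for w x r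
  proof -
    have "\<tau> ^ m * r \<le> r / 5" using m r by (simp add: field_simps)
    then have "wmeas w (ball x (\<tau> ^ m * r)) \<le> wmeas w (ball x (r / 5))"
      by (intro wmeas_mono subset_ball)
    then show ?thesis using iter[OF w fac r, of m] by (meson mult_left_mono order_trans zero_le)
  qed
  then show ?thesis by blast
qed

subsection \<open>The maximal operator and the decomposition hypothesis\<close>

lemma Psi_ge_1: "0 < \<rho> x \<Longrightarrow> 0 \<le> r \<Longrightarrow> 0 \<le> \<theta> \<Longrightarrow> 1 \<le> Psi \<rho> \<theta> x r"
  unfolding Psi_def by (intro ge_one_powr_ge_zero) auto

text \<open>The supremum runs over all balls containing the point, so a ball that witnesses a large
  value at one of its points does so at all of them. Openness provides measurability and, later, a
  positive distance to the complement.\<close>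

lemma open_M_rho_superlevel: "open {x. t < M_rho \<rho> \<theta> f x}"
proof -
  have "{x. t < M_rho \<rho> \<theta> f x} = \<Union>((\<lambda>(c, r). ball c r) ` {(c, r). 0 < r \<and>
      t < ennreal (1 / (Psi \<rho> \<theta> c r * measure lebesgue (ball c r))) * (\<integral>\<^sup>+ y \<in> ball c r. ennreal \<bar>f y\<bar> \<partial>lebesgue)})"
    by (auto simp: M_rho_def less_SUP_iff; blast)
  also have "open \<dots>" by (intro open_Union) auto
  finally show ?thesis .
qed

lemma M_rho_measurable: "M_rho \<rho> \<theta> f \<in> borel_measurable lebesgue"
proof (rule borel_measurableI_greater)
  show "{x \<in> space lebesgue. t < M_rho \<rho> \<theta> f x} \<in> sets lebesgue" for t
    using open_M_rho_superlevel[of t \<rho> \<theta> f] by simp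
qed

lemma M_rho_gtD:
  fixes x :: "real^'n"
  assumes "ennreal t < M_rho \<rho> \<theta> f x" "\<And>x. 0 < \<rho> x" "0 \<le> t"
  obtains c r where "0 < r" "x \<in> ball c r"
    "ennreal (t * Psi \<rho> \<theta> c r * measure lebesgue (ball c r)) < (\<integral>\<^sup>+ y \<in> ball c r. ennreal \<bar>f y\<bar> \<partial>lebesgue)"
proof -
  obtain c r where cr: "0 < r" "x \<in> ball c r"
    "ennreal t < ennreal (1 / (Psi \<rho> \<theta> c r * measure lebesgue (ball c r))) * (\<integral>\<^sup>+ y \<in> ball c r. ennreal \<bar>f y\<bar> \<partial>lebesgue)"
    using assms(1) by (auto simp: M_rho_def less_SUP_iff)
  define P where "P = Psi \<rho> \<theta> c r * measure lebesgue (ball c r)"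
  have "0 < 1 + r / \<rho> c" using assms(2)[of c] cr(1) by (simp add: add_pos_pos)
  then have P: "0 < P" using cr(1) unfolding P_def Psi_def by (simp add: content_ball_gt_0_iff)
  have "ennreal (t * P) < (\<integral>\<^sup>+ y \<in> ball c r. ennreal \<bar>f y\<bar> \<partial>lebesgue)"
  proof (rule ccontr)
    assume "\<not> ?thesis"
    then have "ennreal (1 / P) * (\<integral>\<^sup>+ y \<in> ball c r. ennreal \<bar>f y\<bar> \<partial>lebesgue) \<le> ennreal (1 / P) * ennreal (t * P)"
      by (intro mult_left_mono) auto
    also have "\<dots> = ennreal t" using P assms(3) by (simp add: ennreal_mult[symmetric])
    finally show False using cr(3) by (simp add: P_def)
  qed
  then show ?thesis using that[OF cr(1,2)] by (simp add: P_def mult.assoc)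
qed

lemma integral_ball_le_M_rho:
  fixes x :: "real^'n"
  assumes "M_rho \<rho> \<theta> f x \<le> ennreal t" "\<And>x. 0 < \<rho> x" "0 \<le> t" "0 < r" "x \<in> ball c r"
  shows "(\<integral>\<^sup>+ y \<in> ball c r. ennreal \<bar>f y\<bar> \<partial>lebesgue) \<le> ennreal (t * Psi \<rho> \<theta> c r * measure lebesgue (ball c r))"
proof -
  define P where "P = Psi \<rho> \<theta> c r * measure lebesgue (ball c r)"
  have "0 < 1 + r / \<rho> c" using assms(2)[of c] assms(4) by (simp add: add_pos_pos)
  then have P: "0 < P" using assms(4) unfolding P_def Psi_def by (simp add: content_ball_gt_0_iff)
  let ?I = "\<integral>\<^sup>+ y \<in> ball c r. ennreal \<bar>f y\<bar> \<partial>lebesgue"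
  have "ennreal (1 / P) * ?I \<le> M_rho \<rho> \<theta> f x"
    unfolding M_rho_def using assms(4,5) by (intro SUP_upper2[of "(c, r)"]) (auto simp: P_def)
  with assms(1) have "ennreal (1 / P) * ?I \<le> ennreal t" by (rule order_trans[rotated])
  then have "ennreal P * (ennreal (1 / P) * ?I) \<le> ennreal P * ennreal t"
    by (intro mult_left_mono) auto
  moreover have "ennreal P * (ennreal (1 / P) * ?I) = ?I"
    using P by (simp add: mult.assoc[symmetric] ennreal_mult[symmetric])
  ultimately show ?thesis using P assms(3) by (simp add: ennreal_mult[symmetric] P_def mult_ac)
qed

section \<open>Cubes, and the two suprema of the decomposition hypothesis\<close>

lemma cube_eq_box:
  fixes x :: "real^'n"
  shows "cube x r = box (x - (\<chi> i. r / 2)) (x + (\<chi> i. r / 2))"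
proof -
  have "y \<in> cube x r \<longleftrightarrow> y \<in> box (x - (\<chi> i. r / 2)) (x + (\<chi> i. r / 2))" for y
  proof -
    have "\<bar>y $ i - x $ i\<bar> < r / 2 \<longleftrightarrow> x $ i - r / 2 < y $ i \<and> y $ i < x $ i + r / 2" for i by linarith
    then show ?thesis by (simp add: cube_def mem_box_cart)
  qed
  then show ?thesis by blast
qed

lemma sets_cube[measurable]: "cube x r \<in> sets lebesgue"
  by (simp add: cube_eq_box)

lemma emeasure_cube:
  fixes x :: "real^'n"
  assumes "0 \<le> r"
  shows "emeasure lebesgue (cube x r) = ennreal (r ^ CARD('n))"
proof -
  let ?l = "x - (\<chi> i. r / 2)" and ?u = "x + (\<chi> i. r / 2)"
  have d: "?u - ?l = (\<chi> i. r)" by (simp add: vec_eq_iff)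
  have b: "(\<chi> i. r) \<bullet> b = r" if "b \<in> Basis" for b :: "real^'n"
    using that by (auto simp: Basis_vec_def inner_axis)
  have le: "?l \<bullet> b \<le> ?u \<bullet> b" if "b \<in> Basis" for b
  proof -
    have "(?u - ?l) \<bullet> b = r" unfolding d by (rule b[OF that])
    then show ?thesis using assms inner_diff_left[of ?u ?l b] by linarith
  qed
  have "emeasure lborel (box ?l ?u) = ennreal (\<Prod>b\<in>Basis. (?u - ?l) \<bullet> b)"
    by (rule emeasure_lborel_box) (use le in auto)
  also have "(\<Prod>b\<in>Basis. (?u - ?l) \<bullet> b) = r ^ CARD('n)"
    unfolding d by (simp add: b)
  finally show ?thesis by (simp add: cube_eq_box)
qed

lemma measure_cube: "0 \<le> r \<Longrightarrow> measure lebesgue (cube (x::real^'n) r) = r ^ CARD('n)"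
  unfolding measure_def by (subst emeasure_cube) auto

lemma ball_subset_cube:
  fixes x :: "real^'n"
  assumes "dist c x + r \<le> l / 2"
  shows "ball c r \<subseteq> cube x l"
proof
  fix y assume y: "y \<in> ball c r"
  have "\<bar>y $ i - x $ i\<bar> < l / 2" for i
  proof -
    have "\<bar>y $ i - x $ i\<bar> \<le> dist y x"
      using component_le_norm_cart[of "y - x" i] by (simp add: dist_norm)
    also have "\<dots> \<le> dist c y + dist c x" by (metis dist_commute dist_triangle add.commute)
    also have "\<dots> < l / 2" using y assms by simp
    finally show ?thesis .
  qed
  then show "y \<in> cube x l" by (simp add: cube_def)
qed

lemma cube_mono:
  assumes "r \<le> l"
  shows "cube c r \<subseteq> cube c l"
proof
  fix y assume y: "y \<in> cube c r"
  have "\<bar>y $ i - c $ i\<bar> < l / 2" for i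
  proof -
    have "\<bar>y $ i - c $ i\<bar> < r / 2" using y by (simp add: cube_def)
    then show ?thesis using assms by linarith
  qed
  then show "y \<in> cube c l" by (simp add: cube_def)
qed

lemma good_decomp_large_cube:
  fixes x :: "real^'n"
  assumes gd: "good_decomp \<rho> \<theta> q a F G H1" and pos: "0 < \<rho> c"
    and r: "\<rho> c \<le> r" "x \<in> cube c r" and G: "0 \<le> G x"
  shows "(\<integral>\<^sup>+ y \<in> cube c r. ennreal (F y) \<partial>lebesgue) \<le> ennreal (G x * Psi \<rho> \<theta> c r * r ^ CARD('n))"
proof -
  have r0: "0 < r" using r pos by linarith
  define P where "P = Psi \<rho> \<theta> c r * r ^ CARD('n)"
  have "0 < 1 + r / \<rho> c" using pos r0 by (simp add: add_pos_pos)
  then have P: "0 < P" using r0 unfolding P_def Psi_def by simp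
  let ?I = "\<integral>\<^sup>+ y \<in> cube c r. ennreal (F y) \<partial>lebesgue"
  obtain S where "\<And>x. S x + (SUP (x0, r) \<in> {(x0, r). 0 < r \<and> \<rho> x0 \<le> r \<and> x \<in> cube x0 r}.
             ennreal (1 / (Psi \<rho> \<theta> x0 r * measure lebesgue (cube x0 r))) *
             (\<integral>\<^sup>+ y \<in> cube x0 r. ennreal (F y) \<partial>lebesgue)) \<le> ennreal (G x)"
    using gd unfolding good_decomp_def by (elim exE conjE) (rule that, erule spec)
  then have "(SUP (x0, r) \<in> {(x0, r). 0 < r \<and> \<rho> x0 \<le> r \<and> x \<in> cube x0 r}.
             ennreal (1 / (Psi \<rho> \<theta> x0 r * measure lebesgue (cube x0 r))) *
             (\<integral>\<^sup>+ y \<in> cube x0 r. ennreal (F y) \<partial>lebesgue)) \<le> ennreal (G x)"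
    by (rule order_trans[rotated]) (rule add_increasing[OF zero_le order_refl])
  moreover have "ennreal (1 / P) * ?I \<le> (SUP (x0, r) \<in> {(x0, r). 0 < r \<and> \<rho> x0 \<le> r \<and> x \<in> cube x0 r}.
             ennreal (1 / (Psi \<rho> \<theta> x0 r * measure lebesgue (cube x0 r))) *
             (\<integral>\<^sup>+ y \<in> cube x0 r. ennreal (F y) \<partial>lebesgue))"
    using r r0 by (intro SUP_upper2[of "(c, r)"]) (auto simp: P_def measure_cube)
  ultimately have "ennreal (1 / P) * ?I \<le> ennreal (G x)" by (rule order_trans[rotated])
  then have "ennreal P * (ennreal (1 / P) * ?I) \<le> ennreal P * ennreal (G x)"
    by (intro mult_left_mono) auto
  moreover have "ennreal P * (ennreal (1 / P) * ?I) = ?I"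
    using P by (simp add: mult.assoc[symmetric] ennreal_mult[symmetric])
  ultimately show ?thesis using P G by (simp add: ennreal_mult[symmetric] P_def mult_ac)
qed

text \<open>With argument \<open>a / K\<close> this is a^q / K^q. The case distinction is essential:
  \<open>real_of_ereal \<infinity>\<close> is 0, so the plain power of a positive argument would be
  1 instead of the intended 0.\<close>

definition decay :: "ereal \<Rightarrow> real \<Rightarrow> real" where
  "decay q x = (if q = \<infinity> then 0 else x powr real_of_ereal q)"

lemma decay_nonneg: "0 \<le> decay q x"
  by (simp add: decay_def)

text \<open>F can exceed half of the level K \<lambda> only through a function f with small
  integral. For q = \<infinity> the part H stays below that half and f is the part G. For finite q
  the inequality of \<open>le_add_powr\<close> moves the excess of H into f, at the price of the L^q
  mean of H. The average of G is controlled through x, which lies in the undilated cube.\<close>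

lemma good_decomp_small_cube:
  fixes x z c :: "real^'n"
  assumes gd: "good_decomp \<rho> \<theta> q a F G H1"
    and nonneg: "\<And>x. 0 \<le> F x" "\<And>x. 0 \<le> G x" "\<And>x. 0 \<le> H1 x"
    and q: "1 < q" and a: "1 \<le> a" and r: "0 < r" "r < \<rho> c"
    and x: "x \<in> cube c r" "G x \<le> \<gamma> * lam" "H1 x \<le> lam"
    and z: "z \<in> cube c (8 * r)" "M_rho \<rho> \<theta> F z \<le> ennreal lam"
    and lam: "0 < lam" and \<gamma>: "0 < \<gamma>" and K: "4 * a \<le> K"
  shows "\<exists>f. f \<in> borel_measurable lebesgue \<and>
      (AE y in lebesgue. y \<in> cube c (8 * r) \<longrightarrow> ennreal (F y) \<le> ennreal (K * lam / 2) + f y) \<and>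
      (\<integral>\<^sup>+ y \<in> cube c (8 * r). f y \<partial>lebesgue)
         \<le> ennreal ((8 * r) ^ CARD('n) * (K * lam) * ((1 + decay q 4) * (decay q (a / K) + \<gamma> / K)))"
proof -
  obtain G8 H8 :: "real^'n \<Rightarrow> real \<Rightarrow> real^'n \<Rightarrow> real" where GH:
      "\<forall>x0 r. 0 < r \<and> r < \<rho> x0 \<longrightarrow>
         (\<forall>y. 0 \<le> G8 x0 r y \<and> 0 \<le> H8 x0 r y) \<and>
         G8 x0 r \<in> borel_measurable lebesgue \<and> H8 x0 r \<in> borel_measurable lebesgue \<and>
         (AE y in lebesgue. y \<in> cube x0 (8 * r) \<longrightarrow> F y \<le> G8 x0 r y + H8 x0 r y) \<and>
         (\<forall>x \<in> cube x0 (8 * r). \<forall>xb \<in> cube x0 (8 * r).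
            (if q = \<infinity> then
               (AE y in lebesgue. y \<in> cube x0 (8 * r) \<longrightarrow>
                  ennreal (H8 x0 r y) \<le> ennreal a * (M_rho \<rho> \<theta> F x + ennreal (H1 xb)))
             else
               enn_powr (nn_avg (cube x0 (8 * r))
                   (\<lambda>y. ennreal (H8 x0 r y powr real_of_ereal q))) (1 / real_of_ereal q)
                 \<le> ennreal a * (M_rho \<rho> \<theta> F x + ennreal (H1 xb))))"
      and Gs: "\<forall>x. (SUP (x0, r) \<in> {(x0, r). 0 < r \<and> r < \<rho> x0 \<and> x \<in> cube x0 r}.
             nn_avg (cube x0 (8 * r)) (\<lambda>y. ennreal (G8 x0 r y)))
         + (SUP (x0, r) \<in> {(x0, r). 0 < r \<and> \<rho> x0 \<le> r \<and> x \<in> cube x0 r}.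
             ennreal (1 / (Psi \<rho> \<theta> x0 r * measure lebesgue (cube x0 r))) *
             (\<integral>\<^sup>+ y \<in> cube x0 r. ennreal (F y) \<partial>lebesgue))
         \<le> ennreal (G x)"
    using gd unfolding good_decomp_def by (elim exE conjE) (rule that)
  have Gs': "(SUP (x0, r) \<in> {(x0, r). 0 < r \<and> r < \<rho> x0 \<and> x \<in> cube x0 r}.
             nn_avg (cube x0 (8 * r)) (\<lambda>y. ennreal (G8 x0 r y))) \<le> ennreal (G x)"
    by (rule order_trans[OF add_increasing2[OF zero_le order_refl] Gs[rule_format, of x]])
  define g where "g = G8 c r"
  define h where "h = H8 c r"
  define Q where "Q = cube c (8 * r)"
  define V where "V = (8 * r) ^ CARD('n)"
  \<comment> \<open>Half of the level. The requirement 4 a \<le> K says exactly that the bound 2 a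
    \<lambda> for the mean of H does not exceed t.\<close>
  define t where "t = K * lam / 2"
  have V: "0 < V" "emeasure lebesgue Q = ennreal V"
    using r emeasure_cube[of "8 * r" c] by (auto simp: V_def Q_def)
  have Kpos: "4 \<le> K" using a K by linarith
  have t: "0 < t" "2 * a * lam \<le> t" using a K lam Kpos mult_right_mono[OF K, of lam] by (auto simp: t_def)
  note GH' = GH[rule_format, OF conjI, OF r, folded g_def h_def Q_def]
  have gh: "\<And>y. 0 \<le> g y" "\<And>y. 0 \<le> h y" and [measurable]: "g \<in> borel_measurable lebesgue" "h \<in> borel_measurable lebesgue"
    and Fle: "AE y in lebesgue. y \<in> Q \<longrightarrow> F y \<le> g y + h y"
    using GH' by auto
  have [measurable]: "Q \<in> sets lebesgue" by (simp add: Q_def)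
  have "cube c r \<subseteq> Q" using r unfolding Q_def by (intro cube_mono) simp
  with x have xQ: "x \<in> Q" by blast
  \<comment> \<open>Here it matters that the hypothesis allows two independent points of the dilated
    cube: the maximal function is small at z, while \<open>H1\<close> is small at x.\<close>
  have bd: "ennreal a * (M_rho \<rho> \<theta> F z + ennreal (H1 x)) \<le> ennreal (2 * a * lam)"
  proof -
    have "M_rho \<rho> \<theta> F z + ennreal (H1 x) \<le> ennreal (2 * lam)"
      using add_mono[OF z(2) ennreal_leI[OF x(3)]] lam by (simp flip: ennreal_plus)
    then have "ennreal a * (M_rho \<rho> \<theta> F z + ennreal (H1 x)) \<le> ennreal a * ennreal (2 * lam)"
      by (intro mult_left_mono) auto
    then show ?thesis using a lam by (simp add: ennreal_mult[symmetric] mult_ac)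
  qed
  have "nn_avg Q (\<lambda>y. ennreal (g y)) \<le> ennreal (G x)"
    using Gs' r x(1) unfolding SUP_le_iff g_def Q_def by auto
  then have "(\<integral>\<^sup>+ y \<in> Q. ennreal (g y) \<partial>lebesgue) / ennreal V * ennreal V \<le> ennreal (G x) * ennreal V"
    unfolding nn_avg_def V(2) by (rule mult_right_mono) simp
  then have "(\<integral>\<^sup>+ y \<in> Q. ennreal (g y) \<partial>lebesgue) \<le> ennreal (G x) * ennreal V"
    using V by (simp add: ennreal_divide_mult_cancel)
  also have "\<dots> \<le> ennreal (\<gamma> * lam) * ennreal V"
    using x by (intro mult_right_mono ennreal_leI) auto
  finally have gI: "(\<integral>\<^sup>+ y \<in> Q. ennreal (g y) \<partial>lebesgue) \<le> ennreal (\<gamma> * lam * V)"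
    using \<gamma> lam V by (simp add: ennreal_mult)
  have gK: "\<gamma> * lam * V = V * (K * lam) * (\<gamma> / K)" using Kpos by simp
  show ?thesis
  proof (cases "q = \<infinity>")
    case True
    have hb: "AE y in lebesgue. y \<in> Q \<longrightarrow> ennreal (h y) \<le> ennreal a * (M_rho \<rho> \<theta> F z + ennreal (H1 x))"
      using GH' z(1) xQ True by (auto simp: Q_def)
    have "AE y in lebesgue. y \<in> Q \<longrightarrow> ennreal (F y) \<le> ennreal t + ennreal (g y)"
      using Fle hb
    proof eventually_elim
      case (elim y)
      show ?case
      proof
        assume y: "y \<in> Q"
        then have "ennreal (h y) \<le> ennreal t"
          using elim(2) bd t by (meson ennreal_leI order_trans)
        then have "h y \<le> t" using t by simp
        then have "F y \<le> t + g y" using elim(1) y by simp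
        then show "ennreal (F y) \<le> ennreal t + ennreal (g y)"
          using t gh by (simp flip: ennreal_plus)
      qed
    qed
    moreover have "(\<lambda>y. ennreal (g y)) \<in> borel_measurable lebesgue" by simp
    moreover have "\<gamma> * lam * V = V * (K * lam) * ((1 + decay q 4) * (decay q (a / K) + \<gamma> / K))"
      unfolding gK using True by (simp add: decay_def)
    ultimately show ?thesis
      using gI unfolding Q_def V_def t_def by (intro exI[of _ "\<lambda>y. ennreal (g y)"] conjI) (assumption, assumption, metis)
  next
    case False
    define \<sigma> where "\<sigma> = real_of_ereal q"
    have \<sigma>: "1 < \<sigma>" "0 < \<sigma>" using q False by (cases q; simp add: \<sigma>_def)+
    define X where "X = nn_avg Q (\<lambda>y. ennreal (h y powr \<sigma>))"
    have "enn_powr X (1 / \<sigma>) \<le> ennreal a * (M_rho \<rho> \<theta> F z + ennreal (H1 x))"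
      using GH' z(1) xQ False by (auto simp: Q_def X_def \<sigma>_def)
    then have X: "enn_powr X (1 / \<sigma>) \<le> ennreal (2 * a * lam)" using bd by (rule order_trans)
    then have "X \<noteq> \<infinity>" by (auto simp: enn_powr_def top_unique)
    then obtain u where u: "X = ennreal u" "0 \<le> u" by (cases X) auto
    have "u powr (1 / \<sigma>) \<le> 2 * a * lam"
      using X u a lam by (simp add: enn_powr_def)
    then have "(u powr (1 / \<sigma>)) powr \<sigma> \<le> (2 * a * lam) powr \<sigma>"
      using \<sigma> by (intro powr_mono2) auto
    then have ule: "u \<le> (2 * a * lam) powr \<sigma>"
      using \<sigma> u by (simp add: powr_powr)
    have "(\<integral>\<^sup>+ y \<in> Q. ennreal (h y powr \<sigma>) \<partial>lebesgue) / ennreal V = ennreal u"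
      using u unfolding X_def nn_avg_def V(2) by simp
    then have "(\<integral>\<^sup>+ y \<in> Q. ennreal (h y powr \<sigma>) \<partial>lebesgue) = ennreal u * ennreal V"
      using V ennreal_divide_mult_cancel by metis
    also have "\<dots> \<le> ennreal ((2 * a * lam) powr \<sigma> * V)"
      using ule u V by (simp add: ennreal_mult[symmetric])
    finally have hI: "(\<integral>\<^sup>+ y \<in> Q. ennreal (h y powr \<sigma>) \<partial>lebesgue) \<le> ennreal ((2 * a * lam) powr \<sigma> * V)" .
    define f where "f y = ennreal (g y) + ennreal (t powr (1 - \<sigma>)) * ennreal (h y powr \<sigma>)" for y
    have "AE y in lebesgue. y \<in> Q \<longrightarrow> ennreal (F y) \<le> ennreal t + f y"
      using Fle
    proof eventually_elim
      case (elim y)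
      show ?case
      proof
        assume y: "y \<in> Q"
        have "h y \<le> t + t powr (1 - \<sigma>) * h y powr \<sigma>"
          using gh t \<sigma> by (intro le_add_powr) auto
        then have "F y \<le> t + (g y + t powr (1 - \<sigma>) * h y powr \<sigma>)" using elim y by simp
        then have "ennreal (F y) \<le> ennreal (t + (g y + t powr (1 - \<sigma>) * h y powr \<sigma>))" by (rule ennreal_leI)
        then show "ennreal (F y) \<le> ennreal t + f y"
          using t gh by (simp add: f_def ennreal_mult)
      qed
    qed
    moreover have "f \<in> borel_measurable lebesgue" unfolding f_def by measurable
    moreover have "(\<integral>\<^sup>+ y \<in> Q. f y \<partial>lebesgue) \<le> ennreal (V * (K * lam) * ((1 + decay q 4) * (decay q (a / K) + \<gamma> / K)))"
    proof -
      have "(\<integral>\<^sup>+ y \<in> Q. f y \<partial>lebesgue) = (\<integral>\<^sup>+ y. ennreal (g y) * indicator Q y + ennreal (t powr (1 - \<sigma>)) * (ennreal (h y powr \<sigma>) * indicator Q y) \<partial>lebesgue)"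
        unfolding f_def by (intro nn_integral_cong) (auto simp: indicator_def)
      also have "\<dots> = (\<integral>\<^sup>+ y \<in> Q. ennreal (g y) \<partial>lebesgue) + ennreal (t powr (1 - \<sigma>)) * (\<integral>\<^sup>+ y \<in> Q. ennreal (h y powr \<sigma>) \<partial>lebesgue)"
        by (subst nn_integral_add) (auto simp: nn_integral_cmult)
      also have "\<dots> \<le> ennreal (\<gamma> * lam * V) + ennreal (t powr (1 - \<sigma>)) * ennreal ((2 * a * lam) powr \<sigma> * V)"
        by (intro add_mono gI mult_left_mono hI) auto
      also have "\<dots> = ennreal (\<gamma> * lam * V + t powr (1 - \<sigma>) * ((2 * a * lam) powr \<sigma> * V))"
        using V \<gamma> lam by (simp add: ennreal_mult[symmetric])
      also have "\<dots> \<le> ennreal (V * (K * lam) * ((1 + decay q 4) * (decay q (a / K) + \<gamma> / K)))"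
      proof (rule ennreal_leI)
        \<comment> \<open>Expressing the bound for H as a multiple of the cutting height makes all
          powers of t combine to a single factor t; the remaining 4^q is the origin of
          \<open>decay q 4\<close> in the constant.\<close>
        have eq: "2 * a * lam = t * (4 * (a / K))" using Kpos by (simp add: t_def)
        have "t powr (1 - \<sigma>) * (2 * a * lam) powr \<sigma> = t powr (1 - \<sigma>) * (t powr \<sigma> * (4 powr \<sigma> * (a / K) powr \<sigma>))"
          by (simp only: eq powr_mult)
        also have "\<dots> = t * (4 powr \<sigma> * (a / K) powr \<sigma>)"
          using t powr_add[of t "1 - \<sigma>" \<sigma>] by (simp add: mult.assoc[symmetric])
        also have "\<dots> \<le> K * lam * (decay q 4 * decay q (a / K))"
          using False lam Kpos by (auto simp: decay_def \<sigma>_def t_def intro!: mult_right_mono)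
        finally have "t powr (1 - \<sigma>) * ((2 * a * lam) powr \<sigma> * V) \<le> K * lam * (decay q 4 * decay q (a / K)) * V"
          using V by (metis mult.assoc mult_right_mono less_imp_le)
        then have "\<gamma> * lam * V + t powr (1 - \<sigma>) * ((2 * a * lam) powr \<sigma> * V)
          \<le> V * (K * lam) * (\<gamma> / K) + V * (K * lam) * (decay q 4 * decay q (a / K))"
          using gK by (simp add: mult_ac)
        also have "\<dots> = V * (K * lam) * (decay q 4 * decay q (a / K) + \<gamma> / K)" by (simp add: algebra_simps)
        also have "\<dots> \<le> V * (K * lam) * ((1 + decay q 4) * (decay q (a / K) + \<gamma> / K))"
        proof (rule mult_left_mono)
          have "0 \<le> decay q 4 * (\<gamma> / K)" "0 \<le> decay q (a / K)" using \<gamma> Kpos by (auto simp: decay_nonneg)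
          then show "decay q 4 * decay q (a / K) + \<gamma> / K \<le> (1 + decay q 4) * (decay q (a / K) + \<gamma> / K)"
            by (simp add: algebra_simps)
        qed (use V Kpos lam in auto)
        finally show "\<gamma> * lam * V + t powr (1 - \<sigma>) * ((2 * a * lam) powr \<sigma> * V) \<le> V * (K * lam) * ((1 + decay q 4) * (decay q (a / K) + \<gamma> / K))" .
      qed
      finally show ?thesis .
    qed
    ultimately show ?thesis unfolding Q_def V_def t_def by blast
  qed
qed

subsection \<open>The good-lambda inequality\<close>

lemma critical_radius_pos: "critical_radius \<rho> \<Longrightarrow> 0 < \<rho> x"
  by (simp add: critical_radius_def)

text \<open>Within distance \<rho>(x) the factor 1 + |x - y| / \<rho>(x) lies between 1 and 2. Since
  l0 / (l0 + 1) \<le> l0, the single constant C0 2^l0 serves for both directions.\<close>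

lemma critical_radius_compare:
  fixes \<rho> :: "real^'n \<Rightarrow> real"
  assumes "critical_radius \<rho>"
  shows "\<exists>A\<ge>1. \<forall>x y. dist x y \<le> \<rho> x \<longrightarrow> \<rho> x \<le> A * \<rho> y \<and> \<rho> y \<le> A * \<rho> x"
proof -
  obtain l0 C0 where l: "0 < l0" "1 < C0" and pos: "\<And>x. 0 < \<rho> x" and
    bd: "\<And>x y. inverse C0 * (1 + norm (x - y) / \<rho> x) powr (- l0) \<le> \<rho> y / \<rho> x \<and>
        \<rho> y / \<rho> x \<le> C0 * (1 + norm (x - y) / \<rho> x) powr (l0 / (l0 + 1))"
    using assms unfolding critical_radius_def by auto
  define A where "A = C0 * 2 powr l0"
  have A: "1 \<le> A" using l mult_mono[of 1 C0 1 "2 powr l0"] by (auto simp: A_def ge_one_powr_ge_zero)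
  have "\<rho> x \<le> A * \<rho> y \<and> \<rho> y \<le> A * \<rho> x" if d: "dist x y \<le> \<rho> x" for x y
  proof -
    define u where "u = norm (x - y) / \<rho> x"
    have u: "0 \<le> u" "u \<le> 1" using d pos[of x] by (auto simp: u_def dist_norm)
    have "inverse C0 * 2 powr (- l0) \<le> inverse C0 * (1 + u) powr (- l0)"
      using u l by (intro mult_left_mono powr_mono2') auto
    also have "\<dots> \<le> \<rho> y / \<rho> x" using bd by (simp add: u_def)
    finally have "inverse A \<le> \<rho> y / \<rho> x" by (simp add: A_def powr_minus)
    then have 1: "\<rho> x \<le> A * \<rho> y" using pos[of x] A by (simp add: field_simps)
    have "\<rho> y / \<rho> x \<le> C0 * (1 + u) powr (l0 / (l0 + 1))" using bd by (simp add: u_def)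
    also have "\<dots> \<le> C0 * 2 powr (l0 / (l0 + 1))"
      using u l by (intro mult_left_mono powr_mono2) auto
    also have "\<dots> \<le> A" unfolding A_def
      using l by (intro mult_left_mono powr_mono) (auto simp: field_simps)
    finally show ?thesis using 1 pos[of x] by (simp add: field_simps)
  qed
  with A show ?thesis by blast
qed

text \<open>The covering radii in the good-lambda argument are proportional to \<rho>; this supplies
  their uniform bound on bounded sets, by comparison with \<rho>(0).\<close>

lemma critical_radius_bounded:
  fixes \<rho> :: "real^'n \<Rightarrow> real"
  assumes "critical_radius \<rho>"
  shows "\<exists>B. \<forall>x. norm x \<le> R \<longrightarrow> \<rho> x \<le> B"
proof -
  obtain l0 C0 where l: "0 < l0" "1 < C0" and pos: "\<And>x. 0 < \<rho> x" and
    bd: "\<And>x y. \<rho> y / \<rho> x \<le> C0 * (1 + norm (x - y) / \<rho> x) powr (l0 / (l0 + 1))"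
    using assms unfolding critical_radius_def by auto
  have "\<rho> x \<le> C0 * (1 + R / \<rho> 0) powr (l0 / (l0 + 1)) * \<rho> 0" if "norm x \<le> R" for x
  proof -
    have "\<rho> x / \<rho> 0 \<le> C0 * (1 + norm x / \<rho> 0) powr (l0 / (l0 + 1))" using bd[of x 0] by simp
    also have "\<dots> \<le> C0 * (1 + R / \<rho> 0) powr (l0 / (l0 + 1))"
      using l that pos[of 0] by (intro mult_left_mono powr_mono2 add_left_mono divide_right_mono) (auto simp: add_nonneg_nonneg)
    finally show ?thesis using pos[of 0] by (simp add: field_simps)
  qed
  then show ?thesis by blast
qed

lemma ennreal_mult_le_mult:
  assumes "ennreal a * ennreal b \<le> ennreal c * ennreal d" "0 \<le> a" "0 \<le> b" "0 \<le> c" "0 \<le> d"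
  shows "a * b \<le> c * d"
  using assms by (simp add: ennreal_mult[symmetric])

text \<open>The witness ball sits in the concentric cube of side l = max(2r, \<rho>(c)), which is
  supercritical and contains y, so the mean of F there is at most \<gamma> \<lambda> up to \<Psi>.
  If 2r dominates, \<Psi> and the volume change only by fixed factors and the assumption
  \<open>small\<close> contradicts the large mean on the ball. If \<rho>(c) dominates, then \<Psi> =
  2^\<theta> and comparing volumes gives the claim.\<close>

lemma superlevel_ball_small:
  fixes y c :: "real^'n"
  assumes pos: "\<And>x. 0 < \<rho> x" and gd: "good_decomp \<rho> \<theta> q a F G H1"
    and G: "0 \<le> G y" "G y \<le> \<gamma> * lam" and lam: "0 < lam" and \<gamma>: "0 < \<gamma>" and K: "0 < K" and \<theta>: "0 < \<theta>"
    and \<epsilon>: "0 < \<epsilon>" "\<epsilon> \<le> 1 / 2"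
    and small: "\<gamma> * 2 powr \<theta> \<le> K * unit_ball_vol (real CARD('n)) * \<epsilon> ^ CARD('n)"
    and B: "0 < r" "y \<in> ball c r"
    and big: "ennreal (K * lam * Psi \<rho> \<theta> c r * measure lebesgue (ball c r)) < (\<integral>\<^sup>+ z \<in> ball c r. ennreal (F z) \<partial>lebesgue)"
  shows "r < \<epsilon> * \<rho> c"
proof -
  define n where "n = CARD('n)"
  define v where "v = unit_ball_vol (real CARD('n))"
  have v: "0 < v" by (simp add: v_def unit_ball_vol_pos)
  define l where "l = max (2 * r) (\<rho> c)"
  have sub: "ball c r \<subseteq> cube c l" by (rule ball_subset_cube) (auto simp: l_def)
  have "(\<integral>\<^sup>+ z \<in> ball c r. ennreal (F z) \<partial>lebesgue) \<le> (\<integral>\<^sup>+ z \<in> cube c l. ennreal (F z) \<partial>lebesgue)"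
    using sub by (intro nn_integral_mono) (auto simp: indicator_def simp del: mem_ball)
  also have "\<dots> \<le> ennreal (G y * Psi \<rho> \<theta> c l * l ^ n)"
    unfolding n_def using B sub by (intro good_decomp_large_cube[OF gd pos] G) (auto simp: l_def simp del: mem_ball)
  finally have "ennreal (K * lam * Psi \<rho> \<theta> c r * measure lebesgue (ball c r)) < ennreal (G y * Psi \<rho> \<theta> c l * l ^ n)"
    using big by simp
  moreover have P1: "1 \<le> Psi \<rho> \<theta> c r" "1 \<le> Psi \<rho> \<theta> c l"
    using pos[of c] B \<theta> by (auto intro!: Psi_ge_1 simp: l_def)
  moreover have mb: "measure lebesgue (ball c r) = v * r ^ n"
    using B measure_lebesgue_ball[of r c] by (simp add: v_def n_def)
  ultimately have "K * lam * Psi \<rho> \<theta> c r * (v * r ^ n) < G y * Psi \<rho> \<theta> c l * l ^ n"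
    using K lam v B G by (simp add: ennreal_less_iff)
  also have "\<dots> \<le> \<gamma> * lam * Psi \<rho> \<theta> c l * l ^ n"
    using P1 G B by (intro mult_right_mono) (auto simp: l_def)
  finally have main: "K * lam * Psi \<rho> \<theta> c r * (v * r ^ n) < \<gamma> * lam * Psi \<rho> \<theta> c l * l ^ n" .
  show ?thesis
  proof (cases "\<rho> c \<le> 2 * r")
    case True
    then have l: "l = 2 * r" by (simp add: l_def)
    have "Psi \<rho> \<theta> c l \<le> (2 * (1 + r / \<rho> c)) powr \<theta>"
      unfolding Psi_def l using pos[of c] B \<theta> by (intro powr_mono2) (auto simp: add_nonneg_nonneg)
    also have "\<dots> = 2 powr \<theta> * Psi \<rho> \<theta> c r"
      unfolding Psi_def by (rule powr_mult)
    finally have "\<gamma> * lam * Psi \<rho> \<theta> c l * l ^ n \<le> \<gamma> * lam * (2 powr \<theta> * Psi \<rho> \<theta> c r) * l ^ n"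
      using \<gamma> lam B l by (intro mult_right_mono mult_left_mono) auto
    also have "\<dots> = (\<gamma> * 2 powr \<theta>) * (lam * Psi \<rho> \<theta> c r * l ^ n)" by simp
    also have "\<dots> \<le> (K * v * \<epsilon> ^ n) * (lam * Psi \<rho> \<theta> c r * l ^ n)"
      using small lam P1 l B unfolding v_def n_def by (intro mult_right_mono) auto
    \<comment> \<open>The bound \<epsilon> \<le> 1/2 cancels the factor 2^n from l = 2r. The
      resulting chain contradicts \<open>main\<close>, so this case does not occur.\<close>
    also have "\<dots> \<le> (K * v * (1 / 2) ^ n) * (lam * Psi \<rho> \<theta> c r * l ^ n)"
      using \<epsilon> K v lam P1 l B by (intro mult_right_mono mult_left_mono power_mono) auto
    also have "\<dots> = K * lam * Psi \<rho> \<theta> c r * (v * r ^ n)"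
      by (simp add: l power_mult_distrib power_divide)
    finally show ?thesis using main by simp
  next
    case False
    then have l: "l = \<rho> c" by (simp add: l_def)
    have "K * lam * v * r ^ n \<le> K * lam * Psi \<rho> \<theta> c r * (v * r ^ n)"
      using mult_left_mono[OF P1(1), of "K * lam * v * r ^ n"] K lam v B by (simp add: mult_ac)
    also have "\<dots> < \<gamma> * lam * 2 powr \<theta> * \<rho> c ^ n"
      using main pos[of c] by (simp add: l Psi_def)
    also have "\<dots> = (\<gamma> * 2 powr \<theta>) * (lam * \<rho> c ^ n)" by simp
    also have "\<dots> \<le> (K * v * \<epsilon> ^ n) * (lam * \<rho> c ^ n)"
      using small lam pos[of c] unfolding v_def n_def by (intro mult_right_mono) auto
    also have "\<dots> = K * lam * v * (\<epsilon> * \<rho> c) ^ n" by (simp add: power_mult_distrib)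
    finally have "r ^ n < (\<epsilon> * \<rho> c) ^ n" using K lam v by simp
    then show ?thesis using \<epsilon> pos[of c] by (intro power_less_imp_less_base[of r n]) auto
  qed
qed

text \<open>The measure estimate concerns the ball of half the radius, so that its points are within
  \<rho>(x)/8 of x and every witness ball through them is known to be small. Each condition on
  \<epsilon> has one purpose: 16 A^2 \<epsilon> \<le> 1 transfers smallness from the centre of a
  witness ball to x, and (1 + 3 \<epsilon>)^\<theta> \<le> 2 controls \<Psi> on tripled witness
  balls.\<close>

lemma local_good_lambda:
  fixes \<rho> :: "real^'n \<Rightarrow> real"
  assumes pos: "\<And>x. 0 < \<rho> x"
    and A: "1 \<le> A" and cmp: "\<And>x y. dist x y \<le> \<rho> x \<Longrightarrow> \<rho> x \<le> A * \<rho> y \<and> \<rho> y \<le> A * \<rho> x"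
    and nonneg: "\<And>x. 0 \<le> F x" "\<And>x. 0 \<le> G x" "\<And>x. 0 \<le> H1 x"
    and meas: "F \<in> borel_measurable lebesgue" "G \<in> borel_measurable lebesgue" "H1 \<in> borel_measurable lebesgue"
    and gd: "good_decomp \<rho> \<theta> q a F G H1"
    and q: "1 < q" and a: "1 \<le> a" and \<theta>: "0 < \<theta>" and lam: "0 < lam" and \<gamma>: "0 < \<gamma>" "\<gamma> < 1"
    and K: "4 * a \<le> K" "2 * 3 ^ CARD('n) \<le> K"
    and \<epsilon>: "0 < \<epsilon>" "16 * A ^ 2 * \<epsilon> \<le> 1" "(1 + 3 * \<epsilon>) powr \<theta> \<le> 2"
    and small: "\<gamma> * 2 powr \<theta> \<le> K * unit_ball_vol (real CARD('n)) * \<epsilon> ^ CARD('n)"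
    and S_def: "S = {x. ennreal (K * lam) < M_rho \<rho> \<theta> F x \<and> G x + H1 x \<le> \<gamma> * lam}"
    and xS: "x \<in> S"
  shows "\<exists>\<delta>. 0 < \<delta> \<and> \<delta> \<le> \<rho> x / 4 \<and> ball x \<delta> \<subseteq> {x. ennreal lam < M_rho \<rho> \<theta> F x} \<and>
     measure lebesgue (S \<inter> ball x (\<delta> / 2)) \<le>
       (2 * 80 ^ CARD('n) * (1 + decay q 4) + 40 ^ CARD('n) * 2 powr \<theta>) / unit_ball_vol (real CARD('n))
        * (decay q (a / K) + \<gamma> / K) * measure lebesgue (ball x (\<delta> / 2))"
proof -
  define n where "n = CARD('n)"
  define v where "v = unit_ball_vol (real CARD('n))"
  define E where "E = {x. ennreal lam < M_rho \<rho> \<theta> F x}"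
  define \<eta> where "\<eta> = decay q (a / K) + \<gamma> / K"
  have v: "0 < v" by (simp add: v_def unit_ball_vol_pos)
  have K0: "4 \<le> K" using a K by linarith
  have \<eta>: "0 < \<eta>" "\<gamma> / K \<le> \<eta>" using \<gamma> K0 by (auto simp: \<eta>_def decay_nonneg add_nonneg_pos)
  have A2: "1 \<le> A ^ 2" using A by simp
  have "1 * (16 * \<epsilon>) \<le> A ^ 2 * (16 * \<epsilon>)" using \<epsilon> by (intro mult_right_mono A2) simp
  then have \<epsilon>12: "\<epsilon> \<le> 1 / 16" using \<epsilon>(2) by (simp add: mult_ac)
  have [measurable]: "F \<in> borel_measurable lebesgue" "G \<in> borel_measurable lebesgue" "H1 \<in> borel_measurable lebesgue"
    "M_rho \<rho> \<theta> F \<in> borel_measurable lebesgue" by (use meas M_rho_measurable in auto)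
  have "{x \<in> space lebesgue. ennreal (K * lam) < M_rho \<rho> \<theta> F x \<and> G x + H1 x \<le> \<gamma> * lam} \<in> sets lebesgue" by measurable
  then have Sm: "S \<in> sets lebesgue" by (simp add: S_def)
  have xE: "x \<in> E"
  proof -
    have "ennreal lam \<le> ennreal (K * lam)" using K0 lam by (intro ennreal_leI) simp
    then show ?thesis using xS by (auto simp: E_def S_def intro: order.strict_trans1)
  qed
  have oE: "open E" by (simp add: E_def open_M_rho_superlevel)
  have \<gamma>l: "\<gamma> * lam \<le> lam" using \<gamma> lam by simp
  have GH: "G y \<le> \<gamma> * lam" "H1 y \<le> lam" if "y \<in> S" for y
    using that nonneg[of y] \<gamma>l unfolding S_def by (auto; linarith)+
  have balls: "\<exists>c r. 0 < r \<and> y \<in> ball c r \<and> r < \<epsilon> * \<rho> c \<and> r < \<rho> x / 16 \<and>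
       ennreal (K * lam * measure lebesgue (ball c r)) < (\<integral>\<^sup>+ z \<in> ball c r. ennreal (F z) \<partial>lebesgue)"
    if y: "y \<in> S" "dist x y < \<rho> x / 8" for y
  proof -
    have "ennreal (K * lam) < M_rho \<rho> \<theta> F y" using y by (simp add: S_def)
    then obtain c r where cr: "0 < r" "y \<in> ball c r"
      "ennreal (K * lam * Psi \<rho> \<theta> c r * measure lebesgue (ball c r)) < (\<integral>\<^sup>+ z \<in> ball c r. ennreal \<bar>F z\<bar> \<partial>lebesgue)"
      using K0 lam by (elim M_rho_gtD[OF _ pos]) auto
    then have big: "ennreal (K * lam * Psi \<rho> \<theta> c r * measure lebesgue (ball c r)) < (\<integral>\<^sup>+ z \<in> ball c r. ennreal (F z) \<partial>lebesgue)"
      using nonneg by simp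
    have r: "r < \<epsilon> * \<rho> c"
      by (rule superlevel_ball_small[OF pos gd nonneg(2) GH(1)[OF y(1)] lam \<gamma>(1) _ \<theta> \<epsilon>(1) _ small cr(1,2) big])
         (use K0 \<epsilon>12 in auto)
    have "\<epsilon> * \<rho> c \<le> 1 * \<rho> c" using \<epsilon>12 pos[of c] by (intro mult_right_mono) auto
    then have "\<rho> c \<le> A * \<rho> y" using cmp[of c y] cr(2) r by auto
    moreover have "\<rho> y \<le> A * \<rho> x" using cmp[of x y] y pos[of x] by auto
    ultimately have "\<rho> c \<le> A * (A * \<rho> x)" using A by (meson mult_left_mono order_trans zero_le_one)
    then have "\<epsilon> * \<rho> c \<le> \<epsilon> * (A * (A * \<rho> x))" using \<epsilon>(1) by (intro mult_left_mono) auto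
    also have "\<dots> = (16 * A ^ 2 * \<epsilon>) * (\<rho> x / 16)" by (simp add: power2_eq_square)
    also have "\<dots> \<le> 1 * (\<rho> x / 16)" using \<epsilon> pos[of x] by (intro mult_right_mono) auto
    finally have "r < \<rho> x / 16" using r by simp
    moreover have "ennreal (K * lam * measure lebesgue (ball c r)) \<le> ennreal (K * lam * Psi \<rho> \<theta> c r * measure lebesgue (ball c r))"
      using mult_left_mono[OF Psi_ge_1[of \<rho> c r \<theta>], of "K * lam * measure lebesgue (ball c r)"] pos[of c] cr(1) \<theta> K0 lam
      by (intro ennreal_leI) (simp add: mult_ac)
    ultimately show ?thesis using cr r big by (meson order.strict_trans1)
  qed
  have fin: "emeasure lebesgue (S \<inter> ball x d) = ennreal (measure lebesgue (S \<inter> ball x d))" for d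
    by (intro emeasure_eq_measure2 lmeasurable_subset_ball(1)[where r = d and x = x]) (use Sm in auto)
  have five: "(5 :: ennreal) ^ n = ennreal (5 ^ n)"
    by (metis ennreal_numeral ennreal_power zero_le_numeral)
  \<comment> \<open>The factors are 5^n from the covering, 8^n from the dilated cube or 4^n from
    \<rho>(x) = 4\<delta>, and 2^n from halving the radius; the leading 2 comes from halving the
    level K \<lambda>, and 2^\<theta> is \<Psi> at the critical scale. Division by the volume of the
    unit ball converts powers of \<delta> into the measure of a ball.\<close>
  have concl: "measure lebesgue (S \<inter> ball x (\<delta> / 2)) \<le> (2 * 80 ^ n * (1 + decay q 4) + 40 ^ n * 2 powr \<theta>) / v * \<eta> * measure lebesgue (ball x (\<delta> / 2))"
    if "measure lebesgue (S \<inter> ball x (\<delta> / 2)) \<le> (2 * 40 ^ n * (1 + decay q 4) + 20 ^ n * 2 powr \<theta>) * \<eta> * \<delta> ^ n" "0 < \<delta>" for \<delta>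
  proof -
    have mb: "measure lebesgue (ball x (\<delta> / 2)) = v * (\<delta> / 2) ^ n"
      using that(2) measure_lebesgue_ball[of "\<delta> / 2" x] by (simp add: v_def n_def)
    have p: "(80::real) ^ n = 40 ^ n * 2 ^ n" "(40::real) ^ n = 20 ^ n * 2 ^ n"
      using power_mult_distrib[of "40::real" 2 n] power_mult_distrib[of "20::real" 2 n] by simp_all
    have "(2 * 80 ^ n * (1 + decay q 4) + 40 ^ n * 2 powr \<theta>) / v * \<eta> * (v * (\<delta> / 2) ^ n)
      = (2 * 80 ^ n * (1 + decay q 4) + 40 ^ n * 2 powr \<theta>) / 2 ^ n * \<eta> * \<delta> ^ n"
      using v by (simp add: power_divide)
    also have "(2 * 80 ^ n * (1 + decay q 4) + 40 ^ n * 2 powr \<theta>) / 2 ^ n = 2 * 40 ^ n * (1 + decay q 4) + 20 ^ n * 2 powr \<theta>"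
      unfolding p(1) p(2)[THEN arg_cong[where f = "\<lambda>x. x * 2 powr \<theta>"]] by (simp add: field_simps)
    finally show ?thesis using that(1) unfolding mb by simp
  qed
  have "\<exists>\<delta>. 0 < \<delta> \<and> \<delta> \<le> \<rho> x / 4 \<and> ball x \<delta> \<subseteq> E \<and>
     measure lebesgue (S \<inter> ball x (\<delta> / 2)) \<le> (2 * 40 ^ n * (1 + decay q 4) + 20 ^ n * 2 powr \<theta>) * \<eta> * \<delta> ^ n"
  \<comment> \<open>The condition \<open>- E \<noteq> {}\<close> has to be explicit, because the
    distance to the empty set is 0 by convention; an empty complement belongs to the case of a
    distant one.\<close>
  proof (cases "- E \<noteq> {} \<and> infdist x (- E) \<le> \<rho> x / 4")
    case True
    define d where "d = infdist x (- E)"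
    have cl: "closed (- E)" using oE by (rule closed_Compl)
    have d: "0 < d" "d \<le> \<rho> x / 4"
      using True xE cl infdist_pos_not_in_closed[of "- E" x] by (auto simp: d_def)
    obtain z where z: "z \<notin> E" "dist x z = d"
      using infdist_attains_inf[OF cl, of x] True unfolding d_def by (metis ComplD)
    have ballE: "ball x d \<subseteq> E"
    proof
      fix y assume "y \<in> ball x d"
      then show "y \<in> E" using infdist_le[of y "- E" x] unfolding d_def by force
    qed
    define Q where "Q = cube x (8 * d)"
    have Mz: "M_rho \<rho> \<theta> F z \<le> ennreal lam" using z by (simp add: E_def not_less)
    have zQ: "z \<in> Q"
      using ball_subset_cube[of x x "4 * d" "8 * d"] z d by (auto simp: Q_def)
    have xQ: "x \<in> cube x d" using d by (simp add: cube_def)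
    obtain f where f: "f \<in> borel_measurable lebesgue"
      "AE y in lebesgue. y \<in> Q \<longrightarrow> ennreal (F y) \<le> ennreal (K * lam / 2) + f y"
      "(\<integral>\<^sup>+ y \<in> Q. f y \<partial>lebesgue) \<le> ennreal ((8 * d) ^ n * (K * lam) * ((1 + decay q 4) * \<eta>))"
      using good_decomp_small_cube[OF gd nonneg q a d(1) _ xQ GH[OF xS] zQ[unfolded Q_def] Mz lam \<gamma>(1) K(1)] d pos[of x]
      unfolding Q_def n_def \<eta>_def by auto
    have [measurable]: "f \<in> borel_measurable lebesgue" "Q \<in> sets lebesgue" using f by (auto simp: Q_def)
    have "ennreal (K * lam / 2) * emeasure lebesgue (S \<inter> ball x (d / 2)) \<le> 5 ^ DIM(real^'n) * (\<integral>\<^sup>+ y \<in> Q. f y \<partial>lebesgue)"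
    proof (rule weak_type_balls[OF f(1)])
      fix y assume y: "y \<in> S \<inter> ball x (d / 2)"
      then have "y \<in> S" "dist x y < d / 2" by auto
      moreover from this have "dist x y < \<rho> x / 8" using d by simp
      ultimately obtain c r where cr: "0 < r" "y \<in> ball c r" "r < \<epsilon> * \<rho> c" "r < \<rho> x / 16"
        "ennreal (K * lam * measure lebesgue (ball c r)) < (\<integral>\<^sup>+ z \<in> ball c r. ennreal (F z) \<partial>lebesgue)"
        using balls[of y] by blast
      let ?m = "measure lebesgue (ball c r)"
      have yd: "dist x y < d / 2" "dist c y < r" using y cr by auto
      \<comment> \<open>A witness ball of radius r > d would contain z after tripling, and the
        maximal function is at most \<lambda> there. As \<Psi> of the tripled ball is at most 2,
        this would force K < 2 * 3^n.\<close>
      have rd: "r \<le> d"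
      proof (rule ccontr)
        assume "\<not> r \<le> d"
        then have "dist c z < 3 * r"
          using yd z(2) cr(1) d(1) dist_triangle[of c z y] dist_triangle[of y z x] dist_commute[of y x] by linarith
        then have "(\<integral>\<^sup>+ y \<in> ball c (3 * r). ennreal \<bar>F y\<bar> \<partial>lebesgue) \<le> ennreal (lam * Psi \<rho> \<theta> c (3 * r) * measure lebesgue (ball c (3 * r)))"
          using cr(1) lam by (intro integral_ball_le_M_rho[OF Mz pos]) auto
        moreover have "(\<integral>\<^sup>+ z \<in> ball c r. ennreal (F z) \<partial>lebesgue) \<le> (\<integral>\<^sup>+ y \<in> ball c (3 * r). ennreal \<bar>F y\<bar> \<partial>lebesgue)"
          using cr(1) nonneg by (intro nn_integral_mono) (auto simp: indicator_def)
        ultimately have "ennreal (K * lam * ?m) < ennreal (lam * Psi \<rho> \<theta> c (3 * r) * measure lebesgue (ball c (3 * r)))"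
          using cr(5) by simp
        then have "K * lam * ?m < lam * Psi \<rho> \<theta> c (3 * r) * measure lebesgue (ball c (3 * r))"
          using K0 lam by (subst (asm) ennreal_less_iff) auto
        also have "measure lebesgue (ball c (3 * r)) = 3 ^ n * ?m"
          using cr(1) measure_lebesgue_ball[of "3 * r" c] measure_lebesgue_ball[of r c] by (simp add: n_def power_mult_distrib)
        finally have 1: "K * lam * ?m < lam * Psi \<rho> \<theta> c (3 * r) * (3 ^ n * ?m)" .
        have "Psi \<rho> \<theta> c (3 * r) \<le> (1 + 3 * \<epsilon>) powr \<theta>"
          unfolding Psi_def using cr(1,3) pos[of c] \<theta> by (intro powr_mono2) (auto simp: field_simps add_nonneg_nonneg)
        then have "Psi \<rho> \<theta> c (3 * r) \<le> 2" using \<epsilon> by simp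
        then have "lam * Psi \<rho> \<theta> c (3 * r) * (3 ^ n * ?m) \<le> lam * 2 * (3 ^ n * ?m)"
          using lam by (intro mult_right_mono mult_left_mono) auto
        also have "\<dots> = (2 * 3 ^ n) * (lam * ?m)" by simp
        also have "\<dots> \<le> K * (lam * ?m)" using K(2) lam by (intro mult_right_mono) (auto simp: n_def)
        finally show False using 1 by simp
      qed
      have sub: "ball c r \<subseteq> Q"
        unfolding Q_def using rd yd dist_triangle[of c x y] d(1)
        by (intro ball_subset_cube) (simp add: dist_commute)
      let ?t = "ennreal (K * lam / 2)"
      \<comment> \<open>Two halves make up the level K \<lambda>. One of them is absorbed by the
        constant in F \<le> K \<lambda> / 2 + f and cancelled as a finite summand, which leaves the
        other as a lower bound for the mean of f.\<close>
      have "?t * emeasure lebesgue (ball c r) + ?t * emeasure lebesgue (ball c r) = ennreal (K * lam * ?m)"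
      proof -
        have "?t * emeasure lebesgue (ball c r) = ennreal (K * lam / 2 * ?m)"
          unfolding emeasure_ball_eq_measure using K0 lam by (intro ennreal_mult[symmetric]) auto
        then show ?thesis using K0 lam by (simp flip: ennreal_plus)
      qed
      also have "\<dots> \<le> (\<integral>\<^sup>+ z \<in> ball c r. ennreal (F z) \<partial>lebesgue)" using cr(5) by simp
      also have "\<dots> \<le> (\<integral>\<^sup>+ z. ?t * indicator (ball c r) z + f z * indicator (ball c r) z \<partial>lebesgue)"
      proof (rule nn_integral_mono_AE)
        show "AE z in lebesgue. ennreal (F z) * indicator (ball c r) z \<le> ?t * indicator (ball c r) z + f z * indicator (ball c r) z"
          using f(2) by eventually_elim (use sub in \<open>auto simp: indicator_def simp del: mem_ball\<close>)
      qed
      also have "\<dots> = ?t * emeasure lebesgue (ball c r) + (\<integral>\<^sup>+ z \<in> ball c r. f z \<partial>lebesgue)"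
      proof -
        have [measurable]: "ball c r \<in> sets lebesgue" by simp
        show ?thesis by (subst nn_integral_add) (auto simp: nn_integral_cmult_indicator simp del: emeasure_completion)
      qed
      finally have "?t * emeasure lebesgue (ball c r) \<le> (\<integral>\<^sup>+ z \<in> ball c r. f z \<partial>lebesgue)"
        unfolding emeasure_ball_eq_measure by (simp add: ennreal_add_left_cancel_le ennreal_mult_eq_top_iff)
      then show "\<exists>c r. 0 < r \<and> r \<le> \<rho> x \<and> y \<in> ball c r \<and> ball c r \<subseteq> Q \<and>
         ?t * emeasure lebesgue (ball c r) \<le> (\<integral>\<^sup>+ z \<in> ball c r. f z \<partial>lebesgue)"
        using cr sub pos[of x] by (intro exI[of _ c] exI[of _ r]) auto
    qed (use Sm in auto)
    also have "5 ^ DIM(real^'n) * (\<integral>\<^sup>+ y \<in> Q. f y \<partial>lebesgue) \<le> ennreal (5 ^ n) * ennreal ((8 * d) ^ n * (K * lam) * ((1 + decay q 4) * \<eta>))"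
      using f(3) by (simp add: five[unfolded n_def] n_def mult_left_mono)
    finally have "ennreal (K * lam / 2) * ennreal (measure lebesgue (S \<inter> ball x (d / 2))) \<le> ennreal (5 ^ n) * ennreal ((8 * d) ^ n * (K * lam) * ((1 + decay q 4) * \<eta>))"
      unfolding fin .
    then have "K * lam / 2 * measure lebesgue (S \<inter> ball x (d / 2)) \<le> 5 ^ n * ((8 * d) ^ n * (K * lam) * ((1 + decay q 4) * \<eta>))"
      using K0 lam d \<eta> by (intro ennreal_mult_le_mult) (auto simp: decay_nonneg add_nonneg_nonneg)
    also have "\<dots> = K * lam / 2 * (2 * 40 ^ n * (1 + decay q 4) * \<eta> * d ^ n)"
    proof -
      have "(40::real) ^ n = 5 ^ n * 8 ^ n" using power_mult_distrib[of "5::real" 8 n] by simp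
      then show ?thesis by (simp add: power_mult_distrib)
    qed
    finally have "measure lebesgue (S \<inter> ball x (d / 2)) \<le> 2 * 40 ^ n * (1 + decay q 4) * \<eta> * d ^ n"
      using K0 lam by simp
    also have "\<dots> \<le> (2 * 40 ^ n * (1 + decay q 4) + 20 ^ n * 2 powr \<theta>) * \<eta> * d ^ n"
      using \<eta> d by (intro mult_right_mono) auto
    finally show ?thesis using d ballE by (intro exI[of _ d]) simp
  next
    case False
    \<comment> \<open>With the complement of E out of reach there is no point at which the maximal
      function is small. The cube of critical side around x replaces it: the hypothesis on
      supercritical cubes applies to F directly, with \<Psi> = 2^\<theta>.\<close>
    define d where "d = \<rho> x / 4"
    have d: "0 < d" "\<rho> x = 4 * d" using pos[of x] by (auto simp: d_def)
    have ballE: "ball x d \<subseteq> E"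
    proof
      fix y assume "y \<in> ball x d"
      then show "y \<in> E" using infdist_le[of y "- E" x] False unfolding d_def by force
    qed
    define Q where "Q = cube x (\<rho> x)"
    have [measurable]: "Q \<in> sets lebesgue" by (auto simp: Q_def)
    have "ennreal (K * lam) * emeasure lebesgue (S \<inter> ball x (d / 2)) \<le> 5 ^ DIM(real^'n) * (\<integral>\<^sup>+ y \<in> Q. ennreal (F y) \<partial>lebesgue)"
    proof (rule weak_type_balls)
      fix y assume y: "y \<in> S \<inter> ball x (d / 2)"
      then have "y \<in> S" "dist x y < \<rho> x / 8" by (auto simp: d_def)
      then obtain c r where cr: "0 < r" "y \<in> ball c r" "r < \<epsilon> * \<rho> c" "r < \<rho> x / 16"
        "ennreal (K * lam * measure lebesgue (ball c r)) < (\<integral>\<^sup>+ z \<in> ball c r. ennreal (F z) \<partial>lebesgue)"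
        using balls[of y] by blast
      have yd: "dist x y < d / 2" "dist c y < r" using y cr by auto
      have sub: "ball c r \<subseteq> Q"
        unfolding Q_def using yd dist_triangle[of c x y] d cr(4)
        by (intro ball_subset_cube) (simp add: dist_commute)
      have "ennreal (K * lam) * emeasure lebesgue (ball c r) = ennreal (K * lam * measure lebesgue (ball c r))"
        unfolding emeasure_ball_eq_measure using K0 lam by (intro ennreal_mult[symmetric]) auto
      then show "\<exists>c r. 0 < r \<and> r \<le> \<rho> x \<and> y \<in> ball c r \<and> ball c r \<subseteq> Q \<and>
         ennreal (K * lam) * emeasure lebesgue (ball c r) \<le> (\<integral>\<^sup>+ z \<in> ball c r. ennreal (F z) \<partial>lebesgue)"
        using cr sub pos[of x] by (intro exI[of _ c] exI[of _ r]) auto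
    qed (use Sm in auto)
    also have "5 ^ DIM(real^'n) * (\<integral>\<^sup>+ y \<in> Q. ennreal (F y) \<partial>lebesgue) \<le> ennreal (5 ^ n) * ennreal (\<gamma> * lam * 2 powr \<theta> * \<rho> x ^ n)"
    proof -
      have "(\<integral>\<^sup>+ y \<in> Q. ennreal (F y) \<partial>lebesgue) \<le> ennreal (G x * Psi \<rho> \<theta> x (\<rho> x) * \<rho> x ^ n)"
        unfolding n_def Q_def using pos[of x] nonneg by (intro good_decomp_large_cube[OF gd]) (auto simp: cube_def)
      also have "\<dots> \<le> ennreal (\<gamma> * lam * 2 powr \<theta> * \<rho> x ^ n)"
        using GH(1)[OF xS] pos[of x] by (intro ennreal_leI mult_right_mono) (auto simp: Psi_def)
      finally show ?thesis by (simp add: five[unfolded n_def] n_def mult_left_mono)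
    qed
    finally have "ennreal (K * lam) * ennreal (measure lebesgue (S \<inter> ball x (d / 2))) \<le> ennreal (5 ^ n) * ennreal (\<gamma> * lam * 2 powr \<theta> * \<rho> x ^ n)"
      unfolding fin .
    then have "K * lam * measure lebesgue (S \<inter> ball x (d / 2)) \<le> 5 ^ n * (\<gamma> * lam * 2 powr \<theta> * \<rho> x ^ n)"
      using K0 lam \<gamma> pos[of x] by (intro ennreal_mult_le_mult) auto
    also have "\<dots> = K * lam * (20 ^ n * 2 powr \<theta> * (\<gamma> / K) * d ^ n)"
    proof -
      have "(20::real) ^ n = 5 ^ n * 4 ^ n" using power_mult_distrib[of "5::real" 4 n] by simp
      then show ?thesis using K0 by (simp add: d power_mult_distrib)
    qed
    finally have "measure lebesgue (S \<inter> ball x (d / 2)) \<le> 20 ^ n * 2 powr \<theta> * (\<gamma> / K) * d ^ n"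
      by (rule mult_left_le_imp_le) (use K0 lam in simp)
    also have "\<dots> \<le> (2 * 40 ^ n * (1 + decay q 4) + 20 ^ n * 2 powr \<theta>) * \<eta> * d ^ n"
    proof -
      have "20 ^ n * 2 powr \<theta> \<le> 2 * 40 ^ n * (1 + decay q 4) + 20 ^ n * 2 powr \<theta>"
        using decay_nonneg[of q 4] by simp
      then show ?thesis
        using \<eta> d \<gamma> K0 decay_nonneg[of q 4] by (intro mult_right_mono mult_mono add_nonneg_nonneg mult_nonneg_nonneg) simp_all
    qed
    finally show ?thesis using d ballE by (intro exI[of _ d]) simp
  qed
  then show ?thesis
    using concl unfolding E_def \<eta>_def n_def v_def by blast
qed


text \<open>Continuity from below. It confines the covering argument to bounded sets, where the
  radii have a common bound, while the resulting estimate does not depend on the set.\<close>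

lemma wmeas_le_of_bounded:
  assumes w: "weight w" and S: "S \<in> sets lebesgue"
    and le: "\<And>n::nat. wmeas w (S \<inter> ball 0 (real n)) \<le> B"
  shows "wmeas w S \<le> B"
proof -
  let ?m = "density lebesgue (\<lambda>x. ennreal (w x))"
  have "S \<inter> ball 0 (real n) \<in> sets lebesgue" for n by (intro sets.Int S) simp
  then have sm: "range (\<lambda>n::nat. S \<inter> ball 0 (real n)) \<subseteq> sets ?m" by auto
  have inc: "incseq (\<lambda>n::nat. S \<inter> ball 0 (real n))"
    by (auto simp: incseq_def)
  have "S = (\<Union>n::nat. S \<inter> ball 0 (real n))"
    by (auto simp: reals_Archimedean2)
  then have "emeasure ?m S = (SUP n::nat. emeasure ?m (S \<inter> ball 0 (real n)))"
    using SUP_emeasure_incseq[OF sm inc] by simp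
  also have "\<dots> \<le> B"
    using le by (intro SUP_least) (simp add: wmeas_eq_emeasure[OF w] S sets.Int)
  finally show ?thesis by (simp add: wmeas_eq_emeasure[OF w S])
qed

lemma exists_small_dilation:
  fixes \<theta> b :: real
  assumes "0 < \<theta>" "0 < b"
  shows "\<exists>\<epsilon>>0. \<epsilon> \<le> b \<and> (1 + 3 * \<epsilon>) powr \<theta> \<le> 2"
proof -
  define \<epsilon> where "\<epsilon> = min b ((2 powr (1 / \<theta>) - 1) / 3)"
  have "1 < (2::real) powr (1 / \<theta>)" using assms by (intro gr_one_powr) auto
  then have \<epsilon>: "0 < \<epsilon>" "\<epsilon> \<le> b" using assms by (auto simp: \<epsilon>_def)
  have "\<epsilon> \<le> (2 powr (1 / \<theta>) - 1) / 3" unfolding \<epsilon>_def by (rule min.cobounded2)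
  then have "1 + 3 * \<epsilon> \<le> 2 powr (1 / \<theta>)" by simp
  then have "(1 + 3 * \<epsilon>) powr \<theta> \<le> (2 powr (1 / \<theta>)) powr \<theta>"
    using assms \<epsilon> by (intro powr_mono2) auto
  also have "\<dots> = 2" using assms by (simp add: powr_powr)
  finally show ?thesis using \<epsilon> by blast
qed

text \<open>The local estimate is turned into a weighted one by fractional absolute continuity and
  summed by the covering comparison with the weighted measure on both sides. The constant precedes
  the quantifier over weights, so it also serves all truncations with the same
  \<open>C1\<close>.\<close>

lemma good_lambda:
  fixes \<rho> :: "real^'n \<Rightarrow> real"
  assumes \<rho>: "critical_radius \<rho>" and a: "1 \<le> a" and q: "1 < q" and \<theta>: "0 < \<theta>" and s: "1 \<le> s" and C1: "1 \<le> C1"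
  shows "\<exists>C>0. \<forall>w F G H1 lam K \<gamma>.
     weight w \<longrightarrow> frac_abs_cont \<rho> s C1 w \<longrightarrow> (\<forall>x. 0 \<le> F x \<and> 0 \<le> G x \<and> 0 \<le> H1 x) \<longrightarrow>
     F \<in> borel_measurable lebesgue \<longrightarrow> G \<in> borel_measurable lebesgue \<longrightarrow> H1 \<in> borel_measurable lebesgue \<longrightarrow>
     good_decomp \<rho> \<theta> q a F G H1 \<longrightarrow> 0 < lam \<longrightarrow> 4 * a + 2 * 3 ^ CARD('n) \<le> K \<longrightarrow> 0 < \<gamma> \<longrightarrow> \<gamma> < 1 \<longrightarrow>
     wmeas w {x. ennreal (K * lam) < M_rho \<rho> \<theta> F x \<and> G x + H1 x \<le> \<gamma> * lam}
        \<le> ennreal (C * (decay q (a / K) + \<gamma> / K) powr (1 / s)) * wmeas w {x. ennreal lam < M_rho \<rho> \<theta> F x}"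
proof -
  note pos = critical_radius_pos[OF \<rho>]
  define v where "v = unit_ball_vol (real CARD('n))"
  have v: "0 < v" by (simp add: v_def unit_ball_vol_pos)
  obtain A where A: "1 \<le> A" and cmp: "\<And>x y. dist x y \<le> \<rho> x \<Longrightarrow> \<rho> x \<le> A * \<rho> y \<and> \<rho> y \<le> A * \<rho> x"
    using critical_radius_compare[OF \<rho>] by blast
  have A2: "0 < A ^ 2" using A by simp
  \<comment> \<open>The parameter \<theta> acts on \<epsilon>, thereby on \<kappa> and on the final
    constant, and never on the lower bound for K.\<close>
  obtain \<epsilon> where \<epsilon>0: "0 < \<epsilon>" "\<epsilon> \<le> 1 / (16 * A ^ 2)" "(1 + 3 * \<epsilon>) powr \<theta> \<le> 2"
    using exists_small_dilation[OF \<theta>, of "1 / (16 * A ^ 2)"] A2 by auto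
  have \<epsilon>: "0 < \<epsilon>" "16 * A ^ 2 * \<epsilon> \<le> 1" "(1 + 3 * \<epsilon>) powr \<theta> \<le> 2"
    using \<epsilon>0 A2 by (auto simp: field_simps)
  obtain m where m: "\<And>w x r. weight w \<Longrightarrow> frac_abs_cont \<rho> s C1 w \<Longrightarrow> 0 < r \<Longrightarrow> r < \<rho> x \<Longrightarrow>
           wmeas w (ball x r) \<le> 2 ^ m * wmeas w (ball x (r / 5))"
    using frac_abs_cont_doubling[OF C1 s, of \<rho>] by blast
  define C2 where "C2 = (2 * 80 ^ CARD('n) * (1 + decay q 4) + 40 ^ CARD('n) * 2 powr \<theta>) / v"
  have C2: "0 < C2" using v decay_nonneg[of q 4] unfolding C2_def
    by (intro divide_pos_pos add_nonneg_pos) simp_all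
  \<comment> \<open>The threshold for \<gamma> / K below which witness balls are forced to be small.
    Above it, the summand \<kappa>^(-1/s) of \<open>C\<close> makes the factor on the right at least
    1, and the inclusion of S in E is enough.\<close>
  define \<kappa> where "\<kappa> = v * \<epsilon> ^ CARD('n) / 2 powr \<theta>"
  have \<kappa>: "0 < \<kappa>" using v \<epsilon> by (simp add: \<kappa>_def)
  define C where "C = C1 * 2 ^ m * C2 powr (1 / s) + \<kappa> powr (- 1 / s)"
  have Cpos: "0 < C" using C1 C2 \<kappa> by (auto simp: C_def intro!: add_pos_pos)
  have "wmeas w {x. ennreal (K * lam) < M_rho \<rho> \<theta> F x \<and> G x + H1 x \<le> \<gamma> * lam}
        \<le> ennreal (C * (decay q (a / K) + \<gamma> / K) powr (1 / s)) * wmeas w {x. ennreal lam < M_rho \<rho> \<theta> F x}"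
    if w: "weight w" and fac: "frac_abs_cont \<rho> s C1 w" and nn: "\<forall>x. 0 \<le> F x \<and> 0 \<le> G x \<and> 0 \<le> H1 x"
      and meas: "F \<in> borel_measurable lebesgue" "G \<in> borel_measurable lebesgue" "H1 \<in> borel_measurable lebesgue"
      and gd: "good_decomp \<rho> \<theta> q a F G H1" and lam: "0 < lam" and K: "4 * a + 2 * 3 ^ CARD('n) \<le> K"
      and \<gamma>: "0 < \<gamma>" "\<gamma> < 1" for w F G H1 and lam K \<gamma> :: real
  proof -
    define S where "S = {x. ennreal (K * lam) < M_rho \<rho> \<theta> F x \<and> G x + H1 x \<le> \<gamma> * lam}"
    define E where "E = {x. ennreal lam < M_rho \<rho> \<theta> F x}"
    define \<eta> where "\<eta> = decay q (a / K) + \<gamma> / K"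
    have K1: "4 * a \<le> K" "2 * 3 ^ CARD('n) \<le> K" "1 \<le> K"
      using K a one_le_power[of "3::real" "CARD('n)"] by linarith+
    have \<eta>: "0 < \<eta>" "\<gamma> / K \<le> \<eta>" using \<gamma> K1 by (auto simp: \<eta>_def decay_nonneg add_nonneg_pos)
    have [measurable]: "F \<in> borel_measurable lebesgue" "G \<in> borel_measurable lebesgue" "H1 \<in> borel_measurable lebesgue"
      "M_rho \<rho> \<theta> F \<in> borel_measurable lebesgue" by (use meas M_rho_measurable in auto)
    have "{x \<in> space lebesgue. ennreal (K * lam) < M_rho \<rho> \<theta> F x \<and> G x + H1 x \<le> \<gamma> * lam} \<in> sets lebesgue" by measurable
    then have Sm: "S \<in> sets lebesgue" by (simp add: S_def)
    have Em: "E \<in> sets lebesgue" using open_M_rho_superlevel[of "ennreal lam" \<rho> \<theta> F] by (simp add: E_def)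
    have "ennreal lam \<le> ennreal (K * lam)" using K1 lam by (intro ennreal_leI) simp
    then have SE: "S \<subseteq> E" by (auto simp: E_def S_def intro: order.strict_trans1)
    have "wmeas w S \<le> ennreal (C * \<eta> powr (1 / s)) * wmeas w E"
    proof (cases "\<gamma> / K \<le> \<kappa>")
      case False
      have "1 = (\<kappa> * (1 / \<kappa>)) powr (1 / s)" using \<kappa> by simp
      also have "\<dots> = \<kappa> powr (- 1 / s) * \<kappa> powr (1 / s)" using \<kappa> by (simp flip: powr_add)
      also have "\<dots> \<le> \<kappa> powr (- 1 / s) * \<eta> powr (1 / s)"
        using False \<eta> \<kappa> s by (intro mult_left_mono powr_mono2) auto
      also have "\<dots> \<le> C * \<eta> powr (1 / s)" using C1 by (intro mult_right_mono) (auto simp: C_def)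
      finally have "1 \<le> ennreal (C * \<eta> powr (1 / s))" by simp
      then have "1 * wmeas w E \<le> ennreal (C * \<eta> powr (1 / s)) * wmeas w E" by (rule mult_right_mono) simp
      then show ?thesis using wmeas_mono[OF SE, of w] by simp
    next
      case True
      have small: "\<gamma> * 2 powr \<theta> \<le> K * unit_ball_vol (real CARD('n)) * \<epsilon> ^ CARD('n)"
        using True K1 by (simp add: \<kappa>_def v_def field_simps)
      \<comment> \<open>Fractional absolute continuity is applied on the ball of radius \<delta>/2.
        The covering needs balls of a fifth of that radius, so they have radius \<delta>/10, and the
        doubling factor 2^m pays for the passage.\<close>
      define k where "k = ennreal (C1 * (C2 * \<eta>) powr (1 / s)) * 2 ^ m"
      have local: "\<exists>c r. 0 < r \<and> r \<le> \<rho> x / 40 \<and> x \<in> ball c r \<and> ball c r \<subseteq> E \<and> wmeas w (S \<inter> ball c (5 * r)) \<le> k * wmeas w (ball c r)"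
        if x: "x \<in> S" for x
      proof -
        obtain \<delta> where \<delta>: "0 < \<delta>" "\<delta> \<le> \<rho> x / 4" "ball x \<delta> \<subseteq> E"
           "measure lebesgue (S \<inter> ball x (\<delta> / 2)) \<le> C2 * \<eta> * measure lebesgue (ball x (\<delta> / 2))"
          using local_good_lambda[OF pos A cmp _ _ _ meas gd q a \<theta> lam \<gamma> K1(1,2) \<epsilon> small S_def x] nn
          unfolding C2_def E_def \<eta>_def v_def by blast
        have mb: "0 < measure lebesgue (ball x (\<delta> / 2))" using \<delta>(1) by (simp add: content_ball_gt_0_iff)
        have "S \<inter> ball x (\<delta> / 2) \<in> sets lebesgue" by (intro sets.Int Sm) simp
        then have "wmeas w (S \<inter> ball x (\<delta> / 2)) \<le>
           ennreal (C1 * (measure lebesgue (S \<inter> ball x (\<delta> / 2)) / measure lebesgue (ball x (\<delta> / 2))) powr (1 / s)) * wmeas w (ball x (\<delta> / 2))"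
          using fac[unfolded frac_abs_cont_def, rule_format, of "\<delta> / 2" x "S \<inter> ball x (\<delta> / 2)"] \<delta> pos[of x] by auto
        also have "\<dots> \<le> ennreal (C1 * (C2 * \<eta>) powr (1 / s)) * wmeas w (ball x (\<delta> / 2))"
          using \<delta>(4) mb C1 s by (intro mult_right_mono ennreal_leI mult_left_mono powr_mono2) (auto simp: field_simps)
        also have "\<dots> \<le> ennreal (C1 * (C2 * \<eta>) powr (1 / s)) * (2 ^ m * wmeas w (ball x (\<delta> / 2 / 5)))"
          using \<delta> pos[of x] by (intro mult_left_mono m w fac) auto
        finally have "wmeas w (S \<inter> ball x (5 * (\<delta> / 10))) \<le> k * wmeas w (ball x (\<delta> / 10))"
          by (simp add: k_def mult.assoc)
        moreover have "ball x (\<delta> / 10) \<subseteq> E" using subset_ball[of "\<delta> / 10" \<delta> x] \<delta> by auto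
        ultimately show ?thesis using \<delta> by (intro exI[of _ x] exI[of _ "\<delta> / 10"]) auto
      qed
      have "wmeas w S \<le> k * wmeas w E"
      proof (rule wmeas_le_of_bounded[OF w Sm])
        fix n :: nat
        obtain B where B: "\<And>x. norm x \<le> real n \<Longrightarrow> \<rho> x \<le> B" using critical_radius_bounded[OF \<rho>] by blast
        let ?S = "S \<inter> ball 0 (real n)" and ?m = "density lebesgue (\<lambda>x. ennreal (w x))"
        have Snm: "?S \<in> sets lebesgue" using Sm by auto
        have "emeasure ?m ?S \<le> k * emeasure ?m E"
        proof (rule Vitali_compare[OF _ _ Snm Em])
          fix x assume x: "x \<in> ?S"
          then obtain c r where cr: "0 < r" "r \<le> \<rho> x / 40" "x \<in> ball c r" "ball c r \<subseteq> E" "wmeas w (S \<inter> ball c (5 * r)) \<le> k * wmeas w (ball c r)"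
            using local by blast
          have "wmeas w (?S \<inter> ball c (5 * r)) \<le> wmeas w (S \<inter> ball c (5 * r))" by (rule wmeas_mono) auto
          then have "wmeas w (?S \<inter> ball c (5 * r)) \<le> k * wmeas w (ball c r)" using cr(5) by (rule order_trans)
          then have "emeasure ?m (?S \<inter> ball c (5 * r)) \<le> k * emeasure ?m (ball c r)"
            using Snm by (simp add: wmeas_eq_emeasure[OF w] sets.Int)
          moreover have "r \<le> B / 40" using B[of x] x cr(2) by auto
          ultimately show "\<exists>c r. 0 < r \<and> r \<le> B / 40 \<and> x \<in> ball c r \<and> ball c r \<subseteq> E \<and>
              emeasure ?m (?S \<inter> ball c (5 * r)) \<le> k * emeasure ?m (ball c r)"
            using cr by blast
        qed auto
        then show "wmeas w ?S \<le> k * wmeas w E" by (simp add: wmeas_eq_emeasure[OF w] Snm Em)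
      qed
      also have "k = ennreal (C1 * 2 ^ m * C2 powr (1 / s) * \<eta> powr (1 / s))"
      proof -
        have "(2::ennreal) ^ m = ennreal (2 ^ m)" by (metis ennreal_numeral ennreal_power zero_le_numeral)
        then show ?thesis using C1 unfolding k_def by (simp add: ennreal_mult[symmetric] powr_mult mult_ac)
      qed
      also have "\<dots> * wmeas w E \<le> ennreal (C * \<eta> powr (1 / s)) * wmeas w E"
        by (intro mult_right_mono ennreal_leI) (auto simp: C_def)
      finally show ?thesis .
    qed
    then show ?thesis by (simp add: S_def E_def \<eta>_def)
  qed
  then show ?thesis using Cpos by blast
qed

subsection \<open>From good-lambda to norm estimates\<close>

lemma enn_powr_ennreal: "0 \<le> x \<Longrightarrow> enn_powr (ennreal x) r = ennreal (x powr r)"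
  by (simp add: enn_powr_def)

lemma enn_powr_mono: "0 \<le> r \<Longrightarrow> x \<le> y \<Longrightarrow> enn_powr x r \<le> enn_powr y r"
  by (cases x; cases y) (auto simp: enn_powr_def top_unique intro!: ennreal_leI powr_mono2)

lemma enn_powr_cmult:
  assumes "0 < c"
  shows "enn_powr (ennreal c * x) r = ennreal (c powr r) * enn_powr x r"
proof (cases x)
  case (real y)
  then show ?thesis
    using assms by (simp add: ennreal_mult[symmetric] enn_powr_ennreal powr_mult)
next
  case top
  then show ?thesis using assms by (simp add: enn_powr_def ennreal_mult_top)
qed

lemma enn_powr_powr:
  assumes "0 < r"
  shows "enn_powr (enn_powr x (1 / r)) r = x" "enn_powr (enn_powr x r) (1 / r) = x"
  using assms by (cases x; simp add: enn_powr_def powr_powr)+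

text \<open>Going through the maximum instead of convexity covers exponents below 1 as well.\<close>

lemma enn_powr_add_le:
  assumes "0 \<le> r"
  shows "enn_powr (x + y) r \<le> ennreal (2 powr r) * (enn_powr x r + enn_powr y r)"
proof -
  have "x + y \<le> 2 * max x y"
    by (simp add: mult_2 add_mono)
  then have "enn_powr (x + y) r \<le> enn_powr (ennreal 2 * max x y) r"
    using assms by (intro enn_powr_mono) auto
  also have "\<dots> = ennreal (2 powr r) * enn_powr (max x y) r"
    by (rule enn_powr_cmult) simp
  also have "enn_powr (max x y) r \<le> enn_powr x r + enn_powr y r"
    by (auto simp: max_def)
  finally show ?thesis by (simp add: mult_left_mono)
qed

lemma enn_powr_eq_top_iff: "enn_powr x r = \<infinity> \<longleftrightarrow> x = \<infinity>"
  by (simp add: enn_powr_def)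

lemma enn_powr_measurable[measurable]:
  assumes [measurable]: "f \<in> borel_measurable M"
  shows "(\<lambda>x. enn_powr (f x) r) \<in> borel_measurable M"
  unfolding enn_powr_def by measurable

section \<open>Solving the halving recursion\<close>

lemma suminf_half_powers: "(\<Sum>i. ennreal ((1 / 2) ^ i) * x) = 2 * x"
proof -
  have "(\<Sum>i. ennreal ((1 / 2) ^ i)) = ennreal (\<Sum>i. (1 / 2) ^ i)"
    by (rule suminf_ennreal2) (auto intro!: summable_geometric)
  also have "(\<Sum>i. (1 / 2 :: real) ^ i) = 2" by (subst suminf_geometric) auto
  finally show ?thesis by simp
qed

text \<open>Unfolding j steps downwards leaves the remainder 2^(-j) a(k - j), which tends to 0 as
  soon as \<open>a\<close> is bounded near minus infinity. No finiteness of a at other indices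
  enters.\<close>

lemma halving_recursion:
  fixes a b :: "int \<Rightarrow> ennreal"
  assumes step: "\<And>k. a (k + 1) \<le> ennreal (1 / 2) * a k + b k"
    and bd: "\<And>k. k \<le> l \<Longrightarrow> a k \<le> L" and L: "L < \<infinity>"
  shows "a k \<le> (\<Sum>i. ennreal ((1 / 2) ^ i) * b (k - 1 - int i))"
proof -
  have iter: "a k \<le> ennreal ((1 / 2) ^ j) * a (k - int j) + (\<Sum>i<j. ennreal ((1 / 2) ^ i) * b (k - 1 - int i))" for j
  proof (induction j)
    case (Suc j)
    have "a (k - int j) \<le> ennreal (1 / 2) * a (k - 1 - int j) + b (k - 1 - int j)"
      using step[of "k - 1 - int j"] by (simp add: algebra_simps)
    then have "ennreal ((1 / 2) ^ j) * a (k - int j) \<le> ennreal ((1 / 2) ^ j) * (ennreal (1 / 2) * a (k - 1 - int j) + b (k - 1 - int j))"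
      by (rule mult_left_mono) simp
    also have "\<dots> = ennreal ((1 / 2) ^ Suc j) * a (k - int (Suc j)) + ennreal ((1 / 2) ^ j) * b (k - 1 - int j)"
    proof -
      have "ennreal ((1 / 2) ^ j) * ennreal (1 / 2) = ennreal ((1 / 2) ^ Suc j)"
        by (subst ennreal_mult[symmetric]) (auto simp: mult.commute)
      moreover have "k - int (Suc j) = k - 1 - int j" by simp
      ultimately show ?thesis by (simp only: distrib_left mult.assoc[symmetric])
    qed
    finally have "ennreal ((1 / 2) ^ j) * a (k - int j) \<le> ennreal ((1 / 2) ^ Suc j) * a (k - int (Suc j)) + ennreal ((1 / 2) ^ j) * b (k - 1 - int j)" .
    then have "a k \<le> (ennreal ((1 / 2) ^ Suc j) * a (k - int (Suc j)) + ennreal ((1 / 2) ^ j) * b (k - 1 - int j)) + (\<Sum>i<j. ennreal ((1 / 2) ^ i) * b (k - 1 - int i))"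
      using Suc by (meson add_right_mono order_trans)
    then show ?case by (simp only: sum.lessThan_Suc add.assoc add.commute[of "sum _ _"])
  qed simp
  obtain c where c: "L = ennreal c" "0 \<le> c" using L by (cases L) auto
  show ?thesis
  proof (rule ennreal_le_epsilon)
    fix e :: real assume e: "0 < e"
    have "(\<lambda>j. (1 / 2) ^ j * c) \<longlonglongrightarrow> 0 * c" by (intro tendsto_mult LIMSEQ_realpow_zero tendsto_const) auto
    then have "eventually (\<lambda>j. (1 / 2) ^ j * c < e) sequentially" using e by (intro order_tendstoD(2)[of _ 0]) auto
    then obtain N where N: "\<And>j. N \<le> j \<Longrightarrow> (1 / 2) ^ j * c < e" by (auto simp: eventually_sequentially)
    \<comment> \<open>Large enough for the remainder to be below e and, at the same time, for the
      index k - j to lie in the range where \<open>L\<close> bounds \<open>a\<close>.\<close>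
    define j where "j = max N (nat (k - l))"
    have j: "N \<le> j" "k - int j \<le> l" by (auto simp: j_def)
    have "a k \<le> ennreal ((1 / 2) ^ j) * a (k - int j) + (\<Sum>i<j. ennreal ((1 / 2) ^ i) * b (k - 1 - int i))" by (rule iter)
    also have "\<dots> \<le> ennreal e + (\<Sum>i. ennreal ((1 / 2) ^ i) * b (k - 1 - int i))"
    proof (rule add_mono)
      have "ennreal ((1 / 2) ^ j) * a (k - int j) \<le> ennreal ((1 / 2) ^ j) * ennreal c"
        using bd[OF j(2)] c by (intro mult_left_mono) auto
      also have "\<dots> \<le> ennreal e" using N[OF j(1)] c by (simp add: ennreal_mult[symmetric] ennreal_leI less_imp_le)
      finally show "ennreal ((1 / 2) ^ j) * a (k - int j) \<le> ennreal e" .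
      show "(\<Sum>i<j. ennreal ((1 / 2) ^ i) * b (k - 1 - int i)) \<le> (\<Sum>i. ennreal ((1 / 2) ^ i) * b (k - 1 - int i))"
        by (rule sum_le_suminf) auto
    qed
    finally show "a k \<le> (\<Sum>i. ennreal ((1 / 2) ^ i) * b (k - 1 - int i)) + ennreal e" by (simp add: add.commute)
  qed
qed

text \<open>Summing the solved recursion rather than the recursion itself avoids absorbing a
  possibly infinite sum of \<open>a\<close>. Counting measure on the integers is invariant under
  shifts, so only the geometric series with value 2 remains.\<close>

lemma halving_recursion_sum:
  fixes a b :: "int \<Rightarrow> ennreal"
  assumes step: "\<And>k. a (k + 1) \<le> ennreal (1 / 2) * a k + b k"
    and bd: "\<And>k. k \<le> l \<Longrightarrow> a k \<le> L" and L: "L < \<infinity>"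
  shows "(\<integral>\<^sup>+ k. a k \<partial>count_space UNIV) \<le> 2 * (\<integral>\<^sup>+ k. b k \<partial>count_space UNIV)"
proof -
  have "(\<integral>\<^sup>+ k. a k \<partial>count_space UNIV) \<le> (\<integral>\<^sup>+ k. (\<Sum>i. ennreal ((1 / 2) ^ i) * b (k - 1 - int i)) \<partial>count_space UNIV)"
  proof (rule nn_integral_mono)
    fix k
    show "a k \<le> (\<Sum>i. ennreal ((1 / 2) ^ i) * b (k - 1 - int i))"
      by (rule halving_recursion[where a = a and b = b, OF step bd L])
  qed
  also have "\<dots> = (\<Sum>i. \<integral>\<^sup>+ k. ennreal ((1 / 2) ^ i) * b (k - 1 - int i) \<partial>count_space UNIV)"
    by (rule nn_integral_suminf) simp
  also have "\<dots> = (\<Sum>i. ennreal ((1 / 2) ^ i) * (\<integral>\<^sup>+ k. b k \<partial>count_space UNIV))"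
  proof (rule suminf_cong)
    fix i
    have "bij_betw (\<lambda>k. k - 1 - int i) UNIV UNIV"
      by (rule bij_betw_byWitness[where f' = "\<lambda>k. k + 1 + int i"]) auto
    from nn_integral_bij_count_space[OF this, of b]
    show "(\<integral>\<^sup>+ k. ennreal ((1 / 2) ^ i) * b (k - 1 - int i) \<partial>count_space UNIV) = ennreal ((1 / 2) ^ i) * (\<integral>\<^sup>+ k. b k \<partial>count_space UNIV)"
      by (simp add: nn_integral_cmult)
  qed
  also have "\<dots> = 2 * (\<integral>\<^sup>+ k. b k \<partial>count_space UNIV)" by (rule suminf_half_powers)
  finally show ?thesis .
qed

section \<open>Layer-cake formula along powers of K\<close>

lemma exists_geometric_bracket:
  fixes K x :: real
  assumes "1 < K" "0 < x"
  obtains k :: int where "K powr k < x" "x \<le> K powr (k + 1)"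
proof
  \<comment> \<open>The ceiling minus one, rather than the floor: the strict inequality has to be on
    the left, to match the strict superlevel sets.\<close>
  let ?k = "\<lceil>log K x\<rceil> - 1"
  have lower: "real_of_int ?k < log K x" and upper: "log K x \<le> real_of_int ?k + 1" by linarith+
  show "K powr ?k < x" using lower by (simp only: less_log_iff[OF assms])
  show "x \<le> K powr (?k + 1)" using upper by (simp only: log_le_iff[OF assms] of_int_add of_int_1)
qed

text \<open>For finite positive f the largest k with K^k < f already gives f^p up to the factor K^p.
  For f = \<infinity> every k \<ge> 0 contributes at least 1 and the sum diverges.\<close>

lemma enn_powr_le_geometric_sum:
  fixes K p :: real
  assumes K: "1 < K" and p: "0 < p"
  shows "enn_powr f p \<le> ennreal (K powr p) *
     (\<integral>\<^sup>+ k. ennreal (K powr (of_int k * p)) * indicator {k. ennreal (K powr of_int k) < f} k \<partial>count_space (UNIV :: int set))"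
    (is "_ \<le> _ * ?I")
proof (cases f)
  case top
  have "(\<integral>\<^sup>+ k. indicator {0::int..} k \<partial>count_space UNIV) \<le> ?I"
  proof (intro nn_integral_mono)
    fix k :: int
    have "0 \<le> k \<Longrightarrow> 1 \<le> ennreal (K powr (of_int k * p))" using K p by (simp add: ge_one_powr_ge_zero)
    then show "indicator {0..} k \<le> ennreal (K powr (of_int k * p)) * indicator {k. ennreal (K powr of_int k) < f} k"
      using top by (auto simp: indicator_def)
  qed
  then have "?I = \<infinity>" by (simp add: infinite_Ici top_unique)
  then show ?thesis using K by (simp add: ennreal_mult_top)
next
  case (real x)
  show ?thesis
  proof (cases "x = 0")
    case False
    then have x: "0 < x" using real by simp
    obtain k :: int where k: "K powr k < x" "x \<le> K powr (k + 1)"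
      using exists_geometric_bracket[OF K x] by blast
    have "x powr p \<le> (K powr (k + 1)) powr p" using k(2) x p by (intro powr_mono2) auto
    also have "\<dots> = K powr p * K powr (k * p)" using K by (simp add: powr_powr powr_add[symmetric] algebra_simps)
    finally have "enn_powr f p \<le> ennreal (K powr p) * ennreal (K powr (k * p))"
      using real by (simp add: enn_powr_ennreal ennreal_mult[symmetric])
    also have "ennreal (K powr (k * p)) \<le> ?I"
      using nn_integral_ge_point[of k UNIV "\<lambda>k. ennreal (K powr (of_int k * p)) * indicator {k. ennreal (K powr of_int k) < f} k"]
        k(1) real by (simp add: ennreal_less_iff)
    finally show ?thesis by (simp add: mult_left_mono)
  qed (use real in \<open>simp add: enn_powr_def\<close>)
qed

text \<open>The sum is a geometric series of ratio K^(-p) descending from its top term, which is at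
  most y^p; the substitution k = m - j makes this visible.\<close>

lemma geometric_sum_le:
  fixes K p y :: real
  assumes K: "1 < K" and p: "0 < p" and y: "0 \<le> y"
  shows "(\<integral>\<^sup>+ k. ennreal (K powr (of_int k * p)) * indicator {k. K powr of_int k < y} k \<partial>count_space (UNIV :: int set))
     \<le> ennreal (1 / (1 - K powr (- p)) * y powr p)"
proof (cases "y = 0")
  case False
  then have y: "0 < y" using y by simp
  obtain m :: int where m: "K powr m < y" "y \<le> K powr (m + 1)"
    using exists_geometric_bracket[OF K y] by blast
  have c: "K powr (- p) < 1" using K p powr_less_mono[of "- p" 0 K] by simp
  have "(\<integral>\<^sup>+ k. ennreal (K powr (of_int k * p)) * indicator {k. K powr of_int k < y} k \<partial>count_space (UNIV :: int set))
     \<le> (\<integral>\<^sup>+ k. ennreal (K powr (of_int k * p)) * indicator {..m} k \<partial>count_space (UNIV :: int set))"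
  proof (intro nn_integral_mono mult_left_mono)
    fix k :: int
    show "indicator {k. K powr of_int k < y} k \<le> (indicator {..m} k :: ennreal)"
    proof (cases "k \<le> m")
      case False
      then have "K powr (m + 1) \<le> K powr k" using K by (intro powr_mono) auto
      then show ?thesis using m(2) by (auto simp: indicator_def)
    qed (simp add: indicator_def)
  qed simp
  also have "\<dots> = (\<integral>\<^sup>+ k. ennreal (K powr (of_int k * p)) \<partial>count_space {..m})"
    by (rule nn_integral_count_space_indicator[symmetric]) simp
  also have "\<dots> = (\<integral>\<^sup>+ j. ennreal (K powr (of_int (m - int j) * p)) \<partial>count_space (UNIV :: nat set))"
  proof -
    have "bij_betw (\<lambda>j. m - int j) UNIV {..m}"
      by (rule bij_betw_byWitness[where f' = "\<lambda>k. nat (m - k)"]) auto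
    from nn_integral_bij_count_space[OF this, of "\<lambda>k. ennreal (K powr (of_int k * p))"] show ?thesis by simp
  qed
  also have "\<dots> = (\<Sum>j. ennreal (K powr (of_int (m - int j) * p)))"
    by (rule nn_integral_count_space_nat)
  also have "\<dots> = (\<Sum>j. ennreal (K powr (m * p)) * ennreal ((K powr (- p)) ^ j))"
  proof (rule suminf_cong)
    fix j
    have "K powr (of_int (m - int j) * p) = K powr (m * p) * (K powr (- p)) powr (real j)"
      using K by (simp add: powr_powr powr_add[symmetric] algebra_simps)
    then show "ennreal (K powr (of_int (m - int j) * p)) = ennreal (K powr (m * p)) * ennreal ((K powr (- p)) ^ j)"
      using K by (simp add: ennreal_mult powr_realpow)
  qed
  also have "\<dots> = ennreal (K powr (m * p)) * ennreal (1 / (1 - K powr (- p)))"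
  proof -
    have "(\<Sum>j. ennreal ((K powr (- p)) ^ j)) = ennreal (\<Sum>j. (K powr (- p)) ^ j)"
      using c by (intro suminf_ennreal2) (auto intro!: summable_geometric)
    also have "(\<Sum>j. (K powr (- p)) ^ j) = 1 / (1 - K powr (- p))" using c by (subst suminf_geometric) auto
    finally show ?thesis by simp
  qed
  also have "\<dots> = ennreal (1 / (1 - K powr (- p)) * K powr (m * p))"
    using c by (simp add: ennreal_mult[symmetric] mult.commute)
  also have "K powr (m * p) = (K powr m) powr p" by (simp add: powr_powr)
  also have "ennreal (1 / (1 - K powr (- p)) * (K powr m) powr p) \<le> ennreal (1 / (1 - K powr (- p)) * y powr p)"
    using m(1) c p by (intro ennreal_leI mult_left_mono powr_mono2) auto
  finally show ?thesis .
qed simp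


text \<open>The level set of M is split according to whether g exceeds \<gamma> t, and \<delta> K^p
  \<le> 1/2 supplies the halving. The level t is arbitrary, so the step serves the levels K^k of the
  strong estimate and the levels K^k t of the weak one.\<close>

lemma good_lambda_geometric_step:
  fixes w :: "real^'n \<Rightarrow> real" and M :: "real^'n \<Rightarrow> ennreal" and g :: "real^'n \<Rightarrow> real"
  assumes w: "weight w" and M: "M \<in> borel_measurable lebesgue" and g: "g \<in> borel_measurable lebesgue"
    and K: "1 < K" and p: "0 < p" and \<delta>: "0 \<le> \<delta>" "\<delta> * K powr p \<le> 1 / 2" and t: "0 < t"
    and GL: "wmeas w {x. ennreal (K * t) < M x \<and> g x \<le> \<gamma> * t} \<le> ennreal \<delta> * wmeas w {x. ennreal t < M x}"
  shows "ennreal ((K * t) powr p) * wmeas w {x. ennreal (K * t) < M x}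
     \<le> ennreal (1 / 2) * (ennreal (t powr p) * wmeas w {x. ennreal t < M x})
        + ennreal (K powr p) * (ennreal (t powr p) * wmeas w {x. \<gamma> * t < g x})"
proof -
  have [measurable]: "M \<in> borel_measurable lebesgue" "g \<in> borel_measurable lebesgue" using M g by auto
  have "{x \<in> space lebesgue. ennreal (K * t) < M x \<and> g x \<le> \<gamma> * t} \<in> sets lebesgue"
    "{x \<in> space lebesgue. \<gamma> * t < g x} \<in> sets lebesgue" by measurable
  then have "wmeas w ({x. ennreal (K * t) < M x \<and> g x \<le> \<gamma> * t} \<union> {x. \<gamma> * t < g x})
     \<le> wmeas w {x. ennreal (K * t) < M x \<and> g x \<le> \<gamma> * t} + wmeas w {x. \<gamma> * t < g x}"
    by (intro wmeas_Un[OF w]) simp_all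
  moreover have "wmeas w {x. ennreal (K * t) < M x} \<le> wmeas w ({x. ennreal (K * t) < M x \<and> g x \<le> \<gamma> * t} \<union> {x. \<gamma> * t < g x})"
    by (rule wmeas_mono) auto
  ultimately have "wmeas w {x. ennreal (K * t) < M x} \<le> ennreal \<delta> * wmeas w {x. ennreal t < M x} + wmeas w {x. \<gamma> * t < g x}"
    using GL by (meson add_right_mono order_trans)
  then have "ennreal ((K * t) powr p) * wmeas w {x. ennreal (K * t) < M x}
      \<le> ennreal ((K * t) powr p) * (ennreal \<delta> * wmeas w {x. ennreal t < M x} + wmeas w {x. \<gamma> * t < g x})"
    by (rule mult_left_mono) simp
  also have Kt: "ennreal ((K * t) powr p) = ennreal (K powr p) * ennreal (t powr p)"
    by (simp add: powr_mult ennreal_mult)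
  also have "ennreal (K powr p) * ennreal (t powr p) * (ennreal \<delta> * wmeas w {x. ennreal t < M x} + wmeas w {x. \<gamma> * t < g x})
     = (ennreal \<delta> * ennreal (K powr p)) * (ennreal (t powr p) * wmeas w {x. ennreal t < M x})
       + ennreal (K powr p) * (ennreal (t powr p) * wmeas w {x. \<gamma> * t < g x})"
    by (simp add: distrib_left mult_ac)
  also have "ennreal \<delta> * ennreal (K powr p) = ennreal (\<delta> * K powr p)" using \<delta> by (simp add: ennreal_mult)
  also have "ennreal (\<delta> * K powr p) * (ennreal (t powr p) * wmeas w {x. ennreal t < M x})
      \<le> ennreal (1 / 2) * (ennreal (t powr p) * wmeas w {x. ennreal t < M x})"
    using \<delta> by (intro mult_right_mono ennreal_leI) auto
  finally show ?thesis unfolding Kt by (simp add: add_right_mono)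
qed

lemma powr_less_bound:
  fixes K t t0 :: real
  assumes K: "1 < K" and t: "0 < t" "0 < t0"
  shows "\<exists>k0::int. \<forall>k\<le>k0. K powr of_int k * t \<le> t0"
proof (intro exI allI impI)
  fix k :: int assume "k \<le> \<lfloor>log K (t0 / t)\<rfloor>"
  then have "real_of_int k \<le> log K (t0 / t)" by linarith
  then have "K powr k \<le> t0 / t" using K t by (simp add: le_log_iff)
  then show "K powr k * t \<le> t0" using t by (simp add: field_simps)
qed

text \<open>The constant collects K^p from discretising M, 2 from the recursion, another K^p from
  the single step, the geometric series from returning from the sum to g^p, and \<gamma>^(-p) from
  the thresholds \<gamma> K^k.\<close>

lemma strong_type_of_good_lambda:
  fixes w :: "real^'n \<Rightarrow> real" and M :: "real^'n \<Rightarrow> ennreal" and g :: "real^'n \<Rightarrow> real"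
  assumes w: "weight w" and M: "M \<in> borel_measurable lebesgue" and g: "g \<in> borel_measurable lebesgue" "\<And>x. 0 \<le> g x"
    and K: "1 < K" and p: "0 < p" and \<delta>: "0 \<le> \<delta>" "\<delta> * K powr p \<le> 1 / 2" and \<gamma>: "0 < \<gamma>"
    and GL: "\<And>t. 0 < t \<Longrightarrow> wmeas w {x. ennreal (K * t) < M x \<and> g x \<le> \<gamma> * t} \<le> ennreal \<delta> * wmeas w {x. ennreal t < M x}"
    and bd: "\<And>t. 0 < t \<Longrightarrow> t \<le> t0 \<Longrightarrow> ennreal (t powr p) * wmeas w {x. ennreal t < M x} \<le> L" and L: "L < \<infinity>" and t0: "0 < t0"
  shows "(\<integral>\<^sup>+ x. ennreal (w x) * enn_powr (M x) p \<partial>lebesgue)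
     \<le> ennreal (2 * K powr p * K powr p * (1 / (1 - K powr (- p))) / \<gamma> powr p) * (\<integral>\<^sup>+ x. ennreal (w x) * ennreal (g x powr p) \<partial>lebesgue)"
proof -
  have [measurable]: "M \<in> borel_measurable lebesgue" "g \<in> borel_measurable lebesgue" "w \<in> borel_measurable lebesgue" using M g weightD[OF w] by auto
  define a where "a k = ennreal (K powr (of_int k * p)) * wmeas w {x. ennreal (K powr of_int k) < M x}" for k :: int
  define b where "b k = ennreal (K powr (of_int k * p)) * wmeas w {x. \<gamma> * K powr of_int k < g x}" for k :: int
  have a_def': "a k = ennreal ((K powr of_int k) powr p) * wmeas w {x. ennreal (K powr of_int k) < M x}" for k
    by (simp add: a_def powr_powr)
  have b_def': "b k = ennreal ((K powr of_int k) powr p) * wmeas w {x. \<gamma> * K powr of_int k < g x}" for k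
    by (simp add: b_def powr_powr)
  have step: "a (k + 1) \<le> ennreal (1 / 2) * a k + ennreal (K powr p) * b k" for k
  proof -
    have Kk: "0 < K powr of_int k" "K powr of_int (k + 1) = K * K powr of_int k" using K by (simp_all add: powr_add)
    show ?thesis
      unfolding a_def' b_def' Kk(2) by (rule good_lambda_geometric_step[OF w M g(1) K p \<delta> Kk(1) GL[OF Kk(1)]])
  qed
  obtain k0 :: int where k0: "\<And>k. k \<le> k0 \<Longrightarrow> K powr of_int k \<le> t0"
    using powr_less_bound[OF K zero_less_one t0] by auto
  have aL: "a k \<le> L" if "k \<le> k0" for k
    unfolding a_def' using k0[OF that] K by (intro bd) auto
  \<comment> \<open>Fubini between Lebesgue and counting measure, stated for a general family of
    sets because it is used once for M and once, in the opposite direction, for g.\<close>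
  have swap: "(\<integral>\<^sup>+ x. ennreal (w x) * (\<integral>\<^sup>+ k. ennreal (c k) * indicator {k. P k x} k \<partial>count_space UNIV) \<partial>lebesgue)
     = (\<integral>\<^sup>+ k. ennreal (c k) * wmeas w {x. P k x} \<partial>count_space UNIV)"
    if m: "\<And>k. {x. P k x} \<in> sets lebesgue" for c :: "int \<Rightarrow> real" and P :: "int \<Rightarrow> real^'n \<Rightarrow> bool"
  proof -
    have [measurable]: "{x. P k x} \<in> sets lebesgue" for k by (rule m)
    have "(\<integral>\<^sup>+ x. ennreal (w x) * (\<integral>\<^sup>+ k. ennreal (c k) * indicator {k. P k x} k \<partial>count_space UNIV) \<partial>lebesgue)
      = (\<integral>\<^sup>+ x. \<integral>\<^sup>+ k. ennreal (c k) * (ennreal (w x) * indicator {x. P k x} x) \<partial>count_space UNIV \<partial>lebesgue)"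
      by (subst nn_integral_cmult[symmetric]) (auto simp: indicator_def mult_ac intro!: nn_integral_cong)
    also have "\<dots> = (\<integral>\<^sup>+ k. \<integral>\<^sup>+ x. ennreal (c k) * (ennreal (w x) * indicator {x. P k x} x) \<partial>lebesgue \<partial>count_space UNIV)"
      by (intro nn_integral_count_space_nn_integral) auto
    also have "\<dots> = (\<integral>\<^sup>+ k. ennreal (c k) * wmeas w {x. P k x} \<partial>count_space UNIV)"
      unfolding wmeas_def by (intro nn_integral_cong nn_integral_cmult) auto
    finally show ?thesis .
  qed
  have Mm: "{x. ennreal t < M x} \<in> sets lebesgue" and gm: "{x. t < g x} \<in> sets lebesgue" for t
  proof -
    have "{x \<in> space lebesgue. ennreal t < M x} \<in> sets lebesgue" "{x \<in> space lebesgue. t < g x} \<in> sets lebesgue" by measurable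
    then show "{x. ennreal t < M x} \<in> sets lebesgue" "{x. t < g x} \<in> sets lebesgue" by simp_all
  qed
  have "(\<integral>\<^sup>+ x. ennreal (w x) * enn_powr (M x) p \<partial>lebesgue)
     \<le> (\<integral>\<^sup>+ x. ennreal (w x) * (\<integral>\<^sup>+ k. ennreal (K powr p * K powr (of_int k * p)) * indicator {k. ennreal (K powr of_int k) < M x} k \<partial>count_space (UNIV :: int set)) \<partial>lebesgue)"
  proof (intro nn_integral_mono mult_left_mono)
    fix x
    have "ennreal (K powr p) * (\<integral>\<^sup>+ k. ennreal (K powr (of_int k * p)) * indicator {k. ennreal (K powr of_int k) < M x} k \<partial>count_space (UNIV :: int set))
      = (\<integral>\<^sup>+ k. ennreal (K powr p * K powr (of_int k * p)) * indicator {k. ennreal (K powr of_int k) < M x} k \<partial>count_space (UNIV :: int set))"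
      by (subst nn_integral_cmult[symmetric]) (auto simp: ennreal_mult mult.assoc)
    then show "enn_powr (M x) p \<le> (\<integral>\<^sup>+ k. ennreal (K powr p * K powr (of_int k * p)) * indicator {k. ennreal (K powr of_int k) < M x} k \<partial>count_space (UNIV :: int set))"
      using enn_powr_le_geometric_sum[OF K p, of "M x"] by simp
  qed simp
  also have "\<dots> = ennreal (K powr p) * (\<integral>\<^sup>+ k. a k \<partial>count_space UNIV)"
    by (subst swap) (use Mm in \<open>auto simp: a_def nn_integral_cmult[symmetric] ennreal_mult mult.assoc\<close>)
  also have "\<dots> \<le> ennreal (K powr p) * (2 * (\<integral>\<^sup>+ k. ennreal (K powr p) * b k \<partial>count_space UNIV))"
    by (intro mult_left_mono halving_recursion_sum[where a = a and b = "\<lambda>k. ennreal (K powr p) * b k", OF step aL L]) simp_all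
  also have "\<dots> = ennreal (2 * K powr p * K powr p) * (\<integral>\<^sup>+ k. b k \<partial>count_space UNIV)"
    by (subst nn_integral_cmult) (simp_all add: ennreal_mult mult_ac)
  also have "(\<integral>\<^sup>+ k. b k \<partial>count_space UNIV) = (\<integral>\<^sup>+ x. ennreal (w x) * (\<integral>\<^sup>+ k. ennreal (K powr (of_int k * p)) * indicator {k. \<gamma> * K powr of_int k < g x} k \<partial>count_space UNIV) \<partial>lebesgue)"
    unfolding b_def by (subst swap) (use gm in auto)
  also have "\<dots> \<le> (\<integral>\<^sup>+ x. ennreal (1 / (1 - K powr (- p)) / \<gamma> powr p) * (ennreal (w x) * ennreal (g x powr p)) \<partial>lebesgue)"
  proof (rule nn_integral_mono)
    fix x
    have c: "K powr (- p) < 1" using K p powr_less_mono[of "- p" 0 K] by simp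
    have "{k::int. \<gamma> * K powr of_int k < g x} = {k. K powr of_int k < g x / \<gamma>}"
      using \<gamma> by (auto simp: field_simps)
    then have "(\<integral>\<^sup>+ k. ennreal (K powr (of_int k * p)) * indicator {k. \<gamma> * K powr of_int k < g x} k \<partial>count_space (UNIV :: int set))
      \<le> ennreal (1 / (1 - K powr (- p)) * (g x / \<gamma>) powr p)"
      using geometric_sum_le[OF K p, of "g x / \<gamma>"] g(2)[of x] \<gamma> by simp
    also have "\<dots> = ennreal (1 / (1 - K powr (- p)) / \<gamma> powr p) * ennreal (g x powr p)"
      using c \<gamma> g(2)[of x] by (subst ennreal_mult[symmetric]) (auto simp: powr_divide)
    finally have "ennreal (w x) * (\<integral>\<^sup>+ k. ennreal (K powr (of_int k * p)) * indicator {k. \<gamma> * K powr of_int k < g x} k \<partial>count_space (UNIV :: int set))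
       \<le> ennreal (w x) * (ennreal (1 / (1 - K powr (- p)) / \<gamma> powr p) * ennreal (g x powr p))"
      by (rule mult_left_mono) simp
    then show "ennreal (w x) * (\<integral>\<^sup>+ k. ennreal (K powr (of_int k * p)) * indicator {k. \<gamma> * K powr of_int k < g x} k \<partial>count_space UNIV)
      \<le> ennreal (1 / (1 - K powr (- p)) / \<gamma> powr p) * (ennreal (w x) * ennreal (g x powr p))"
      by (simp only: mult_ac)
  qed
  also have "\<dots> = ennreal (1 / (1 - K powr (- p)) / \<gamma> powr p) * (\<integral>\<^sup>+ x. ennreal (w x) * ennreal (g x powr p) \<partial>lebesgue)"
    by (rule nn_integral_cmult) measurable
  finally have "(\<integral>\<^sup>+ x. ennreal (w x) * enn_powr (M x) p \<partial>lebesgue) \<le>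
     ennreal (2 * K powr p * K powr p) * (ennreal (1 / (1 - K powr (- p)) / \<gamma> powr p) * (\<integral>\<^sup>+ x. ennreal (w x) * ennreal (g x powr p) \<partial>lebesgue))"
    by (simp add: mult_left_mono)
  also have "\<dots> = ennreal (2 * K powr p * K powr p * (1 / (1 - K powr (- p)) / \<gamma> powr p)) * (\<integral>\<^sup>+ x. ennreal (w x) * ennreal (g x powr p) \<partial>lebesgue)"
  proof -
    have c: "K powr (- p) < 1" using K p powr_less_mono[of "- p" 0 K] by simp
    show ?thesis unfolding mult.assoc[symmetric] using c \<gamma> by (subst ennreal_mult[symmetric]) auto
  qed
  finally show ?thesis by simp
qed

text \<open>The levels K^k t are anchored at the given t, so the desired quantity is the term with
  index 0, and the inhomogeneity of the recursion is a constant multiple of the weak bound \<beta>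
  for g.\<close>

lemma weak_type_of_good_lambda:
  fixes w :: "real^'n \<Rightarrow> real" and M :: "real^'n \<Rightarrow> ennreal" and g :: "real^'n \<Rightarrow> real"
  assumes w: "weight w" and M: "M \<in> borel_measurable lebesgue" and g: "g \<in> borel_measurable lebesgue"
    and K: "1 < K" and p: "0 < p" and \<delta>: "0 \<le> \<delta>" "\<delta> * K powr p \<le> 1 / 2" and \<gamma>: "0 < \<gamma>"
    and GL: "\<And>t. 0 < t \<Longrightarrow> wmeas w {x. ennreal (K * t) < M x \<and> g x \<le> \<gamma> * t} \<le> ennreal \<delta> * wmeas w {x. ennreal t < M x}"
    and bd: "\<And>t. 0 < t \<Longrightarrow> t \<le> t0 \<Longrightarrow> ennreal (t powr p) * wmeas w {x. ennreal t < M x} \<le> L" and L: "L < \<infinity>" and t0: "0 < t0"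
    and \<beta>: "\<And>u. 0 < u \<Longrightarrow> ennreal (u powr p) * wmeas w {x. u < g x} \<le> \<beta>" and t: "0 < t"
  shows "ennreal (t powr p) * wmeas w {x. ennreal t < M x} \<le> ennreal (2 * K powr p / \<gamma> powr p) * \<beta>"
proof -
  define a where "a k = ennreal ((K powr of_int k * t) powr p) * wmeas w {x. ennreal (K powr of_int k * t) < M x}" for k :: int
  obtain k0 :: int where k0: "\<And>k. k \<le> k0 \<Longrightarrow> K powr of_int k * t \<le> t0"
    using powr_less_bound[OF K t t0] by auto
  have aL: "a k \<le> L" if "k \<le> k0" for k
    unfolding a_def using k0[OF that] K t by (intro bd) auto
  have step: "a (k + 1) \<le> ennreal (1 / 2) * a k + ennreal (K powr p / \<gamma> powr p) * \<beta>" for k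
  proof -
    define u where "u = K powr of_int k * t"
    have u: "0 < u" "K powr of_int (k + 1) * t = K * u" using K t by (simp_all add: powr_add u_def)
    have "ennreal (K powr p) * (ennreal (u powr p) * wmeas w {x. \<gamma> * u < g x})
      = ennreal (K powr p / \<gamma> powr p) * (ennreal ((\<gamma> * u) powr p) * wmeas w {x. \<gamma> * u < g x})"
      unfolding mult.assoc[symmetric] using \<gamma> by (simp add: ennreal_mult[symmetric] powr_mult)
    also have "\<dots> \<le> ennreal (K powr p / \<gamma> powr p) * \<beta>"
      using \<gamma> u by (intro mult_left_mono \<beta>) auto
    finally show ?thesis
      using good_lambda_geometric_step[OF w M g K p \<delta> u(1) GL[OF u(1)]] unfolding a_def u(2) u_def[symmetric]
      by (meson add_left_mono order_trans)
  qed
  have "a 0 \<le> (\<Sum>i. ennreal ((1 / 2) ^ i) * (ennreal (K powr p / \<gamma> powr p) * \<beta>))"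
    by (rule halving_recursion[where a = a and b = "\<lambda>_. ennreal (K powr p / \<gamma> powr p) * \<beta>" and k = 0, OF step aL L])
  also have "\<dots> = 2 * (ennreal (K powr p / \<gamma> powr p) * \<beta>)" by (rule suminf_half_powers)
  also have "\<dots> = ennreal (2 * (K powr p / \<gamma> powr p)) * \<beta>"
    by (subst ennreal_mult) (auto simp: mult_ac)
  finally show ?thesis using K t by (simp add: a_def)
qed

text \<open>Integrability does more than make the right-hand side finite: it bounds the radii of the
  witness balls at a fixed level, which the covering argument requires.\<close>

lemma M_rho_weak_type_1:
  fixes \<rho> :: "real^'n \<Rightarrow> real"
  assumes pos: "\<And>x. 0 < \<rho> x" and \<theta>: "0 < \<theta>" and F: "integrable lebesgue F" and t: "0 < t"
  shows "ennreal t * emeasure lebesgue {x. ennreal t < M_rho \<rho> \<theta> F x} \<le> 5 ^ CARD('n) * (\<integral>\<^sup>+ x. ennreal \<bar>F x\<bar> \<partial>lebesgue)"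
proof -
  let ?I = "\<integral>\<^sup>+ x. ennreal \<bar>F x\<bar> \<partial>lebesgue"
  have "?I < \<infinity>" using F by (simp add: integrable_iff_bounded)
  then obtain I where I: "?I = ennreal I" "0 \<le> I" by (cases ?I) auto
  have [measurable]: "F \<in> borel_measurable lebesgue" using F by auto
  define v where "v = unit_ball_vol (real CARD('n))"
  have v: "0 < v" by (simp add: v_def unit_ball_vol_pos)
  have "ennreal t * emeasure lebesgue {x. ennreal t < M_rho \<rho> \<theta> F x} \<le> 5 ^ DIM(real^'n) * (\<integral>\<^sup>+ x \<in> UNIV. ennreal \<bar>F x\<bar> \<partial>lebesgue)"
  proof (rule weak_type_balls)
    show "{x. ennreal t < M_rho \<rho> \<theta> F x} \<in> sets lebesgue"
      using open_M_rho_superlevel[of "ennreal t" \<rho> \<theta> F] by simp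
    fix y assume "y \<in> {x. ennreal t < M_rho \<rho> \<theta> F x}"
    then obtain c r where cr: "0 < r" "y \<in> ball c r"
      "ennreal (t * Psi \<rho> \<theta> c r * measure lebesgue (ball c r)) < (\<integral>\<^sup>+ z \<in> ball c r. ennreal \<bar>F z\<bar> \<partial>lebesgue)"
      using t by (elim CollectE M_rho_gtD[OF _ pos]) auto
    have le: "ennreal (t * measure lebesgue (ball c r)) \<le> ennreal (t * Psi \<rho> \<theta> c r * measure lebesgue (ball c r))"
      using mult_left_mono[OF Psi_ge_1[of \<rho> c r \<theta>], of "t * measure lebesgue (ball c r)"] pos[of c] cr(1) \<theta> t
      by (intro ennreal_leI) (simp add: mult_ac)
    have eq: "ennreal t * emeasure lebesgue (ball c r) = ennreal (t * measure lebesgue (ball c r))"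
      unfolding emeasure_ball_eq_measure using t by (intro ennreal_mult[symmetric]) auto
    have le': "ennreal t * emeasure lebesgue (ball c r) \<le> (\<integral>\<^sup>+ z \<in> ball c r. ennreal \<bar>F z\<bar> \<partial>lebesgue)"
      unfolding eq using le cr(3) by simp
    also have "\<dots> \<le> ?I" by (intro nn_integral_mono) (auto simp: indicator_def)
    finally have "t * measure lebesgue (ball c r) \<le> I" unfolding eq I using I by simp
    then have rn: "t * (v * r ^ CARD('n)) \<le> I" using cr(1) measure_lebesgue_ball[of r c] by (simp add: v_def)
    \<comment> \<open>The available bound is for r^n; it controls r itself only when r \<ge>
      1.\<close>
    have "r \<le> max 1 (I / (t * v))"
    proof (cases "r \<le> 1")
      case False
      then have "r ^ 1 \<le> r ^ CARD('n)" by (intro power_increasing) (auto simp: Suc_leI)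
      then have "t * v * r \<le> t * v * r ^ CARD('n)" using t v by (intro mult_left_mono) auto
      also have "\<dots> \<le> I" using rn by (simp only: mult.assoc)
      finally have "r \<le> I / (t * v)" using t v by (simp add: pos_le_divide_eq mult.commute)
      then show ?thesis by simp
    qed simp
    then show "\<exists>c r. 0 < r \<and> r \<le> max 1 (I / (t * v)) \<and> y \<in> ball c r \<and> ball c r \<subseteq> UNIV \<and>
       ennreal t * emeasure lebesgue (ball c r) \<le> (\<integral>\<^sup>+ z \<in> ball c r. ennreal \<bar>F z\<bar> \<partial>lebesgue)"
      using cr le' by (intro exI[of _ c] exI[of _ r]) simp
  qed auto
  then show ?thesis by simp
qed


text \<open>Monotone convergence along truncation heights \<open>Suc N\<close>, which are positive
  as the estimates for truncated weights demand.\<close>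

lemma nn_integral_trunc_limit:
  assumes w: "weight w" and h: "h \<in> borel_measurable lebesgue"
    and le: "\<And>N::nat. (\<integral>\<^sup>+ x. ennreal (min (w x) (real (Suc N))) * h x \<partial>lebesgue) \<le> B"
  shows "(\<integral>\<^sup>+ x. ennreal (w x) * h x \<partial>lebesgue) \<le> B"
proof -
  have [measurable]: "w \<in> borel_measurable lebesgue" "h \<in> borel_measurable lebesgue" using weightD[OF w] h by auto
  have "(\<integral>\<^sup>+ x. ennreal (w x) * h x \<partial>lebesgue) \<le> (\<integral>\<^sup>+ x. (SUP N::nat. ennreal (min (w x) (real (Suc N))) * h x) \<partial>lebesgue)"
  proof (rule nn_integral_mono)
    fix x
    obtain N :: nat where "w x \<le> real N" using real_arch_simple by blast
    then have "min (w x) (real (Suc N)) = w x" by simp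
    then show "ennreal (w x) * h x \<le> (SUP N::nat. ennreal (min (w x) (real (Suc N))) * h x)"
      by (intro SUP_upper2[of N]) auto
  qed
  also have "\<dots> = (SUP N::nat. \<integral>\<^sup>+ x. ennreal (min (w x) (real (Suc N))) * h x \<partial>lebesgue)"
    by (rule nn_integral_monotone_convergence_SUP)
       (auto simp: incseq_def le_fun_def intro!: mult_right_mono ennreal_leI)
  also have "\<dots> \<le> B" using le by (intro SUP_least) auto
  finally show ?thesis .
qed

lemma frac_abs_cont_mono:
  assumes "frac_abs_cont \<rho> s C w" "C \<le> D"
  shows "frac_abs_cont \<rho> s D w"
  unfolding frac_abs_cont_def
proof (intro allI impI)
  fix x r E assume h: "0 < r \<and> r < \<rho> x \<and> E \<in> sets lebesgue \<and> E \<subseteq> ball x r"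
  then have "wmeas w E \<le> ennreal (C * (measure lebesgue E / measure lebesgue (ball x r)) powr (1 / s)) * wmeas w (ball x r)"
    using assms(1) unfolding frac_abs_cont_def by blast
  also have "\<dots> \<le> ennreal (D * (measure lebesgue E / measure lebesgue (ball x r)) powr (1 / s)) * wmeas w (ball x r)"
    using assms(2) by (intro mult_right_mono ennreal_leI) auto
  finally show "wmeas w E \<le> ennreal (D * (measure lebesgue E / measure lebesgue (ball x r)) powr (1 / s)) * wmeas w (ball x r)" .
qed

text \<open>For small \<gamma> the term \<gamma> / K is dominated by (a/K)^\<sigma>, and the whole
  expression is at most a constant times K^(p - \<sigma>/s). The exponent is negative because p <
  q/s, so a large K makes it small.\<close>

lemma exists_good_parameters:
  fixes C a p s K0 :: real and q :: ereal
  assumes C: "0 < C" and a: "1 \<le> a" and s: "1 \<le> s" and p: "0 < p" "ereal p < q / ereal s" and K0: "1 < K0"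
  shows "\<exists>K \<gamma>. K0 \<le> K \<and> 0 < \<gamma> \<and> \<gamma> < 1 \<and> C * (decay q (a / K) + \<gamma> / K) powr (1 / s) * K powr p \<le> 1 / 2"
proof -
  \<comment> \<open>For q = \<infinity> any exponent above s p would do, since \<open>decay\<close>
    vanishes; s (p + 1) is such a choice.\<close>
  define \<sigma> where "\<sigma> = (if q = \<infinity> then s * (p + 1) else real_of_ereal q)"
  have \<sigma>: "p < \<sigma> / s"
  proof (cases q)
    case (real r)
    then show ?thesis using p s by (simp add: \<sigma>_def)
  next
    case MInf
    then show ?thesis using p s by simp
  qed (use s in \<open>simp add: \<sigma>_def\<close>)
  define e where "e = \<sigma> / s - p"
  have e: "0 < e" using \<sigma> by (simp add: e_def)
  \<comment> \<open>The target for K^(-e): multiplied by the accumulated constant it gives exactly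
    1/2. It is reached as soon as K \<ge> d^(-1/e).\<close>
  define d where "d = 1 / (2 * C * (2 * a powr \<sigma>) powr (1 / s))"
  have a0: "0 < a" using a by simp
  have d: "0 < d" using C a0 by (simp add: d_def)
  define K where "K = max K0 (d powr (- 1 / e))"
  have K: "1 < K" "K0 \<le> K" using K0 by (auto simp: K_def)
  define \<gamma> where "\<gamma> = min (1 / 2) (K * (a / K) powr \<sigma>)"
  have \<gamma>: "0 < \<gamma>" "\<gamma> < 1" "\<gamma> / K \<le> (a / K) powr \<sigma>" using K a0 by (auto simp: \<gamma>_def field_simps min_def)
  have "decay q (a / K) \<le> (a / K) powr \<sigma>" by (simp add: decay_def \<sigma>_def)
  then have "decay q (a / K) + \<gamma> / K \<le> 2 * a powr \<sigma> * K powr (- \<sigma>)"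
    using \<gamma>(3) K a0 by (simp add: powr_divide powr_minus_divide)
  then have "(decay q (a / K) + \<gamma> / K) powr (1 / s) \<le> (2 * a powr \<sigma> * K powr (- \<sigma>)) powr (1 / s)"
    using s \<gamma> K by (intro powr_mono2) (auto simp: decay_nonneg add_nonneg_nonneg)
  also have "\<dots> = (2 * a powr \<sigma>) powr (1 / s) * K powr (- \<sigma> / s)"
    by (simp add: powr_mult powr_powr)
  finally have "C * (decay q (a / K) + \<gamma> / K) powr (1 / s) * K powr p \<le> C * ((2 * a powr \<sigma>) powr (1 / s) * K powr (- \<sigma> / s)) * K powr p"
    using C by (intro mult_right_mono mult_left_mono) auto
  also have "\<dots> = C * (2 * a powr \<sigma>) powr (1 / s) * K powr (- e)"
    using K by (simp add: e_def powr_add[symmetric] mult.assoc)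
  also have "\<dots> \<le> C * (2 * a powr \<sigma>) powr (1 / s) * (d powr (- 1 / e)) powr (- e)"
    using C d e K by (intro mult_left_mono powr_mono2') (auto simp: K_def)
  also have "(d powr (- 1 / e)) powr (- e) = d" using d e by (simp add: powr_powr)
  also have "C * (2 * a powr \<sigma>) powr (1 / s) * d = 1 / 2" using C a0 by (simp add: d_def)
  finally show ?thesis using K \<gamma> by blast
qed

section \<open>Norms through their p-th powers\<close>

lemma powr_add_le:
  fixes x y p :: real
  assumes "0 \<le> x" "0 \<le> y" "0 \<le> p"
  shows "(x + y) powr p \<le> 2 powr p * (x powr p + y powr p)"
proof -
  have "(x + y) powr p \<le> (2 * max x y) powr p" using assms by (intro powr_mono2) auto
  also have "\<dots> = 2 powr p * max x y powr p" by (simp add: powr_mult)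
  also have "\<dots> \<le> 2 powr p * (x powr p + y powr p)" by (auto simp: max_def)
  finally show ?thesis .
qed

lemma enn_powr_root_le:
  assumes p: "0 < p" and c: "0 < c" and le: "X \<le> ennreal c * (Y + Z)"
  shows "enn_powr X (1 / p) \<le> ennreal ((2 * c) powr (1 / p)) * (enn_powr Y (1 / p) + enn_powr Z (1 / p))"
proof -
  have "enn_powr X (1 / p) \<le> enn_powr (ennreal c * (Y + Z)) (1 / p)"
    using p by (intro enn_powr_mono le) simp
  also have "\<dots> = ennreal (c powr (1 / p)) * enn_powr (Y + Z) (1 / p)" by (rule enn_powr_cmult[OF c])
  also have "\<dots> \<le> ennreal (c powr (1 / p)) * (ennreal (2 powr (1 / p)) * (enn_powr Y (1 / p) + enn_powr Z (1 / p)))"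
    using p by (intro mult_left_mono enn_powr_add_le) auto
  also have "\<dots> = ennreal ((2 * c) powr (1 / p)) * (enn_powr Y (1 / p) + enn_powr Z (1 / p))"
    by (simp add: mult.assoc[symmetric] ennreal_mult[symmetric] powr_mult mult.commute)
  finally show ?thesis .
qed

lemma enn_powr_weak_quantity:
  assumes "0 < p" "0 < t"
  shows "enn_powr (ennreal t * enn_powr X (1 / p)) p = ennreal (t powr p) * X"
  using assms by (simp add: enn_powr_cmult enn_powr_powr)

lemma weak_quantity_le:
  assumes p: "0 < p" and t: "0 < t"
  shows "ennreal (t powr p) * wmeas w {x. ennreal t < f x} \<le> enn_powr (wLp_weak w p f) p"
proof -
  have "ennreal t * enn_powr (wmeas w {x. ennreal t < f x}) (1 / p) \<le> wLp_weak w p f"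
    unfolding wLp_weak_def using t by (intro SUP_upper) auto
  then show ?thesis
    using enn_powr_mono[of p] p enn_powr_weak_quantity[OF p t] by (metis less_imp_le)
qed

lemma wLp_weak_le:
  assumes p: "0 < p" and le: "\<And>t. 0 < t \<Longrightarrow> ennreal (t powr p) * wmeas w {x. ennreal t < f x} \<le> B"
  shows "wLp_weak w p f \<le> enn_powr B (1 / p)"
  unfolding wLp_weak_def
proof (rule SUP_least)
  fix t :: real assume "t \<in> {0<..}"
  then have t: "0 < t" by simp
  have "ennreal t * enn_powr (wmeas w {x. ennreal t < f x}) (1 / p) = enn_powr (ennreal (t powr p) * wmeas w {x. ennreal t < f x}) (1 / p)"
    using p t enn_powr_weak_quantity[OF p t] enn_powr_powr(2)[OF p] by metis
  also have "\<dots> \<le> enn_powr B (1 / p)" using p le[OF t] by (intro enn_powr_mono) auto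
  finally show "ennreal t * enn_powr (wmeas w {x. ennreal t < f x}) (1 / p) \<le> enn_powr B (1 / p)" .
qed

text \<open>The truncated weight is at most N, so its measure is dominated by N times Lebesgue
  measure, to which the weak (1,1) bound applies. This is where p \<ge> 1 enters: t^p \<le> t for t
  \<le> 1.\<close>

lemma weak_quantity_trunc_finite:
  fixes \<rho> :: "real^'n \<Rightarrow> real"
  assumes pos: "\<And>x. 0 < \<rho> x" and \<theta>: "0 < \<theta>" and F: "integrable lebesgue F" and p: "1 \<le> p" and N: "0 < N"
  shows "\<exists>L<\<infinity>. \<forall>t. 0 < t \<and> t \<le> 1 \<longrightarrow>
      ennreal (t powr p) * wmeas (\<lambda>x. min (w x) N) {x. ennreal t < M_rho \<rho> \<theta> F x} \<le> L"
proof -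
  define I where "I = (5 ^ CARD('n) * (\<integral>\<^sup>+ x. ennreal \<bar>F x\<bar> \<partial>lebesgue) :: ennreal)"
  have "(\<integral>\<^sup>+ x. ennreal \<bar>F x\<bar> \<partial>lebesgue) < \<infinity>" using F by (simp add: integrable_iff_bounded)
  then have I: "ennreal N * I < \<infinity>" by (simp add: I_def ennreal_mult_less_top power_less_top_ennreal)
  have "ennreal (t powr p) * wmeas (\<lambda>x. min (w x) N) {x. ennreal t < M_rho \<rho> \<theta> F x} \<le> ennreal N * I" if t: "0 < t" "t \<le> 1" for t
  proof -
    let ?S = "{x. ennreal t < M_rho \<rho> \<theta> F x}"
    have S: "?S \<in> sets lebesgue" using open_M_rho_superlevel[of "ennreal t" \<rho> \<theta> F] by simp
    have "wmeas (\<lambda>x. min (w x) N) ?S \<le> (\<integral>\<^sup>+ x. ennreal N * indicator ?S x \<partial>lebesgue)"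
      unfolding wmeas_def by (intro nn_integral_mono mult_right_mono ennreal_leI) auto
    also have "\<dots> = ennreal N * emeasure lebesgue ?S" using S by (rule nn_integral_cmult_indicator)
    finally have "ennreal (t powr p) * wmeas (\<lambda>x. min (w x) N) ?S \<le> ennreal t * (ennreal N * emeasure lebesgue ?S)"
      using t p powr_mono'[of 1 p t] by (intro mult_mono ennreal_leI) auto
    also have "\<dots> = ennreal N * (ennreal t * emeasure lebesgue ?S)" by (simp add: mult_ac)
    also have "\<dots> \<le> ennreal N * I"
      unfolding I_def by (intro mult_left_mono M_rho_weak_type_1[OF pos \<theta> F t(1)]) simp
    finally show ?thesis .
  qed
  then show ?thesis using I by blast
qed

text \<open>Boundedness at small levels is the common consequence of all the finiteness assumptions,
  and it suffices for the strong and the weak estimate alike. Both are stated for p-th powers, and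
  uniformly in the weight for fixed \<open>C1\<close>.\<close>

lemma wLp_estimates_if_bounded_at_0:
  fixes \<rho> :: "real^'n \<Rightarrow> real"
  assumes \<rho>: "critical_radius \<rho>" and a: "1 \<le> a" and q: "1 < q" and \<theta>: "0 < \<theta>" and s: "1 \<le> s" and C1: "1 \<le> C1"
    and p: "0 < p" "ereal p < q / ereal s"
  shows "\<exists>C>0. \<forall>w F G H1.
     weight w \<longrightarrow> frac_abs_cont \<rho> s C1 w \<longrightarrow> (\<forall>x. 0 \<le> F x \<and> 0 \<le> G x \<and> 0 \<le> H1 x) \<longrightarrow>
     F \<in> borel_measurable lebesgue \<longrightarrow> G \<in> borel_measurable lebesgue \<longrightarrow> H1 \<in> borel_measurable lebesgue \<longrightarrow>
     good_decomp \<rho> \<theta> q a F G H1 \<longrightarrow>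
     (\<exists>t0>0. \<exists>L<\<infinity>. \<forall>t. 0 < t \<and> t \<le> t0 \<longrightarrow> ennreal (t powr p) * wmeas w {x. ennreal t < M_rho \<rho> \<theta> F x} \<le> L) \<longrightarrow>
     (\<integral>\<^sup>+ x. ennreal (w x) * enn_powr (M_rho \<rho> \<theta> F x) p \<partial>lebesgue)
        \<le> ennreal C * ((\<integral>\<^sup>+ x. ennreal (w x) * enn_powr (ennreal (G x)) p \<partial>lebesgue) + (\<integral>\<^sup>+ x. ennreal (w x) * enn_powr (ennreal (H1 x)) p \<partial>lebesgue)) \<and>
     (\<forall>t>0. ennreal (t powr p) * wmeas w {x. ennreal t < M_rho \<rho> \<theta> F x}
        \<le> ennreal C * (enn_powr (wLp_weak w p (\<lambda>x. ennreal (G x))) p + enn_powr (wLp_weak w p (\<lambda>x. ennreal (H1 x))) p))"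
proof -
  obtain C2 where C2: "0 < C2" and GL: "\<And>w F G H1 lam K \<gamma>.
     weight w \<Longrightarrow> frac_abs_cont \<rho> s C1 w \<Longrightarrow> (\<forall>x. 0 \<le> F x \<and> 0 \<le> G x \<and> 0 \<le> H1 x) \<Longrightarrow>
     F \<in> borel_measurable lebesgue \<Longrightarrow> G \<in> borel_measurable lebesgue \<Longrightarrow> H1 \<in> borel_measurable lebesgue \<Longrightarrow>
     good_decomp \<rho> \<theta> q a F G H1 \<Longrightarrow> 0 < lam \<Longrightarrow> 4 * a + 2 * 3 ^ CARD('n) \<le> K \<Longrightarrow> 0 < \<gamma> \<Longrightarrow> \<gamma> < 1 \<Longrightarrow>
     wmeas w {x. ennreal (K * lam) < M_rho \<rho> \<theta> F x \<and> G x + H1 x \<le> \<gamma> * lam}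
        \<le> ennreal (C2 * (decay q (a / K) + \<gamma> / K) powr (1 / s)) * wmeas w {x. ennreal lam < M_rho \<rho> \<theta> F x}"
    using good_lambda[OF \<rho> a q \<theta> s C1] by blast
  have "(0::real) < 2 * 3 ^ CARD('n)" by simp
  then have "1 < 4 * a + 2 * 3 ^ CARD('n)" using a by linarith
  from exists_good_parameters[OF C2 a s p this] obtain K \<gamma> where K: "4 * a + 2 * 3 ^ CARD('n) \<le> K" and \<gamma>: "0 < \<gamma>" "\<gamma> < 1"
    and \<delta>: "C2 * (decay q (a / K) + \<gamma> / K) powr (1 / s) * K powr p \<le> 1 / 2" by blast
  have K1: "1 < K" using K \<open>1 < 4 * a + 2 * 3 ^ CARD('n)\<close> by linarith
  define \<delta>' where "\<delta>' = C2 * (decay q (a / K) + \<gamma> / K) powr (1 / s)"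
  have \<delta>': "0 \<le> \<delta>'" "\<delta>' * K powr p \<le> 1 / 2" using C2 \<delta> by (auto simp: \<delta>'_def)
  define A where "A = 2 * K powr p * K powr p * (1 / (1 - K powr (- p))) / \<gamma> powr p"
  define B where "B = 2 * K powr p / \<gamma> powr p"
  have "K powr (- p) < 1" using K1 p powr_less_mono[of "- p" 0 K] by simp
  then have A: "0 < A" using K1 \<gamma> by (simp add: A_def)
  have B: "0 < B" using K1 \<gamma> by (simp add: B_def)
  \<comment> \<open>The factor 2^p comes from separating G from H1: in the strong estimate by the
    power of a sum, in the weak one because g > u forces one of them above u/2.\<close>
  define C where "C = (A + B) * 2 powr p"
  have C: "0 < C" using A B by (simp add: C_def)
  have "(\<integral>\<^sup>+ x. ennreal (w x) * enn_powr (M_rho \<rho> \<theta> F x) p \<partial>lebesgue)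
        \<le> ennreal C * ((\<integral>\<^sup>+ x. ennreal (w x) * enn_powr (ennreal (G x)) p \<partial>lebesgue) + (\<integral>\<^sup>+ x. ennreal (w x) * enn_powr (ennreal (H1 x)) p \<partial>lebesgue)) \<and>
     (\<forall>t>0. ennreal (t powr p) * wmeas w {x. ennreal t < M_rho \<rho> \<theta> F x}
        \<le> ennreal C * (enn_powr (wLp_weak w p (\<lambda>x. ennreal (G x))) p + enn_powr (wLp_weak w p (\<lambda>x. ennreal (H1 x))) p))"
    if w: "weight w" and fac: "frac_abs_cont \<rho> s C1 w" and nn: "\<forall>x. 0 \<le> F x \<and> 0 \<le> G x \<and> 0 \<le> H1 x"
      and meas: "F \<in> borel_measurable lebesgue" "G \<in> borel_measurable lebesgue" "H1 \<in> borel_measurable lebesgue"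
      and gd: "good_decomp \<rho> \<theta> q a F G H1"
      and bd: "\<exists>t0>0. \<exists>L<\<infinity>. \<forall>t. 0 < t \<and> t \<le> t0 \<longrightarrow> ennreal (t powr p) * wmeas w {x. ennreal t < M_rho \<rho> \<theta> F x} \<le> L"
    for w F G H1
  proof -
    define g where "g x = G x + H1 x" for x
    have [measurable]: "G \<in> borel_measurable lebesgue" "H1 \<in> borel_measurable lebesgue" "w \<in> borel_measurable lebesgue"
      using meas weightD[OF w] by auto
    have g: "g \<in> borel_measurable lebesgue" "\<And>x. 0 \<le> g x" using nn by (auto simp: g_def[abs_def])
    have GL': "wmeas w {x. ennreal (K * t) < M_rho \<rho> \<theta> F x \<and> g x \<le> \<gamma> * t} \<le> ennreal \<delta>' * wmeas w {x. ennreal t < M_rho \<rho> \<theta> F x}" if "0 < t" for t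
      unfolding g_def \<delta>'_def by (rule GL[OF w fac nn meas gd that K \<gamma>])
    obtain t0 L where t0: "0 < t0" and L: "L < \<infinity>" and bd': "\<And>t. 0 < t \<Longrightarrow> t \<le> t0 \<Longrightarrow> ennreal (t powr p) * wmeas w {x. ennreal t < M_rho \<rho> \<theta> F x} \<le> L"
      using bd by blast
    have AC: "A * 2 powr p \<le> C" "B * 2 powr p \<le> C" using A B by (auto simp: C_def algebra_simps)
    have "(\<integral>\<^sup>+ x. ennreal (w x) * enn_powr (M_rho \<rho> \<theta> F x) p \<partial>lebesgue) \<le> ennreal A * (\<integral>\<^sup>+ x. ennreal (w x) * ennreal (g x powr p) \<partial>lebesgue)"
      unfolding A_def by (rule strong_type_of_good_lambda[OF w M_rho_measurable g K1 p(1) \<delta>' \<gamma>(1) GL' bd' L t0])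
    also have "(\<integral>\<^sup>+ x. ennreal (w x) * ennreal (g x powr p) \<partial>lebesgue) \<le>
       (\<integral>\<^sup>+ x. ennreal (2 powr p) * (ennreal (w x) * enn_powr (ennreal (G x)) p + ennreal (w x) * enn_powr (ennreal (H1 x)) p) \<partial>lebesgue)"
    proof (rule nn_integral_mono)
      fix x
      have "ennreal (g x powr p) \<le> ennreal (2 powr p * (G x powr p + H1 x powr p))"
        unfolding g_def using nn p by (intro ennreal_leI powr_add_le) auto
      also have "\<dots> = ennreal (2 powr p) * (enn_powr (ennreal (G x)) p + enn_powr (ennreal (H1 x)) p)"
        using nn by (simp add: ennreal_mult enn_powr_ennreal)
      finally have "ennreal (w x) * ennreal (g x powr p) \<le> ennreal (w x) * (ennreal (2 powr p) * (enn_powr (ennreal (G x)) p + enn_powr (ennreal (H1 x)) p))"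
        by (rule mult_left_mono) simp
      then show "ennreal (w x) * ennreal (g x powr p) \<le> ennreal (2 powr p) * (ennreal (w x) * enn_powr (ennreal (G x)) p + ennreal (w x) * enn_powr (ennreal (H1 x)) p)"
        by (simp only: distrib_left mult_ac)
    qed
    also have "\<dots> = ennreal (2 powr p) * ((\<integral>\<^sup>+ x. ennreal (w x) * enn_powr (ennreal (G x)) p \<partial>lebesgue) + (\<integral>\<^sup>+ x. ennreal (w x) * enn_powr (ennreal (H1 x)) p \<partial>lebesgue))"
      by (subst nn_integral_cmult) (simp_all add: nn_integral_add)
    finally have "(\<integral>\<^sup>+ x. ennreal (w x) * enn_powr (M_rho \<rho> \<theta> F x) p \<partial>lebesgue) \<le> ennreal A * (ennreal (2 powr p) *
       ((\<integral>\<^sup>+ x. ennreal (w x) * enn_powr (ennreal (G x)) p \<partial>lebesgue) + (\<integral>\<^sup>+ x. ennreal (w x) * enn_powr (ennreal (H1 x)) p \<partial>lebesgue)))"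
      by (simp add: mult_left_mono)
    also have "\<dots> \<le> ennreal C * ((\<integral>\<^sup>+ x. ennreal (w x) * enn_powr (ennreal (G x)) p \<partial>lebesgue) + (\<integral>\<^sup>+ x. ennreal (w x) * enn_powr (ennreal (H1 x)) p \<partial>lebesgue))"
      unfolding mult.assoc[symmetric] using A AC by (intro mult_right_mono) (simp_all add: ennreal_mult[symmetric] ennreal_leI)
    finally have strong: "(\<integral>\<^sup>+ x. ennreal (w x) * enn_powr (M_rho \<rho> \<theta> F x) p \<partial>lebesgue)
      \<le> ennreal C * ((\<integral>\<^sup>+ x. ennreal (w x) * enn_powr (ennreal (G x)) p \<partial>lebesgue) + (\<integral>\<^sup>+ x. ennreal (w x) * enn_powr (ennreal (H1 x)) p \<partial>lebesgue))" .
    define \<beta> where "\<beta> = enn_powr (wLp_weak w p (\<lambda>x. ennreal (G x))) p + enn_powr (wLp_weak w p (\<lambda>x. ennreal (H1 x))) p"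
    have weak_g: "ennreal (u powr p) * wmeas w {x. u < g x} \<le> ennreal (2 powr p) * \<beta>" if u: "0 < u" for u
    proof -
      have sm: "{x. ennreal (u / 2) < ennreal (G x)} \<in> sets lebesgue" "{x. ennreal (u / 2) < ennreal (H1 x)} \<in> sets lebesgue"
      proof -
        have "{x \<in> space lebesgue. ennreal (u / 2) < ennreal (G x)} \<in> sets lebesgue" "{x \<in> space lebesgue. ennreal (u / 2) < ennreal (H1 x)} \<in> sets lebesgue"
          by measurable
        then show "{x. ennreal (u / 2) < ennreal (G x)} \<in> sets lebesgue" "{x. ennreal (u / 2) < ennreal (H1 x)} \<in> sets lebesgue" by simp_all
      qed
      have "{x. u < g x} \<subseteq> {x. ennreal (u / 2) < ennreal (G x)} \<union> {x. ennreal (u / 2) < ennreal (H1 x)}"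
        using u nn by (auto simp: g_def ennreal_less_iff)
      then have "wmeas w {x. u < g x} \<le> wmeas w {x. ennreal (u / 2) < ennreal (G x)} + wmeas w {x. ennreal (u / 2) < ennreal (H1 x)}"
        using wmeas_Un[OF w sm] by (meson order_trans wmeas_mono)
      then have "ennreal (u powr p) * wmeas w {x. u < g x} \<le> ennreal (u powr p) * (wmeas w {x. ennreal (u / 2) < ennreal (G x)} + wmeas w {x. ennreal (u / 2) < ennreal (H1 x)})"
        by (rule mult_left_mono) simp
      also have u_split: "ennreal (u powr p) = ennreal (2 powr p) * ennreal ((u / 2) powr p)"
        using powr_mult[of 2 "u / 2" p] by (simp add: ennreal_mult[symmetric])
      also have "ennreal (2 powr p) * ennreal ((u / 2) powr p) * (wmeas w {x. ennreal (u / 2) < ennreal (G x)} + wmeas w {x. ennreal (u / 2) < ennreal (H1 x)})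
        = ennreal (2 powr p) * (ennreal ((u / 2) powr p) * wmeas w {x. ennreal (u / 2) < ennreal (G x)} + ennreal ((u / 2) powr p) * wmeas w {x. ennreal (u / 2) < ennreal (H1 x)})"
        by (simp only: mult.assoc distrib_left)
      also have "\<dots> \<le> ennreal (2 powr p) * \<beta>"
        unfolding \<beta>_def using u p by (intro mult_left_mono add_mono weak_quantity_le) auto
      finally show ?thesis unfolding u_split .
    qed
    have weak: "ennreal (t powr p) * wmeas w {x. ennreal t < M_rho \<rho> \<theta> F x} \<le> ennreal C * \<beta>" if t: "0 < t" for t
    proof -
      have "ennreal (t powr p) * wmeas w {x. ennreal t < M_rho \<rho> \<theta> F x} \<le> ennreal B * (ennreal (2 powr p) * \<beta>)"
        unfolding B_def by (rule weak_type_of_good_lambda[OF w M_rho_measurable g(1) K1 p(1) \<delta>' \<gamma>(1) GL' bd' L t0 weak_g t])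
      also have "\<dots> \<le> ennreal C * \<beta>"
        unfolding mult.assoc[symmetric] using B AC by (intro mult_right_mono) (simp_all add: ennreal_mult[symmetric] ennreal_leI)
      finally show ?thesis .
    qed
    show ?thesis using strong weak unfolding \<beta>_def by blast
  qed
  then show ?thesis using C by blast
qed


section \<open>Norm estimates for a fixed weight\<close>

lemma wmeas_superlevel_le_integral:
  assumes w: "weight w" and M: "M \<in> borel_measurable lebesgue" and p: "0 < p" and t: "0 < t"
  shows "ennreal (t powr p) * wmeas w {x. ennreal t < M x} \<le> (\<integral>\<^sup>+ x. ennreal (w x) * enn_powr (M x) p \<partial>lebesgue)"
proof -
  have [measurable]: "M \<in> borel_measurable lebesgue" "w \<in> borel_measurable lebesgue" using M weightD[OF w] by auto
  have "{x \<in> space lebesgue. ennreal t < M x} \<in> sets lebesgue" by measurable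
  then have [measurable]: "{x. ennreal t < M x} \<in> sets lebesgue" by simp
  have "ennreal (t powr p) * wmeas w {x. ennreal t < M x} = (\<integral>\<^sup>+ x. ennreal (t powr p) * (ennreal (w x) * indicator {x. ennreal t < M x} x) \<partial>lebesgue)"
    unfolding wmeas_def by (rule nn_integral_cmult[symmetric]) simp
  also have "\<dots> \<le> (\<integral>\<^sup>+ x. ennreal (w x) * enn_powr (M x) p \<partial>lebesgue)"
  proof (rule nn_integral_mono)
    fix x
    have "enn_powr (ennreal t) p \<le> enn_powr (M x) p" if "ennreal t < M x"
      using that p by (intro enn_powr_mono) auto
    then show "ennreal (t powr p) * (ennreal (w x) * indicator {x. ennreal t < M x} x) \<le> ennreal (w x) * enn_powr (M x) p"
      using t by (auto simp: indicator_def enn_powr_ennreal mult.commute[of "ennreal (t powr p)"] intro!: mult_left_mono)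
  qed
  finally show ?thesis .
qed

lemma wLp_weak_mono_weight:
  assumes "0 < p" "\<And>x. v x \<le> w x"
  shows "wLp_weak v p f \<le> wLp_weak w p f"
  unfolding wLp_weak_def using assms
  by (intro SUP_mono') (auto intro!: mult_left_mono enn_powr_mono wmeas_le)

text \<open>A finite strong or weak norm bounds the small levels directly. For integrable F and p
  \<ge> 1 the estimates are proved for the truncated weights and passed to the limit, which is
  possible because their constant is independent of the truncation height.\<close>

lemma wLp_estimates:
  fixes \<rho> :: "real^'n \<Rightarrow> real"
  assumes \<rho>: "critical_radius \<rho>" and a: "1 \<le> a" and q: "1 < q" and \<theta>: "0 < \<theta>" and s: "1 \<le> s" and C1: "1 \<le> C1"
    and p: "0 < p" "ereal p < q / ereal s"
    and w: "weight w" and fac: "frac_abs_cont \<rho> s C1 w" "\<And>N. 0 < N \<Longrightarrow> frac_abs_cont \<rho> s C1 (\<lambda>x. min (w x) N)"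
  shows "\<exists>C>0. \<forall>F G H1.
     (\<forall>x. 0 \<le> F x \<and> 0 \<le> G x \<and> 0 \<le> H1 x) \<longrightarrow>
     F \<in> borel_measurable lebesgue \<longrightarrow> G \<in> borel_measurable lebesgue \<longrightarrow> H1 \<in> borel_measurable lebesgue \<longrightarrow>
     good_decomp \<rho> \<theta> q a F G H1 \<longrightarrow>
     ((wLp w p (M_rho \<rho> \<theta> F) < \<infinity> \<or> (1 \<le> p \<and> integrable lebesgue F)) \<longrightarrow>
        wLp w p (M_rho \<rho> \<theta> F) \<le> ennreal C * (wLp w p (\<lambda>x. ennreal (G x)) + wLp w p (\<lambda>x. ennreal (H1 x)))) \<and>
     ((wLp_weak w p (M_rho \<rho> \<theta> F) < \<infinity> \<or> (1 \<le> p \<and> integrable lebesgue F)) \<longrightarrow>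
        wLp_weak w p (M_rho \<rho> \<theta> F) \<le> ennreal C * (wLp_weak w p (\<lambda>x. ennreal (G x)) + wLp_weak w p (\<lambda>x. ennreal (H1 x))))"
proof -
  note pos = critical_radius_pos[OF \<rho>]
  obtain C where C: "0 < C" and est: "\<And>w F G H1.
     weight w \<Longrightarrow> frac_abs_cont \<rho> s C1 w \<Longrightarrow> (\<forall>x. 0 \<le> F x \<and> 0 \<le> G x \<and> 0 \<le> H1 x) \<Longrightarrow>
     F \<in> borel_measurable lebesgue \<Longrightarrow> G \<in> borel_measurable lebesgue \<Longrightarrow> H1 \<in> borel_measurable lebesgue \<Longrightarrow>
     good_decomp \<rho> \<theta> q a F G H1 \<Longrightarrow>
     (\<exists>t0>0. \<exists>L<\<infinity>. \<forall>t. 0 < t \<and> t \<le> t0 \<longrightarrow> ennreal (t powr p) * wmeas w {x. ennreal t < M_rho \<rho> \<theta> F x} \<le> L) \<Longrightarrow>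
     (\<integral>\<^sup>+ x. ennreal (w x) * enn_powr (M_rho \<rho> \<theta> F x) p \<partial>lebesgue)
        \<le> ennreal C * ((\<integral>\<^sup>+ x. ennreal (w x) * enn_powr (ennreal (G x)) p \<partial>lebesgue) + (\<integral>\<^sup>+ x. ennreal (w x) * enn_powr (ennreal (H1 x)) p \<partial>lebesgue)) \<and>
     (\<forall>t>0. ennreal (t powr p) * wmeas w {x. ennreal t < M_rho \<rho> \<theta> F x}
        \<le> ennreal C * (enn_powr (wLp_weak w p (\<lambda>x. ennreal (G x))) p + enn_powr (wLp_weak w p (\<lambda>x. ennreal (H1 x))) p))"
    using wLp_estimates_if_bounded_at_0[OF \<rho> a q \<theta> s C1 p] by blast
  define D where "D = (2 * C) powr (1 / p)"
  have D: "0 < D" using C by (simp add: D_def)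
  have "((wLp w p (M_rho \<rho> \<theta> F) < \<infinity> \<or> (1 \<le> p \<and> integrable lebesgue F)) \<longrightarrow>
        wLp w p (M_rho \<rho> \<theta> F) \<le> ennreal D * (wLp w p (\<lambda>x. ennreal (G x)) + wLp w p (\<lambda>x. ennreal (H1 x)))) \<and>
     ((wLp_weak w p (M_rho \<rho> \<theta> F) < \<infinity> \<or> (1 \<le> p \<and> integrable lebesgue F)) \<longrightarrow>
        wLp_weak w p (M_rho \<rho> \<theta> F) \<le> ennreal D * (wLp_weak w p (\<lambda>x. ennreal (G x)) + wLp_weak w p (\<lambda>x. ennreal (H1 x))))"
    if nn: "\<forall>x. 0 \<le> F x \<and> 0 \<le> G x \<and> 0 \<le> H1 x"
      and meas: "F \<in> borel_measurable lebesgue" "G \<in> borel_measurable lebesgue" "H1 \<in> borel_measurable lebesgue"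
      and gd: "good_decomp \<rho> \<theta> q a F G H1" for F G H1
  proof -
    let ?M = "M_rho \<rho> \<theta> F"
    let ?I = "\<lambda>f. \<integral>\<^sup>+ x. ennreal (w x) * enn_powr (f x) p \<partial>lebesgue"
    let ?bd = "\<lambda>w. \<exists>t0>0. \<exists>L<\<infinity>. \<forall>t. 0 < t \<and> t \<le> t0 \<longrightarrow> ennreal (t powr p) * wmeas w {x. ennreal t < ?M x} \<le> L"
    let ?strong = "?I ?M \<le> ennreal C * (?I (\<lambda>x. ennreal (G x)) + ?I (\<lambda>x. ennreal (H1 x)))"
    let ?weak = "\<forall>t>0. ennreal (t powr p) * wmeas w {x. ennreal t < ?M x}
        \<le> ennreal C * (enn_powr (wLp_weak w p (\<lambda>x. ennreal (G x))) p + enn_powr (wLp_weak w p (\<lambda>x. ennreal (H1 x))) p)"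
    have fin: "?strong \<and> ?weak" if "?bd w"
      by (rule est[OF w fac(1) nn meas gd that])
    have L1: "?strong \<and> ?weak" if p1: "1 \<le> p" and F: "integrable lebesgue F"
    proof -
      have t: "(\<integral>\<^sup>+ x. ennreal (min (w x) N) * enn_powr (?M x) p \<partial>lebesgue)
          \<le> ennreal C * (?I (\<lambda>x. ennreal (G x)) + ?I (\<lambda>x. ennreal (H1 x))) \<and>
         (\<forall>t>0. ennreal (t powr p) * wmeas (\<lambda>x. min (w x) N) {x. ennreal t < ?M x}
          \<le> ennreal C * (enn_powr (wLp_weak w p (\<lambda>x. ennreal (G x))) p + enn_powr (wLp_weak w p (\<lambda>x. ennreal (H1 x))) p))"
        if N: "0 < N" for N
      proof -
        let ?v = "\<lambda>x. min (w x) N"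
        have wv: "weight ?v" using weight_trunc[OF w] N by simp
        have "?bd ?v"
          using weak_quantity_trunc_finite[OF pos \<theta> F p1 N, of w] by (intro exI[of _ 1]) simp
        note e = est[OF wv fac(2)[OF N] nn meas gd this]
        \<comment> \<open>On the right-hand side the truncated weight is replaced by w at once, so
          that only the left-hand side varies with N in the limit.\<close>
        have mono: "(\<integral>\<^sup>+ x. ennreal (?v x) * f x \<partial>lebesgue) \<le> (\<integral>\<^sup>+ x. ennreal (w x) * f x \<partial>lebesgue)" for f
          by (intro nn_integral_mono mult_right_mono ennreal_leI) auto
        have wmono: "enn_powr (wLp_weak ?v p f) p \<le> enn_powr (wLp_weak w p f) p" for f
          using p by (intro enn_powr_mono wLp_weak_mono_weight) auto
        show ?thesis
        proof (intro conjI allI impI)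
          show "(\<integral>\<^sup>+ x. ennreal (min (w x) N) * enn_powr (?M x) p \<partial>lebesgue)
              \<le> ennreal C * (?I (\<lambda>x. ennreal (G x)) + ?I (\<lambda>x. ennreal (H1 x)))"
            by (rule order_trans[OF conjunct1[OF e]]) (intro mult_left_mono add_mono mono zero_le)
          fix t :: real assume "0 < t"
          show "ennreal (t powr p) * wmeas ?v {x. ennreal t < ?M x}
            \<le> ennreal C * (enn_powr (wLp_weak w p (\<lambda>x. ennreal (G x))) p + enn_powr (wLp_weak w p (\<lambda>x. ennreal (H1 x))) p)"
            by (rule order_trans[OF conjunct2[OF e, rule_format, OF \<open>0 < t\<close>]]) (intro mult_left_mono add_mono wmono zero_le)
        qed
      qed
      have [measurable]: "?M \<in> borel_measurable lebesgue" "w \<in> borel_measurable lebesgue"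
        using weightD[OF w] M_rho_measurable by auto
      have ?strong
        by (rule nn_integral_trunc_limit[OF w]) (use t in auto)
      moreover have ?weak
      proof (intro allI impI)
        fix u :: real assume u: "0 < u"
        have "{x \<in> space lebesgue. ennreal u < ?M x} \<in> sets lebesgue" by measurable
        then have [measurable]: "{x. ennreal u < ?M x} \<in> sets lebesgue" by simp
        \<comment> \<open>The weak quantity at a fixed level is rewritten as a weighted integral of
          a fixed function, so the same limit theorem applies to it.\<close>
        have eq: "ennreal (u powr p) * wmeas v {x. ennreal u < ?M x} = (\<integral>\<^sup>+ x. ennreal (v x) * (ennreal (u powr p) * indicator {x. ennreal u < ?M x} x) \<partial>lebesgue)"
          if [measurable]: "v \<in> borel_measurable lebesgue" for v
          unfolding wmeas_def by (subst nn_integral_cmult[symmetric]) (auto simp: mult_ac)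
        show "ennreal (u powr p) * wmeas w {x. ennreal u < ?M x}
          \<le> ennreal C * (enn_powr (wLp_weak w p (\<lambda>x. ennreal (G x))) p + enn_powr (wLp_weak w p (\<lambda>x. ennreal (H1 x))) p)"
          unfolding eq[OF weightD(2)[OF w]]
        proof (rule nn_integral_trunc_limit[OF w])
          fix N :: nat
          have m: "(\<lambda>x. min (w x) (real (Suc N))) \<in> borel_measurable lebesgue" by measurable
          show "(\<integral>\<^sup>+ x. ennreal (min (w x) (real (Suc N))) * (ennreal (u powr p) * indicator {x. ennreal u < ?M x} x) \<partial>lebesgue)
             \<le> ennreal C * (enn_powr (wLp_weak w p (\<lambda>x. ennreal (G x))) p + enn_powr (wLp_weak w p (\<lambda>x. ennreal (H1 x))) p)"
            unfolding eq[OF m, symmetric] using t[of "real (Suc N)"] u by simp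
        qed measurable
      qed
      ultimately show ?thesis ..
    qed
    show ?thesis
    proof (intro conjI impI)
      assume h: "wLp w p ?M < \<infinity> \<or> (1 \<le> p \<and> integrable lebesgue F)"
      have ?strong
      proof (cases "1 \<le> p \<and> integrable lebesgue F")
        case False
        then have "wLp w p ?M \<noteq> \<infinity>" using h by auto
        then have "?I ?M < \<infinity>" unfolding wLp_def enn_powr_eq_top_iff by (simp add: less_top)
        then have "?bd w"
          using wmeas_superlevel_le_integral[OF w M_rho_measurable p(1)] by (intro exI[of _ 1]) auto
        then show ?thesis using fin by blast
      qed (use L1 in blast)
      then show "wLp w p ?M \<le> ennreal D * (wLp w p (\<lambda>x. ennreal (G x)) + wLp w p (\<lambda>x. ennreal (H1 x)))"
        unfolding wLp_def D_def by (rule enn_powr_root_le[OF p(1) C])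
    next
      assume h: "wLp_weak w p ?M < \<infinity> \<or> (1 \<le> p \<and> integrable lebesgue F)"
      have ?weak
      proof (cases "1 \<le> p \<and> integrable lebesgue F")
        case False
        then have "wLp_weak w p ?M \<noteq> \<infinity>" using h by auto
        then have "enn_powr (wLp_weak w p ?M) p \<noteq> \<infinity>" by (simp only: enn_powr_eq_top_iff not_False_eq_True)
        then have "enn_powr (wLp_weak w p ?M) p < \<infinity>" by (simp add: less_top)
        then have "?bd w"
          using weak_quantity_le[OF p(1), of _ w ?M] by (intro exI[of _ 1]) auto
        then show ?thesis using fin by blast
      qed (use L1 in blast)
      then have "wLp_weak w p ?M \<le> enn_powr (ennreal C * (enn_powr (wLp_weak w p (\<lambda>x. ennreal (G x))) p + enn_powr (wLp_weak w p (\<lambda>x. ennreal (H1 x))) p)) (1 / p)"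
        by (intro wLp_weak_le p(1)) auto
      also have "\<dots> \<le> ennreal D * (wLp_weak w p (\<lambda>x. ennreal (G x)) + wLp_weak w p (\<lambda>x. ennreal (H1 x)))"
        using enn_powr_root_le[OF p(1) C order_refl, of "enn_powr (wLp_weak w p (\<lambda>x. ennreal (G x))) p" "enn_powr (wLp_weak w p (\<lambda>x. ennreal (H1 x))) p"]
        unfolding D_def by (simp add: enn_powr_powr(2)[OF p(1)])
      finally show "wLp_weak w p ?M \<le> ennreal D * (wLp_weak w p (\<lambda>x. ennreal (G x)) + wLp_weak w p (\<lambda>x. ennreal (H1 x)))" .
    qed
  qed
  then show ?thesis using D by blast
qed

lemma RH_imp_frac_abs_cont:
  fixes w :: "real^'n \<Rightarrow> real"
  assumes w: "weight w" and s: "1 \<le> s"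
    and RH: "if s = 1 then RH_inf_loc \<rho> w else RH_loc \<rho> (s / (s - 1)) w"
  shows "\<exists>C\<ge>1. frac_abs_cont \<rho> s C w"
proof (cases "s = 1")
  case True
  then show ?thesis using RH_inf_loc_imp_frac_abs_cont[OF w] RH by simp
next
  case False
  then have "1 < s" "RH_loc \<rho> (s / (s - 1)) w" using s RH by simp_all
  then show ?thesis by (rule RH_loc_imp_frac_abs_cont[OF w])
qed

theorem theorem3p1:
  fixes \<rho> :: "real^'n \<Rightarrow> real" and a :: real
  assumes rho: "critical_radius \<rho>"
    and a: "1 \<le> a"
  shows "\<exists>K0::real. 1 \<le> K0 \<and>
    (\<forall>(q::ereal) (\<theta>::real) (s::real) (\<omega>::real^'n \<Rightarrow> real).
      1 < q \<and> 0 < \<theta> \<and> 1 \<le> s \<and> weight \<omega> \<and>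
      (if s = 1 then RH_inf_loc \<rho> \<omega> else RH_loc \<rho> (s / (s - 1)) \<omega>)
      \<longrightarrow>
      (\<exists>C::real. 0 < C \<and>
         (\<forall>F G H1 :: real^'n \<Rightarrow> real.
            (\<forall>x. 0 \<le> F x \<and> 0 \<le> G x \<and> 0 \<le> H1 x) \<and>
            G \<in> borel_measurable lebesgue \<and> H1 \<in> borel_measurable lebesgue \<and>
            locally_integrable F \<and> good_decomp \<rho> \<theta> q a F G H1
            \<longrightarrow>
            (\<forall>lam K \<gamma>::real. 0 < lam \<and> K0 \<le> K \<and> 0 < \<gamma> \<and> \<gamma> < 1 \<longrightarrow>
               wmeas \<omega> {x. ennreal (K * lam) < M_rho \<rho> \<theta> F x \<and> G x + H1 x \<le> \<gamma> * lam}
               \<le> ennreal (C * ((if q = \<infinity> then 0 else (a / K) powr real_of_ereal q)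
                                + \<gamma> / K) powr (1 / s))
                 * wmeas \<omega> {x. ennreal lam < M_rho \<rho> \<theta> F x}))) \<and>
      (\<forall>p::real. 0 < p \<and> ereal p < q / ereal s \<longrightarrow>
         (\<exists>C::real. 0 < C \<and>
           (\<forall>F G H1 :: real^'n \<Rightarrow> real.
              (\<forall>x. 0 \<le> F x \<and> 0 \<le> G x \<and> 0 \<le> H1 x) \<and>
              G \<in> borel_measurable lebesgue \<and> H1 \<in> borel_measurable lebesgue \<and>
              locally_integrable F \<and> good_decomp \<rho> \<theta> q a F G H1
              \<longrightarrow>
              ((wLp \<omega> p (M_rho \<rho> \<theta> F) < \<infinity> \<or> (1 \<le> p \<and> integrable lebesgue F)) \<longrightarrow>
                 wLp \<omega> p (M_rho \<rho> \<theta> F)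
                   \<le> ennreal C * (wLp \<omega> p (\<lambda>x. ennreal (G x)) + wLp \<omega> p (\<lambda>x. ennreal (H1 x)))) \<and>
              ((wLp_weak \<omega> p (M_rho \<rho> \<theta> F) < \<infinity> \<or> (1 \<le> p \<and> integrable lebesgue F)) \<longrightarrow>
                 wLp_weak \<omega> p (M_rho \<rho> \<theta> F)
                   \<le> ennreal C * (wLp_weak \<omega> p (\<lambda>x. ennreal (G x))
                                  + wLp_weak \<omega> p (\<lambda>x. ennreal (H1 x))))))))"
proof -
  \<comment> \<open>The summand 4 a keeps the bound for H below half of the level, and 2 * 3^n rules
    out witness balls reaching the complement of the superlevel set after tripling. Both depend on a
    and the dimension only, so \<open>K0\<close> is fixed before q, \<theta>, s and
    \<omega>.\<close>
  define K0 where "K0 = 4 * a + 2 * 3 ^ CARD('n)"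
  have "(0::real) < 2 * 3 ^ CARD('n)" by simp
  then have K0: "1 \<le> K0" using a unfolding K0_def by linarith
  show ?thesis
  proof (rule exI[of _ K0], intro conjI K0 allI impI, goal_cases)
    case (1 q \<theta> s \<omega>)
    then have q: "1 < q" and \<theta>: "0 < \<theta>" and s: "1 \<le> s" and w: "weight \<omega>"
      and RH: "if s = 1 then RH_inf_loc \<rho> \<omega> else RH_loc \<rho> (s / (s - 1)) \<omega>" by auto
    obtain C1 where C1: "1 \<le> C1" "frac_abs_cont \<rho> s C1 \<omega>"
      using RH_imp_frac_abs_cont[OF w s RH] by blast
    obtain C where C: "0 < C" "\<And>F G H1 lam K \<gamma>.
       (\<forall>x. 0 \<le> F x \<and> 0 \<le> G x \<and> 0 \<le> H1 x) \<Longrightarrow>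
       F \<in> borel_measurable lebesgue \<Longrightarrow> G \<in> borel_measurable lebesgue \<Longrightarrow> H1 \<in> borel_measurable lebesgue \<Longrightarrow>
       good_decomp \<rho> \<theta> q a F G H1 \<Longrightarrow> 0 < lam \<Longrightarrow> K0 \<le> K \<Longrightarrow> 0 < \<gamma> \<Longrightarrow> \<gamma> < 1 \<Longrightarrow>
       wmeas \<omega> {x. ennreal (K * lam) < M_rho \<rho> \<theta> F x \<and> G x + H1 x \<le> \<gamma> * lam}
          \<le> ennreal (C * (decay q (a / K) + \<gamma> / K) powr (1 / s)) * wmeas \<omega> {x. ennreal lam < M_rho \<rho> \<theta> F x}"
      using good_lambda[OF rho a q \<theta> s C1(1)] w C1(2) unfolding K0_def by blast
    show ?case
      by (rule exI[of _ C]) (use C in \<open>simp add: decay_def locally_integrable_def\<close>)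
  next
    case (2 q \<theta> s \<omega> p)
    then have q: "1 < q" and \<theta>: "0 < \<theta>" and s: "1 \<le> s" and w: "weight \<omega>" and p: "0 < p" "ereal p < q / ereal s"
      and RH: "if s = 1 then RH_inf_loc \<rho> \<omega> else RH_loc \<rho> (s / (s - 1)) \<omega>" by auto
    obtain C1 where C1: "1 \<le> C1" "frac_abs_cont \<rho> s C1 \<omega>"
      using RH_imp_frac_abs_cont[OF w s RH] by blast
    obtain C2 where C2: "1 \<le> C2" "\<And>N. 0 < N \<Longrightarrow> frac_abs_cont \<rho> s C2 (\<lambda>x. min (\<omega> x) N)"
      using frac_abs_cont_trunc[OF w C1(1) s C1(2)] by blast
    \<comment> \<open>One constant for the weight and all its truncations, as the limiting argument
      requires.\<close>
    define D where "D = max C1 C2"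
    have D: "1 \<le> D" "C1 \<le> D" "C2 \<le> D" using C1 by (auto simp: D_def)
    have trunc: "frac_abs_cont \<rho> s D (\<lambda>x. min (\<omega> x) N)" if "0 < N" for N
      using frac_abs_cont_mono[OF C2(2)[OF that] D(3)] .
    from wLp_estimates[OF rho a q \<theta> s D(1) p w frac_abs_cont_mono[OF C1(2) D(2)] trunc]
    show ?case
      by (rule ex_forward) (assumption, erule conj_forward, assumption, simp add: locally_integrable_def)
  qed
qed

end
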